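(* Let $A\in\mathcal A_{\$}(\mathbf X)$ be a rich band-dominated operator on $\mathbf X=l^p(\mathbb Z^N,X)$, let $c\ge\|A\|$ (with $c>0$), and suppose that the sequence $(A_n)_{n\in\mathbb N}$ of finite sections $A_n:=P_nAP_n:\mathrm{im}\,P_n\to\mathrm{im}\,P_n$ is stable. Then the condition numbers $\kappa(A_n)=\|A_n\|\,\|A_n^{-1}\|$ satisfy $$\limsup_{n\to\infty}\kappa(A_n)=\|A\|\cdot\max_{S\in S(A,c)}\|S^{-1}\|,$$ where $S(A,c)$ is the stability spectrum of $A$.
   Context: Let $N\in\mathbb N$, $p\in\{0\}\cup[1,\infty]$, and let $X\ne\{0\}$ be a complex Banach space. $\mathbf X=l^p(\mathbb Z^N,X)$ is the space of sequences $x=(x_i)_{i\in\mathbb Z^N}$, $x_i\in X$, with the usual $p$-norm for $1\le p\le\infty$; $l^0(\mathbb Z^N,X)$ denotes the closure in $l^\infty(\mathbb Z^N,X)$ of the finitely supported sequences. $P_n:=\chi_{\{-n,\dots,n\}^N}I$ (multiplication by the characteristic function), $Q_n:=I-P_n$ ($n\in\mathbb N$), $\mathcal P:=(P_n)$. $\mathcal K(\mathbf X,\mathcal P):=\{K\in\mathcal L(\mathbf X):\|Q_nK\|+\|KQ_n\|\to0\}$; $\mathcal L(\mathbf X,\mathcal P):=\{A\in\mathcal L(\mathbf X): AK,KA\in\mathcal K(\mathbf X,\mathcal P)\ \forall K\in\mathcal K(\mathbf X,\mathcal P)\}$. $(B_n)\subset\mathcal L(\mathbf X)$ converges $\mathcal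 P$-strongly to $B$ if $\|K(B_n-B)\|+\|(B_n-B)K\|\to0$ for every $K\in\mathcal K(\mathbf X,\mathcal P)$. Shifts: $(V_kx)_i=x_{i-k}$ for $k\in\mathbb Z^N$. For $A\in\mathcal L(\mathbf X,\mathcal P)$ and $h=(h_n)\subset\mathbb Z^N$ with $|h_n|\to\infty$, the limit operator $A_h$ is the $\mathcal P$-strong limit of $V_{-h_n}AV_{h_n}$, if it exists. $A$ is rich if every $h\subset\mathbb Z^N$ tending to infinity has a subsequence $g$ such that $A_g$ exists. A band operator is a finite sum $\sum_\alpha a_\alpha V_\alpha$ with $a_\alpha\in l^\infty(\mathbb Z^N,\mathcal L(X))$ acting by $(a_\alpha x)_i=a_\alpha(i)x_i$; $\mathcal A(\mathbf X)\subset\mathcal L(\mathbf X,\mathcal P)$ is the norm closure in $\mathcal L(\mathbf X)$ of the set of band operators; $\mathcal A_{\$}(\mathbf X)$ is the set of rich operators in $\mathcal A(\mathbf X)$. $(A_n)$ is stable if there is $n_0$ such that all $A_n:\mathrm{im}\,P_n\to\mathrm{im}\,P_n$ with $n\ge n_0$ are invertible and $\sup_{n\ge n_0}\|A_n^{-1}\|<\infty$. For $c>0$ put $A_{n,c}:=P_nAP_n+cQ_n\in\mathcal L(\mathbf X)$. The stability spectrum $S(A,c)$ consists of the operator $A$ itself together with all truncated limit operators of $A$ extended by $c$ times the identity, that is, all $\mathcal P$-strong limits of sequences $V_{-h_k}A_{m_k,c}V_{h_k}$ as $k\to\infty$, where $m_k\in\mathbb N$, $m_k\to\infty$, and $h_k\in\mathbb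 Z^N$ with $|h_k|_\infty=m_k$ (these limits have the form $\chi_UA_h\chi_UI+c\,\chi_{\mathbb Z^N\setminus U}I$, with $A_h$ a limit operator of $A$ and $U\subset\mathbb Z^N$ the limit of the shifted cubes $\{-m_k,\dots,m_k\}^N-h_k$). *)

theory Defs
  imports "HOL-Analysis.Analysis"
begin

section \<open>Complex Banach spaces\<close>

class complex_banach = banach +
  fixes scaleC :: "complex \<Rightarrow> 'a \<Rightarrow> 'a" (infixr "*\<^sub>C" 75)
  assumes scaleC_add_right: "a *\<^sub>C (x + y) = a *\<^sub>C x + a *\<^sub>C y"
    and scaleC_add_left: "(a + b) *\<^sub>C x = a *\<^sub>C x + b *\<^sub>C x"
    and scaleC_scaleC: "a *\<^sub>C (b *\<^sub>C x) = (a * b) *\<^sub>C x"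
    and scaleC_of_real: "complex_of_real r *\<^sub>C x = r *\<^sub>R x"
    and norm_scaleC: "norm (a *\<^sub>C x) = cmod a * norm x"

instantiation complex :: complex_banach
begin
definition scaleC_complex :: "complex \<Rightarrow> complex \<Rightarrow> complex"
  where "scaleC_complex a x = a * x"
instance
  by standard (auto simp: scaleC_complex_def algebra_simps scaleR_conv_of_real norm_mult)
end


section \<open>The sequence spaces\<close>

text \<open>Elements of \<open>\<int>\<^sup>N\<close> have type \<open>int ^ 'n\<close> with \<open>N = CARD('n)\<close>. Since the exponent
  \<open>p\<close> is a variable, \<open>l\<^sup>p(\<int>\<^sup>N, X)\<close> is a set of functions rather than a type. The exponent is an
  extended nonnegative real, and \<open>p = 0\<close> stands for the closure of the finitely supported sequences
  in \<open>l\<^sup>\<infinity>\<close>, with the supremum norm.\<close>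

definition sup_norm :: "(int ^ 'n \<Rightarrow> 'a::complex_banach) \<Rightarrow> real" where
  "sup_norm x = (SUP i. norm (x i))"

definition lp_space :: "ennreal \<Rightarrow> (int ^ 'n \<Rightarrow> 'a::complex_banach) set" where
  "lp_space p =
    (if p = 0 then {x. bounded (range x) \<and>
        (\<forall>\<epsilon>>0. \<exists>y. finite {i. y i \<noteq> 0} \<and> sup_norm (x - y) < \<epsilon>)}
     else if p = \<infinity> then {x. bounded (range x)}
     else {x. (\<lambda>i. norm (x i) powr enn2real p) summable_on UNIV})"

definition lp_norm :: "ennreal \<Rightarrow> (int ^ 'n \<Rightarrow> 'a::complex_banach) \<Rightarrow> real" where
  "lp_norm p x =
    (if p = 0 \<or> p = \<infinity> then sup_norm x
     else (\<Sum>\<^sub>\<infinity>i. norm (x i) powr enn2real p) powr (1 / enn2real p))"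


section \<open>Bounded operators\<close>

type_synonym ('n, 'a) seq_op = "(int ^ 'n \<Rightarrow> 'a) \<Rightarrow> (int ^ 'n \<Rightarrow> 'a)"

text \<open>\<open>bounded_ops p E\<close> is the set of bounded complex-linear operators on a linear subspace \<open>E\<close> of
  \<open>lp_space p\<close>. Values outside \<open>E\<close> are unconstrained and irrelevant: two functions that
  agree on \<open>E\<close> represent the same operator, with the same norm, invertibility and inverse.\<close>

definition bounded_ops ::
    "ennreal \<Rightarrow> (int ^ 'n \<Rightarrow> 'a::complex_banach) set \<Rightarrow> ('n, 'a) seq_op set" where
  "bounded_ops p E = {A. A ` E \<subseteq> E \<and>
     (\<forall>x\<in>E. \<forall>y\<in>E. A (\<lambda>i. x i + y i) = (\<lambda>i. A x i + A y i)) \<and>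
     (\<forall>x\<in>E. \<forall>a. A (\<lambda>i. a *\<^sub>C x i) = (\<lambda>i. a *\<^sub>C A x i)) \<and>
     (\<exists>C. \<forall>x\<in>E. lp_norm p (A x) \<le> C * lp_norm p x)}"

definition op_norm ::
    "ennreal \<Rightarrow> (int ^ 'n \<Rightarrow> 'a::complex_banach) set \<Rightarrow> ('n, 'a) seq_op \<Rightarrow> real" where
  "op_norm p E A = (SUP x\<in>{x\<in>E. lp_norm p x \<le> 1}. lp_norm p (A x))"

text \<open>Invertibility in \<open>bounded_ops p E\<close>; the inverse is \<open>inv_into E A\<close>.\<close>

definition op_invertible ::
    "ennreal \<Rightarrow> (int ^ 'n \<Rightarrow> 'a::complex_banach) set \<Rightarrow> ('n, 'a) seq_op \<Rightarrow> bool" where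
  "op_invertible p E A \<longleftrightarrow>
     A \<in> bounded_ops p E \<and> bij_betw A E E \<and> inv_into E A \<in> bounded_ops p E"

abbreviation Lp :: "ennreal \<Rightarrow> ('n::finite, 'a::complex_banach) seq_op set" where
  "Lp p \<equiv> bounded_ops p (lp_space p)"

abbreviation Lp_norm :: "ennreal \<Rightarrow> ('n::finite, 'a::complex_banach) seq_op \<Rightarrow> real" where
  "Lp_norm p \<equiv> op_norm p (lp_space p)"


section \<open>The approximate projections and P-strong convergence\<close>

definition idx_norm :: "int ^ 'n \<Rightarrow> int" where
  "idx_norm i = Max (range (\<lambda>j. \<bar>i $ j\<bar>))"

definition Proj :: "nat \<Rightarrow> ('n::finite, 'a::complex_banach) seq_op" where
  "Proj n x = (\<lambda>i. if idx_norm i \<le> int n then x i else 0)"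

definition Coproj :: "nat \<Rightarrow> ('n::finite, 'a::complex_banach) seq_op" where
  "Coproj n x = x - Proj n x"

definition K_ops :: "ennreal \<Rightarrow> ('n::finite, 'a::complex_banach) seq_op set" where
  "K_ops p = {K \<in> Lp p.
     (\<lambda>n. Lp_norm p (Coproj n \<circ> K) + Lp_norm p (K \<circ> Coproj n)) \<longlonglongrightarrow> 0}"

definition LP_ops :: "ennreal \<Rightarrow> ('n::finite, 'a::complex_banach) seq_op set" where
  "LP_ops p = {A \<in> Lp p. \<forall>K\<in>K_ops p. A \<circ> K \<in> K_ops p \<and> K \<circ> A \<in> K_ops p}"

definition P_strong_lim ::
    "ennreal \<Rightarrow> (nat \<Rightarrow> ('n::finite, 'a::complex_banach) seq_op) \<Rightarrow> ('n, 'a) seq_op \<Rightarrow> bool" where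
  "P_strong_lim p B B' \<longleftrightarrow> (\<forall>n. B n \<in> Lp p) \<and> B' \<in> Lp p \<and>
     (\<forall>K\<in>K_ops p.
        (\<lambda>n. Lp_norm p (K \<circ> (B n - B')) + Lp_norm p ((B n - B') \<circ> K)) \<longlonglongrightarrow> 0)"


section \<open>Limit operators and rich band-dominated operators\<close>

definition Shift :: "int ^ 'n \<Rightarrow> ('n::finite, 'a::complex_banach) seq_op" where
  "Shift k x = (\<lambda>i. x (i - k))"

definition tends_to_infinity :: "(nat \<Rightarrow> int ^ 'n) \<Rightarrow> bool" where
  "tends_to_infinity h \<longleftrightarrow> filterlim (\<lambda>n. idx_norm (h n)) at_top sequentially"

definition limit_operator ::
    "ennreal \<Rightarrow> ('n::finite, 'a::complex_banach) seq_op \<Rightarrow> (nat \<Rightarrow> int ^ 'n) \<Rightarrow> ('n, 'a) seq_op \<Rightarrow> bool" where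
  "limit_operator p A h B \<longleftrightarrow> A \<in> LP_ops p \<and> tends_to_infinity h \<and>
     P_strong_lim p (\<lambda>n. Shift (- h n) \<circ> A \<circ> Shift (h n)) B"

definition rich :: "ennreal \<Rightarrow> ('n::finite, 'a::complex_banach) seq_op \<Rightarrow> bool" where
  "rich p A \<longleftrightarrow> (\<forall>h. tends_to_infinity h \<longrightarrow>
     (\<exists>r B. strict_mono (r :: nat \<Rightarrow> nat) \<and> limit_operator p A (h \<circ> r) B))"

text \<open>A coefficient in \<open>l\<^sup>\<infinity>(\<int>\<^sup>N, L(X))\<close>: the values of \<open>\<Rightarrow>\<^sub>L\<close> are bounded but only real-linear,
  so complex homogeneity is required separately.\<close>

definition bounded_coeff :: "(int ^ 'n \<Rightarrow> ('a::complex_banach \<Rightarrow>\<^sub>L 'a)) \<Rightarrow> bool" where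
  "bounded_coeff a \<longleftrightarrow> bounded (range a) \<and>
     (\<forall>i z v. blinfun_apply (a i) (z *\<^sub>C v) = z *\<^sub>C blinfun_apply (a i) v)"

definition band_operator :: "('n::finite, 'a::complex_banach) seq_op \<Rightarrow> bool" where
  "band_operator B \<longleftrightarrow> (\<exists>F a. finite F \<and> (\<forall>\<alpha>\<in>F. bounded_coeff (a \<alpha>)) \<and>
     B = (\<lambda>x i. \<Sum>\<alpha>\<in>F. blinfun_apply (a \<alpha> i) (Shift \<alpha> x i)))"

definition band_dominated :: "ennreal \<Rightarrow> ('n::finite, 'a::complex_banach) seq_op set" where
  "band_dominated p = {A \<in> Lp p. \<forall>\<epsilon>>0. \<exists>B. band_operator B \<and> Lp_norm p (A - B) < \<epsilon>}"

definition rich_band_dominated :: "ennreal \<Rightarrow> ('n::finite, 'a::complex_banach) seq_op set" where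
  "rich_band_dominated p = {A \<in> band_dominated p. rich p A}"


section \<open>Finite sections and the stability spectrum\<close>

definition im_Proj :: "ennreal \<Rightarrow> nat \<Rightarrow> (int ^ 'n \<Rightarrow> 'a::complex_banach) set" where
  "im_Proj p n = Proj n ` lp_space p"

text \<open>\<open>A\<^sub>n\<close>, to be read as an operator on \<open>im_Proj p n\<close>.\<close>

definition fin_section :: "('n::finite, 'a::complex_banach) seq_op \<Rightarrow> nat \<Rightarrow> ('n, 'a) seq_op" where
  "fin_section A n = Proj n \<circ> A \<circ> Proj n"

definition stable_sections :: "ennreal \<Rightarrow> ('n::finite, 'a::complex_banach) seq_op \<Rightarrow> bool" where
  "stable_sections p A \<longleftrightarrow> (\<exists>n0 C. \<forall>n\<ge>n0.
     op_invertible p (im_Proj p n) (fin_section A n) \<and>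
     op_norm p (im_Proj p n) (inv_into (im_Proj p n) (fin_section A n)) \<le> C)"

text \<open>The usual convention that the condition number of a non-invertible operator is infinite.\<close>

definition cond_number ::
    "ennreal \<Rightarrow> (int ^ 'n \<Rightarrow> 'a::complex_banach) set \<Rightarrow> ('n, 'a) seq_op \<Rightarrow> ereal" where
  "cond_number p E A =
    (if op_invertible p E A then ereal (op_norm p E A * op_norm p E (inv_into E A)) else \<infinity>)"

definition ext_section ::
    "('n::finite, 'a::complex_banach) seq_op \<Rightarrow> real \<Rightarrow> nat \<Rightarrow> ('n, 'a) seq_op" where
  "ext_section A c n x = (\<lambda>i. fin_section A n x i + c *\<^sub>R Coproj n x i)"

definition stability_spectrum ::
    "ennreal \<Rightarrow> ('n::finite, 'a::complex_banach) seq_op \<Rightarrow> real \<Rightarrow> ('n, 'a) seq_op set" where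
  "stability_spectrum p A c = {A} \<union>
     {S. \<exists>m h. filterlim m at_top sequentially \<and> (\<forall>k. idx_norm (h k) = int (m k)) \<and>
        P_strong_lim p (\<lambda>k. Shift (- h k) \<circ> ext_section A c (m k) \<circ> Shift (h k)) S}"

end

theory Submission
  imports Defs "HOL-Complex_Analysis.Great_Picard"
begin

text \<open>The whole argument runs on one property of a band-dominated operator \<open>A\<close>: it almost commutes
  with multiplication by a function \<open>\<phi>\<close> that varies slowly on the lattice, in the sense that the norm
  of the commutator tends to zero with the Lipschitz constant of \<open>\<phi>\<close>
  (\<open>band_dominated_comm_bound\<close>). Finite sections, their extensions, shifts and limits inherit this
  property with the same constants, so that a vector may be cut down to a bounded part of the
  lattice under all operators in question, uniformly. Since a finitely supported vector sees
  only finitely much of an operator, norm estimates pass to local limits in this way for every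
  exponent, also for \<open>p = \<infinity>\<close>, where truncations of a vector need not converge to it.

  First, \<open>\<parallel>A\<^sub>n\<parallel>\<close> tends to \<open>\<parallel>A\<parallel>\<close> (\<open>fin_section_norm_tendsto\<close>), so that the claim concerns
  \<open>L = limsup \<parallel>A\<^sub>n\<^sup>-\<^sup>1\<parallel>\<close> only.

  Second, every member \<open>S\<close> of the stability spectrum is a local limit of shifted copies of the extended
  sections. On the complement of the cube these act as \<open>c\<close>, and \<open>1/c \<le> 1/\<parallel>A\<parallel> \<le> \<parallel>A\<^sub>n\<^sup>-\<^sup>1\<parallel>\<close>, so the
  extension leaves the norm of the inverse unchanged. Invertibility with a uniform bound
  survives in the limit (\<open>limit_invertible\<close>), whence \<open>\<parallel>S\<^sup>-\<^sup>1\<parallel> \<le> L\<close>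
  (\<open>stability_spectrum_invertible\<close>).

  Third, some \<open>S\<close> attains \<open>L\<close> (\<open>spectrum_attains_limit\<close>). Along a subsequence with
  \<open>\<parallel>A\<^sub>n\<^sup>-\<^sup>1\<parallel> \<rightarrow> L\<close> there are vectors \<open>x\<close> with \<open>\<parallel>A\<^sub>n x\<parallel> / \<parallel>x\<parallel>\<close> close to \<open>1/L\<close>. Such a vector can be
  replaced by a piece of it that lives on a set of bounded diameter, where the diameter depends only
  on the permitted loss \<open>\<delta>\<close> (\<open>localisation\<close>). For a fixed \<open>\<delta>\<close> this produces
  an operator with \<open>\<parallel>S\<^sup>-\<^sup>1\<parallel>\<close> close to \<open>L\<close>; in order to serve all \<open>\<delta>\<close> with one operator, the pieces are cut
  out of each other, the largest first, so that a single site lies in all of them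
  (\<open>nested_localisation\<close>). If these sites move away from the boundaries of the cubes, then
  the pieces do not notice the truncation and \<open>S = A\<close> will do. Otherwise the operators are
  recentred at boundary points near these sites. Richness makes the shifted copies of
  \<open>A\<close> converge along a subsequence, compactness makes the shifted cubes converge as well,
  and the truncated limit operator belonging to them has approximate minimisers at every scale.\<close>

section \<open>Inequalities and subsequences\<close>

text \<open>Convexity of \<open>x\<^sup>q\<close>, applied to the convex combination of \<open>a/s\<close> and \<open>b/t\<close> with weights \<open>s/(s+t)\<close> and
  \<open>t/(s+t)\<close>. Because it is linear in \<open>a\<^sup>q\<close> and \<open>b\<^sup>q\<close>, it may be summed; with \<open>s\<close> and \<open>t\<close> the two norms this
  gives Minkowski's inequality, and below it replaces Minkowski for sums over translates.\<close>

lemma powr_add_le_weighted: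
  fixes a b s t q :: real
  assumes "a \<ge> 0" "b \<ge> 0" "s > 0" "t > 0" "q \<ge> 1"
  shows "(a + b) powr q \<le> (s + t) powr (q - 1) * (s powr (1 - q) * a powr q + t powr (1 - q) * b powr q)"
proof (cases "a = 0 \<or> b = 0")
  case True
  have one: "z powr q \<le> (s + t) powr (q - 1) * (u powr (1 - q) * z powr q)" if "0 < u" "u \<le> s + t" for u z
  proof -
    have "1 = u powr (q - 1) * u powr (1 - q)" using that by (simp flip: powr_add)
    also have "\<dots> \<le> (s + t) powr (q - 1) * u powr (1 - q)"
      using that assms by (intro mult_right_mono powr_mono2) auto
    finally have "1 * z powr q \<le> ((s + t) powr (q - 1) * u powr (1 - q)) * z powr q"
      by (rule mult_right_mono) simp
    then show ?thesis by (simp add: mult.assoc)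
  qed
  show ?thesis using True one[of s a] one[of t b] assms by auto
next
  case False
  then have ab: "a > 0" "b > 0" using assms by auto
  have cvx: "convex_on {0<..} (\<lambda>x. x powr q)" by (rule powr_convex[OF assms(5)])
  define u where "u = s / (s + t)"
  have u: "u > 0" "u \<le> 1" "1 - u = t / (s + t)" using assms by (auto simp: u_def field_simps)
  have eq: "(a + b) / (s + t) = (1 - u) * (b / t) + u * (a / s)"
    using assms by (simp add: u(3)) (simp add: u_def add_divide_distrib)
  have "((a + b) / (s + t)) powr q \<le> (1 - u) * (b / t) powr q + u * (a / s) powr q"
    using convex_onD[OF cvx, of u "b / t" "a / s"] u assms ab by (simp add: eq)
  also have "\<dots> = (t powr (1 - q) * b powr q + s powr (1 - q) * a powr q) / (s + t)"
    using assms by (simp add: u(3), simp add: u_def powr_divide powr_diff add_divide_distrib)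
  finally have "((a + b) powr q) / ((s + t) powr q) \<le> \<dots>"
    using assms by (simp add: powr_divide)
  then have "(a + b) powr q \<le> (t powr (1 - q) * b powr q + s powr (1 - q) * a powr q) / (s + t) * (s + t) powr q"
    using assms by (simp add: pos_divide_le_eq)
  then show ?thesis using assms by (simp add: powr_diff field_simps)
qed

text \<open>If \<open>a + b\<close> exceeded \<open>(s + t) f\<close> wherever \<open>f\<close> is positive, then so would the sums of the \<open>q\<close>-th powers,
  against Minkowski. This selects one translate that is good for two error terms at once.\<close>

lemma weighted_pigeonhole:
  fixes f a b :: "'i \<Rightarrow> real"
  assumes H: "finite H" and nonneg: "\<And>h. h \<in> H \<Longrightarrow> f h \<ge> 0 \<and> a h \<ge> 0 \<and> b h \<ge> 0"
    and q: "q \<ge> 1" and s: "s > 0" and t: "t > 0"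
    and f: "(\<Sum>h\<in>H. f h powr q) = F" "F > 0"
    and a: "(\<Sum>h\<in>H. a h powr q) \<le> s powr q * F" and b: "(\<Sum>h\<in>H. b h powr q) \<le> t powr q * F"
  shows "\<exists>h\<in>H. f h > 0 \<and> a h + b h \<le> (s + t) * f h"
proof (rule ccontr)
  assume "\<not> ?thesis"
  then have less: "(s + t) * f h < a h + b h" if "h \<in> H" "f h > 0" for h using that by force
  have le: "(s + t) powr q * f h powr q \<le> (a h + b h) powr q" if "h \<in> H" for h
  proof (cases "f h > 0")
    case True
    then show ?thesis using less[OF that] s t q
      by (subst powr_mult[symmetric]) (auto intro!: powr_mono2)
  next
    case False
    then have "f h = 0" using nonneg[OF that] by auto
    then show ?thesis using q by simp
  qed
  have "\<exists>h\<in>H. f h > 0"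
  proof (rule ccontr)
    assume no: "\<not> (\<exists>h\<in>H. f h > 0)"
    have "f h = 0" if "h \<in> H" for h using nonneg[OF that] no that by force
    then show False using f q by simp
  qed
  then obtain h0 where h0: "h0 \<in> H" "f h0 > 0" by blast
  have "(s + t) powr q * f h0 powr q < (a h0 + b h0) powr q"
    using less[OF h0] h0 s t q by (subst powr_mult[symmetric]) (auto intro!: powr_less_mono2)
  then have "(\<Sum>h\<in>H. (s + t) powr q * f h powr q) < (\<Sum>h\<in>H. (a h + b h) powr q)"
    using H h0 le by (intro sum_strict_mono_ex1) auto
  also have "\<dots> \<le> (\<Sum>h\<in>H. (s + t) powr (q - 1) * (s powr (1 - q) * a h powr q + t powr (1 - q) * b h powr q))"
    using nonneg s t q by (intro sum_mono powr_add_le_weighted) auto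
  also have "\<dots> = (s + t) powr (q - 1) * (s powr (1 - q) * (\<Sum>h\<in>H. a h powr q) + t powr (1 - q) * (\<Sum>h\<in>H. b h powr q))"
    by (simp add: sum_distrib_left[symmetric] sum.distrib)
  also have "\<dots> \<le> (s + t) powr (q - 1) * (s powr (1 - q) * (s powr q * F) + t powr (1 - q) * (t powr q * F))"
    by (intro mult_left_mono add_mono a b) auto
  also have "\<dots> = (s + t) powr q * F"
  proof -
    have "s powr (1 - q) * (s powr q * F) = s * F" "t powr (1 - q) * (t powr q * F) = t * F"
      using s t by (simp_all add: powr_diff)
    moreover have "(s + t) powr (q - 1) * (s * F + t * F) = (s + t) powr q * F"
      using s t by (simp add: powr_diff flip: distrib_right)
    ultimately show ?thesis by (simp only:)
  qed
  finally show False using f(1) by (simp add: sum_distrib_left[symmetric])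
qed

lemma geometric_tail_le: "(\<Sum>s\<in>{l..<j}. (1/2::real) ^ s) \<le> 2 * (1/2) ^ l"
proof -
  have "(\<Sum>s\<in>{l..<l + k}. (1/2::real) ^ s) = 2 * (1/2) ^ l - 2 * (1/2) ^ (l + k)" for k
    by (induction k) auto
  from this[of "j - l"] show ?thesis by (cases "l \<le> j") auto
qed

lemma nat_ge_real: "\<exists>m. m \<ge> t \<and> (a::real) \<le> real m"
  by (metis linear order_trans of_nat_mono real_arch_simple)

text \<open>Sequential compactness of a countable power of the two-point space. It provides the limit set
  of a sequence of shifted cubes.\<close>

lemma converging_indicators_subseq:
  fixes Q :: "nat \<Rightarrow> 'i::countable \<Rightarrow> bool"
  shows "\<exists>\<sigma> U. strict_mono (\<sigma> :: nat \<Rightarrow> nat) \<and> (\<forall>i. \<forall>\<^sub>F k in sequentially. Q (\<sigma> k) i = (i \<in> U))"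
proof -
  define f where "f k i = (if Q k i then 1 else 0 :: real)" for k i
  obtain \<sigma> :: "nat \<Rightarrow> nat" where \<sigma>: "strict_mono \<sigma>" "\<And>i. i \<in> UNIV \<Longrightarrow> \<exists>l. (\<lambda>k. f (\<sigma> k) i) \<longlonglongrightarrow> l"
    by (rule function_convergent_subsequence[of UNIV f 1]) (auto simp: f_def)
  have "\<exists>b. \<forall>\<^sub>F k in sequentially. Q (\<sigma> k) i = b" for i
  proof -
    obtain l where "(\<lambda>k. f (\<sigma> k) i) \<longlonglongrightarrow> l" using \<sigma>(2) by blast
    then have "\<forall>\<^sub>F k in sequentially. dist (f (\<sigma> k) i) l < 1 / 2" by (rule tendstoD) simp
    then have "\<forall>\<^sub>F k in sequentially. Q (\<sigma> k) i = (l > 1 / 2)"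
    proof eventually_elim
      case (elim k)
      then have "f (\<sigma> k) i < l + 1 / 2" "l - 1 / 2 < f (\<sigma> k) i"
        unfolding dist_real_def abs_less_iff by linarith+
      then show ?case by (cases "Q (\<sigma> k) i") (simp_all add: f_def)
    qed
    then show ?thesis by blast
  qed
  then obtain b where "\<And>i. \<forall>\<^sub>F k in sequentially. Q (\<sigma> k) i = b i" by metis
  then have "\<forall>i. \<forall>\<^sub>F k in sequentially. Q (\<sigma> k) i = (i \<in> Collect b)" by simp
  then show ?thesis using \<sigma>(1) by blast
qed

section \<open>The index lattice\<close>

lemma idx_norm_le_iff: "idx_norm (i::int^'n) \<le> k \<longleftrightarrow> (\<forall>j. \<bar>i $ j\<bar> \<le> k)"
  unfolding idx_norm_def by (subst Max_le_iff) auto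

lemma abs_coord_le_idx_norm: "\<bar>(i::int^'n) $ j\<bar> \<le> idx_norm i"
  using idx_norm_le_iff by blast

lemma idx_norm_nonneg [simp]: "idx_norm (i::int^'n) \<ge> 0"
  using abs_coord_le_idx_norm[of i] by (meson abs_ge_zero order_trans)

lemma idx_norm_zero [simp]: "idx_norm (0::int^'n) = 0"
  using idx_norm_le_iff[of "0::int^'n" 0] idx_norm_nonneg[of "0::int^'n"] by simp

lemma idx_norm_uminus [simp]: "idx_norm (- (i::int^'n)) = idx_norm i"
  unfolding idx_norm_def by simp

lemma idx_norm_minus_commute: "idx_norm ((i::int^'n) - j) = idx_norm (j - i)"
  using idx_norm_uminus[of "i - j"] by simp

lemma idx_norm_triangle: "idx_norm ((i::int^'n) + j) \<le> idx_norm i + idx_norm j"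
  unfolding idx_norm_le_iff
  by (metis abs_coord_le_idx_norm abs_triangle_ineq add_mono order_trans vector_add_component)

lemma idx_norm_triangle_minus: "idx_norm ((i::int^'n) - k) \<le> idx_norm (i - j) + idx_norm (j - k)"
  using idx_norm_triangle[of "i - j" "j - k"] by simp

lemma idx_norm_attained: "\<exists>j. idx_norm (i::int^'n) = \<bar>i $ j\<bar>"
proof -
  have "idx_norm i \<in> range (\<lambda>j. \<bar>i $ j\<bar>)"
    unfolding idx_norm_def by (rule Max_in) auto
  then show ?thesis by auto
qed

lemma bij_betw_cube:
  "bij_betw vec_nth {i::int^'n. idx_norm i \<le> k} (Pi\<^sub>E UNIV (\<lambda>_. {-k..k}))"
proof -
  have "\<bar>a\<bar> \<le> k \<longleftrightarrow> a \<in> {-k..k}" for a :: int by auto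
  then show ?thesis
    by (intro bij_betw_byWitness[where f' = vec_lambda]) (auto simp: idx_norm_le_iff PiE_iff)
qed

lemma finite_cube [simp]: "finite {i::int^'n. idx_norm i \<le> k}"
  using bij_betw_finite[OF bij_betw_cube[of k]] by (simp add: finite_PiE)

lemma card_cube:
  assumes "k \<ge> 0"
  shows "real (card {i::int^'n. idx_norm i \<le> k}) = (2 * k + 1) ^ CARD('n)"
proof -
  have "card {i::int^'n. idx_norm i \<le> k} = nat (2 * k + 1) ^ CARD('n)"
    using bij_betw_same_card[OF bij_betw_cube[of k]]
    by (simp add: card_PiE)
  then show ?thesis using assms by simp
qed

lemma finite_ball_index [simp]: "finite {i::int^'n. idx_norm (i - j) \<le> k}"
proof -
  have "{i::int^'n. idx_norm (i - j) \<le> k} = (\<lambda>i. i + j) ` {i. idx_norm i \<le> k}"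
    by (auto simp: image_iff) (metis diff_add_cancel)
  then show ?thesis by simp
qed

text \<open>The sup-norm distance to the boundary of a cube is realised by pushing a coordinate of maximal
  modulus outwards.\<close>

lemma boundary_point_near:
  assumes "idx_norm (i::int^'n) \<le> int n"
  shows "\<exists>h. idx_norm h = int n \<and> idx_norm (h - i) = int n - idx_norm i"
proof -
  obtain j where j: "idx_norm i = \<bar>i $ j\<bar>" using idx_norm_attained by blast
  define s where "s = (if i $ j \<ge> 0 then 1 else - 1 :: int)"
  define h where "h = (\<chi> l. if l = j then s * int n else i $ l)"
  have "idx_norm h \<le> int n"
    unfolding idx_norm_le_iff h_def using assms[unfolded idx_norm_le_iff] by (simp add: s_def abs_mult)
  moreover have "int n \<le> idx_norm h"
    using abs_coord_le_idx_norm[of h j] by (simp add: h_def s_def split: if_splits)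
  moreover have "idx_norm (h - i) \<le> int n - idx_norm i"
    unfolding idx_norm_le_iff using j assms by (auto simp: h_def s_def)
  moreover have "int n - idx_norm i \<le> idx_norm (h - i)"
    using idx_norm_triangle[of "h - i" i] \<open>int n \<le> idx_norm h\<close> by simp
  ultimately show ?thesis by force
qed

section \<open>The supremum norm\<close>

lemma sup_norm_le_iff:
  assumes "bounded (range (x :: int^'n \<Rightarrow> 'a::complex_banach))"
  shows "sup_norm x \<le> C \<longleftrightarrow> (\<forall>i. norm (x i) \<le> C)"
proof -
  have "bdd_above (range (\<lambda>i. norm (x i)))"
    using assms unfolding bounded_iff bdd_above_def by auto
  then show ?thesis unfolding sup_norm_def by (subst cSUP_le_iff) auto
qed

lemma norm_le_sup_norm:
  assumes "bounded (range (x :: int^'n \<Rightarrow> 'a::complex_banach))"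
  shows "norm (x i) \<le> sup_norm x"
  using sup_norm_le_iff[OF assms] by blast

text \<open>Replacing the closure of the finitely supported sequences by sequences tending to zero makes membership
  in \<open>l\<^sup>0\<close> a condition on the entries, which can be checked for pointwise limits.\<close>

lemma lp_space_0_iff:
  "(x :: int^'n \<Rightarrow> 'a::complex_banach) \<in> lp_space 0 \<longleftrightarrow> (\<forall>\<epsilon>>0. finite {i. \<epsilon> \<le> norm (x i)})"
  (is "?L \<longleftrightarrow> ?R")
proof
  assume L: ?L
  show ?R
  proof (intro allI impI)
    fix e :: real assume "e > 0"
    then obtain y where y: "finite {i. y i \<noteq> 0}" "sup_norm (x - y) < e"
      using L by (auto simp: lp_space_def)
    have "bounded (range y)"
    proof -
      have "range y \<subseteq> y ` {i. y i \<noteq> 0} \<union> {0}" by auto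
      then show ?thesis using y(1) by (meson bounded_subset finite_imp_bounded finite_UnI finite_imageI finite.intros)
    qed
    moreover have "bounded (range x)" using L by (auto simp: lp_space_def)
    ultimately have bd: "bounded (range (x - y))"
      unfolding bounded_iff fun_diff_def by simp (meson add_mono norm_triangle_ineq4 order_trans)
    have "{i. e \<le> norm (x i)} \<subseteq> {i. y i \<noteq> 0}"
    proof safe
      fix i assume "e \<le> norm (x i)" "y i = 0"
      then show False using norm_le_sup_norm[OF bd, of i] y(2) by simp
    qed
    then show "finite {i. e \<le> norm (x i)}" using y(1) finite_subset by blast
  qed
next
  assume R: ?R
  have "bounded (range x)"
  proof -
    have "range x \<subseteq> x ` {i. 1 \<le> norm (x i)} \<union> ball 0 1"
      by (auto simp: not_le)
    then show ?thesis using R by (meson bounded_Un bounded_ball bounded_subset finite_imageI finite_imp_bounded zero_less_one)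
  qed
  moreover have "\<exists>y. finite {i. y i \<noteq> 0} \<and> sup_norm (x - y) < e" if "e > 0" for e
  proof -
    define y where "y i = (if e / 2 \<le> norm (x i) then x i else 0)" for i
    have fin: "finite {i. y i \<noteq> 0}"
      by (rule finite_subset[OF _ R[rule_format, of "e / 2"]]) (use that in \<open>auto simp: y_def\<close>)
    have le: "norm ((x - y) i) \<le> e / 2" for i using that by (auto simp: y_def)
    then have "bounded (range (x - y))" unfolding bounded_iff by blast
    then have "sup_norm (x - y) \<le> e / 2" using le sup_norm_le_iff by blast
    then show ?thesis using fin that by (intro exI[of _ y]) auto
  qed
  ultimately show ?L by (simp add: lp_space_def)
qed

section \<open>Multiplication operators and slowly varying functions\<close>

definition Mult :: "(int^'n \<Rightarrow> real) \<Rightarrow> ('n::finite, 'a::complex_banach) seq_op" where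
  "Mult \<phi> x = (\<lambda>i. \<phi> i *\<^sub>R x i)"

text \<open>The Lipschitz constant is \<open>1/r\<close>; it is multiplied out so that the width \<open>r\<close> of the transition appears.\<close>

definition lip_cutoff :: "real \<Rightarrow> (int^'n \<Rightarrow> real) \<Rightarrow> bool" where
  "lip_cutoff r \<phi> \<longleftrightarrow> (\<forall>i. 0 \<le> \<phi> i \<and> \<phi> i \<le> 1) \<and> (\<forall>i j. r * \<bar>\<phi> i - \<phi> j\<bar> \<le> of_int (idx_norm (i - j)))"

text \<open>Equal to one up to distance \<open>m\<close> from \<open>h\<close>, then decaying linearly to zero over the distance \<open>r\<close>.\<close>

definition bump :: "int^'n \<Rightarrow> real \<Rightarrow> real \<Rightarrow> int^'n \<Rightarrow> real" where
  "bump h m r j = max 0 (min 1 ((m + r - of_int (idx_norm (j - h))) / r))"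

lemma lip_cutoffD:
  assumes "lip_cutoff r \<phi>"
  shows "0 \<le> \<phi> i" "\<phi> i \<le> 1" "r * \<bar>\<phi> i - \<phi> j\<bar> \<le> of_int (idx_norm (i - j))"
  using assms by (auto simp: lip_cutoff_def)

lemma lip_cutoff_abs_le: "lip_cutoff r \<phi> \<Longrightarrow> \<bar>\<phi> i\<bar> \<le> 1"
  by (auto simp: lip_cutoff_def)

lemma lip_cutoff_translate: "lip_cutoff r \<phi> \<Longrightarrow> lip_cutoff r (\<lambda>i. \<phi> (i - h))"
  unfolding lip_cutoff_def by (metis diff_diff_eq2 diff_add_cancel)

lemma bump_bounds [simp]: "0 \<le> bump h m r j" "bump h m r j \<le> 1" "\<bar>bump h m r j\<bar> \<le> 1"
  by (auto simp: bump_def)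

lemma bump_eq_1: "r > 0 \<Longrightarrow> of_int (idx_norm (j - h)) \<le> m \<Longrightarrow> bump h m r j = 1"
  by (simp add: bump_def)

lemma bump_eq_0: "r > 0 \<Longrightarrow> m + r \<le> of_int (idx_norm (j - h)) \<Longrightarrow> bump h m r j = 0"
  using divide_nonpos_pos[of "m + r - of_int (idx_norm (j - h))" r]
  by (auto simp: bump_def min_def max_def)

lemma lip_cutoff_bump:
  fixes h :: "int^'n"
  assumes "r > 0"
  shows "lip_cutoff r (bump h m r)"
  unfolding lip_cutoff_def
proof (intro conjI allI)
  fix i j :: "int^'n"
  have "\<bar>bump h m r i - bump h m r j\<bar> \<le>
      \<bar>(m + r - of_int (idx_norm (i - h))) / r - (m + r - of_int (idx_norm (j - h))) / r\<bar>"
    unfolding bump_def by (auto simp: max_def min_def)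
  also have "\<dots> = \<bar>of_int (idx_norm (j - h)) - of_int (idx_norm (i - h))\<bar> / r"
    using assms by (simp flip: diff_divide_distrib)
  finally have 1: "r * \<bar>bump h m r i - bump h m r j\<bar> \<le> \<bar>of_int (idx_norm (j - h)) - of_int (idx_norm (i - h))\<bar>"
    using assms by (simp add: pos_le_divide_eq mult.commute)
  have 2: "\<bar>idx_norm (j - h) - idx_norm (i - h)\<bar> \<le> idx_norm (i - j)"
    using idx_norm_triangle_minus[of i h j] idx_norm_triangle_minus[of j h i]
    by (simp add: idx_norm_minus_commute[of j i])
  have "\<bar>real_of_int (idx_norm (j - h)) - of_int (idx_norm (i - h))\<bar> \<le> of_int (idx_norm (i - j))"
    using 2 by linarith
  then show "r * \<bar>bump h m r i - bump h m r j\<bar> \<le> of_int (idx_norm (i - j))" using 1 by linarith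
qed auto

lemma Mult_diff: "Mult \<phi> (\<lambda>i. x i - y i) = (\<lambda>i. Mult \<phi> x i - Mult \<phi> y i)"
  by (simp add: Mult_def scaleR_diff_right)

lemma Mult_Proj: "Mult \<phi> (Proj n x) = Proj n (Mult \<phi> x)"
  by (auto simp: Mult_def Proj_def)

lemma Proj_Proj: "Proj m (Proj n x) = Proj (min m n) x"
  by (auto simp: Proj_def fun_eq_iff)

lemma Proj_eq_iff: "Proj n x = x \<longleftrightarrow> (\<forall>i. \<not> idx_norm i \<le> int n \<longrightarrow> x i = 0)"
  unfolding Proj_def fun_eq_iff by auto

lemma Proj_diff: "Proj n (\<lambda>i. x i - y i) = (\<lambda>i. Proj n x i - Proj n y i)"
  by (auto simp: Proj_def)

lemma Shift_inverse [simp]: "Shift (- h) (Shift h x) = x" "Shift h (Shift (- h) x) = x"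
  by (simp_all add: Shift_def)

section \<open>Almost locality and local convergence\<close>

text \<open>As \<open>r\<close> and \<open>\<epsilon>\<close> are parameters and not quantified, a whole family of operators can be required to share them.\<close>

definition comm_bound :: "ennreal \<Rightarrow> real \<Rightarrow> real \<Rightarrow> ('n::finite, 'a::complex_banach) seq_op \<Rightarrow> bool" where
  "comm_bound p r \<epsilon> T \<longleftrightarrow> (\<forall>\<phi> x. lip_cutoff r \<phi> \<longrightarrow> x \<in> lp_space p \<longrightarrow>
     lp_norm p (\<lambda>i. T (Mult \<phi> x) i - Mult \<phi> (T x) i) \<le> \<epsilon> * lp_norm p x)"

abbreviation almost_local :: "ennreal \<Rightarrow> ('n::finite, 'a::complex_banach) seq_op \<Rightarrow> bool" where
  "almost_local p T \<equiv> \<forall>\<epsilon>>0. \<exists>r>0. comm_bound p r \<epsilon> T"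

text \<open>P-strong convergence, tested on the projections \<open>P\<^sub>m\<close> only and spelled out as an estimate
  on vectors.\<close>

definition loc_conv ::
    "ennreal \<Rightarrow> (nat \<Rightarrow> ('n::finite, 'a::complex_banach) seq_op) \<Rightarrow> ('n, 'a) seq_op \<Rightarrow> bool" where
  "loc_conv p B S \<longleftrightarrow> (\<forall>m. \<forall>\<epsilon>>0. \<forall>\<^sub>F k in sequentially. \<forall>x\<in>lp_space p.
     lp_norm p (Proj m (\<lambda>i. B k x i - S x i)) \<le> \<epsilon> * lp_norm p x \<and>
     lp_norm p (\<lambda>i. B k (Proj m x) i - S (Proj m x) i) \<le> \<epsilon> * lp_norm p x)"

lemma loc_conv_subseq:
  assumes "loc_conv p B S" "filterlim \<sigma> sequentially sequentially"
  shows "loc_conv p (\<lambda>k. B (\<sigma> k)) S"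
  using assms(1) eventually_compose_filterlim[OF _ assms(2)] unfolding loc_conv_def by blast

lemma scaleC_sum_right:
  fixes f :: "'b \<Rightarrow> 'a::complex_banach"
  shows "z *\<^sub>C (\<Sum>a\<in>F. f a) = (\<Sum>a\<in>F. z *\<^sub>C f a)"
proof -
  have "z *\<^sub>C (0::'a) = 0" using norm_scaleC[of z "0::'a"] by simp
  then show ?thesis by (induction F rule: infinite_finite_induct) (auto simp: scaleC_add_right)
qed

text \<open>A band operator reads only finitely many diagonals, so its value at a site depends on a
  neighbourhood of fixed radius.\<close>

lemma band_operator_width:
  assumes "band_operator B"
  shows "\<exists>w::nat. \<forall>x i. (\<forall>j. idx_norm (i - j) \<le> int w \<longrightarrow> x j = 0) \<longrightarrow> B x i = 0"
proof -
  obtain F a where F: "finite F" and B: "B = (\<lambda>x i. \<Sum>\<alpha>\<in>F. blinfun_apply (a \<alpha> i) (Shift \<alpha> x i))"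
    using assms unfolding band_operator_def by blast
  define w where "w = nat (Max (insert 0 (idx_norm ` F)))"
  have "idx_norm \<alpha> \<le> int w" if "\<alpha> \<in> F" for \<alpha>
  proof -
    have "idx_norm \<alpha> \<le> Max (insert 0 (idx_norm ` F))" using that F by auto
    then show ?thesis by (simp add: w_def)
  qed
  then have "B x i = 0" if "\<forall>j. idx_norm (i - j) \<le> int w \<longrightarrow> x j = 0" for x i
    using that unfolding B Shift_def by (intro sum.neutral) auto
  then show ?thesis by blast
qed

text \<open>The closure properties that the operator norm needs; they are shared by the whole space and the
  ranges of the projections.\<close>

definition scaling_closed :: "ennreal \<Rightarrow> (int ^ 'n \<Rightarrow> 'a::complex_banach) set \<Rightarrow> bool" where
  "scaling_closed p E \<longleftrightarrow> E \<subseteq> lp_space p \<and> (\<lambda>i. 0) \<in> E \<and> (\<forall>x\<in>E. \<forall>r. (\<lambda>i. r *\<^sub>R x i) \<in> E)"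

abbreviation Shift_conj ::
    "int ^ 'n \<Rightarrow> ('n::finite, 'a::complex_banach) seq_op \<Rightarrow> ('n, 'a) seq_op" where
  "Shift_conj h T \<equiv> Shift (- h) \<circ> T \<circ> Shift h"

abbreviation inv_norm :: "ennreal \<Rightarrow> ('n::finite, 'a::complex_banach) seq_op \<Rightarrow> nat \<Rightarrow> real" where
  "inv_norm p A n \<equiv> op_norm p (im_Proj p n) (inv_into (im_Proj p n) (fin_section A n))"

abbreviation quot ::
    "ennreal \<Rightarrow> ('n::finite, 'a::complex_banach) seq_op \<Rightarrow> nat \<Rightarrow> (int ^ 'n \<Rightarrow> 'a) \<Rightarrow> real" where
  "quot p A n x \<equiv> lp_norm p (fin_section A n x) / lp_norm p x"

abbreviation good_cutoff where
  "good_cutoff p A \<delta> R n x h \<phi> \<equiv>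
    (\<forall>i. \<bar>\<phi> i\<bar> \<le> 1) \<and> (\<forall>i. \<phi> i \<noteq> 0 \<longrightarrow> idx_norm (i - h) \<le> R) \<and> Mult \<phi> x \<noteq> (\<lambda>i. 0) \<and>
    quot p A n (Mult \<phi> x) \<le> quot p A n x + \<delta>"

abbreviation localises ::
    "ennreal \<Rightarrow> ('n::finite, 'a::complex_banach) seq_op \<Rightarrow> real \<Rightarrow> int \<Rightarrow> bool" where
  "localises p A \<delta> R \<equiv> \<forall>n x. Proj n x = x \<longrightarrow> x \<noteq> (\<lambda>i. 0) \<longrightarrow> (\<exists>h \<phi>. good_cutoff p A \<delta> R n x h \<phi>)"

context
  fixes p :: ennreal
  assumes p_valid: "p = 0 \<or> 1 \<le> p"
begin

section \<open>The sequence spaces\<close>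

lemma exponent_ge_1: "p \<noteq> 0 \<Longrightarrow> p \<noteq> \<infinity> \<Longrightarrow> enn2real p \<ge> 1"
  using p_valid enn2real_mono[of 1 p] by (simp add: less_top)

lemma lp_space_finite_exponent:
  "p \<noteq> 0 \<Longrightarrow> p \<noteq> \<infinity> \<Longrightarrow> x \<in> lp_space p \<longleftrightarrow> (\<lambda>i. norm (x i) powr enn2real p) summable_on UNIV"
  by (simp add: lp_space_def)

lemma lp_norm_finite_exponent:
  "p \<noteq> 0 \<Longrightarrow> p \<noteq> \<infinity> \<Longrightarrow> lp_norm p x = (\<Sum>\<^sub>\<infinity>i. norm (x i) powr enn2real p) powr (1 / enn2real p)"
  by (simp add: lp_norm_def)

lemma lp_norm_powr:
  assumes "p \<noteq> 0" "p \<noteq> \<infinity>"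
  shows "lp_norm p x powr enn2real p = (\<Sum>\<^sub>\<infinity>i. norm (x i) powr enn2real p)"
  using exponent_ge_1[OF assms] by (simp add: lp_norm_finite_exponent[OF assms] powr_powr infsum_nonneg)

lemma lp_bounded:
  assumes "p = 0 \<or> p = \<infinity>" "x \<in> lp_space p"
  shows "bounded (range x)"
  using assms by (auto simp: lp_space_def)

lemma lp_norm_sup: "p = 0 \<or> p = \<infinity> \<Longrightarrow> lp_norm p x = sup_norm x"
  by (simp add: lp_norm_def)

lemma lp_norm_nonneg [simp]:
  assumes "x \<in> lp_space p"
  shows "0 \<le> lp_norm p x"
proof (cases "p = 0 \<or> p = \<infinity>")
  case True
  then show ?thesis
    using norm_le_sup_norm[OF lp_bounded[OF True assms], of 0] norm_ge_zero[of "x 0"] lp_norm_sup[OF True, of x]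
    by linarith
qed (simp add: lp_norm_def)

lemma norm_le_lp_norm:
  assumes "x \<in> lp_space p"
  shows "norm (x i) \<le> lp_norm p x"
proof (cases "p = 0 \<or> p = \<infinity>")
  case True
  then show ?thesis using norm_le_sup_norm[OF lp_bounded[OF True assms]] by (simp add: lp_norm_sup)
next
  case False
  then have p: "p \<noteq> 0" "p \<noteq> \<infinity>" by auto
  have "norm (x i) powr enn2real p \<le> lp_norm p x powr enn2real p"
    unfolding lp_norm_powr[OF p]
    using finite_sum_le_infsum[of "\<lambda>i. norm (x i) powr enn2real p" UNIV "{i}"] assms
    by (simp add: lp_space_finite_exponent[OF p])
  then show ?thesis using exponent_ge_1[OF p] lp_norm_nonneg[OF assms]
    by (metis not_le norm_ge_zero powr_less_mono2 zero_less_one order_less_le_trans)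
qed

text \<open>Entrywise domination is the only property of the spaces that multiplication operators, projections
  and coefficients of band operators need. The constant makes scalar multiples a special case.\<close>

lemma lp_solid:
  assumes y: "y \<in> lp_space p" and C: "C \<ge> 0" and le: "\<And>i. norm (x i) \<le> C * norm (y i)"
  shows "x \<in> lp_space p" and "lp_norm p x \<le> C * lp_norm p y"
proof -
  have "x \<in> lp_space p \<and> lp_norm p x \<le> C * lp_norm p y"
  proof (cases "p = 0 \<or> p = \<infinity>")
    case True
    note bdy = lp_bounded[OF True y]
    have le2: "norm (x i) \<le> C * sup_norm y" for i
      by (rule order_trans[OF le]) (intro mult_left_mono norm_le_sup_norm[OF bdy] C)
    then have bx: "bounded (range x)" unfolding bounded_iff by blast
    have "x \<in> lp_space p"
    proof (cases "p = 0")
      case p0: True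
      show ?thesis
      proof (cases "C = 0")
        case True
        then show ?thesis using le unfolding p0 lp_space_0_iff by (simp add: not_le)
      next
        case False
        then have "C > 0" using C by simp
        show ?thesis unfolding p0 lp_space_0_iff
        proof (intro allI impI)
          fix e :: real assume "e > 0"
          have "finite {i. e / C \<le> norm (y i)}"
            using y \<open>e > 0\<close> \<open>C > 0\<close> unfolding p0 lp_space_0_iff by simp
          moreover have "{i. e \<le> norm (x i)} \<subseteq> {i. e / C \<le> norm (y i)}"
            using le \<open>C > 0\<close> by (auto simp: pos_divide_le_eq mult.commute) (meson order_trans)
          ultimately show "finite {i. e \<le> norm (x i)}" using finite_subset by blast
        qed
      qed
    next
      case False
      then show ?thesis using True bx by (simp add: lp_space_def)
    qed
    then show ?thesis using le2 by (simp add: lp_norm_sup[OF True] sup_norm_le_iff[OF bx])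
  next
    case False
    then have p: "p \<noteq> 0" "p \<noteq> \<infinity>" by auto
    let ?q = "enn2real p"
    have q: "?q \<ge> 1" by (rule exponent_ge_1[OF p])
    have sy: "(\<lambda>i. norm (y i) powr ?q) summable_on UNIV" using y lp_space_finite_exponent[OF p] by blast
    have le2: "norm (x i) powr ?q \<le> C powr ?q * norm (y i) powr ?q" for i
      using powr_mono2[OF _ _ le[of i], of ?q] q C by (simp add: powr_mult)
    have sCy: "(\<lambda>i. C powr ?q * norm (y i) powr ?q) summable_on UNIV"
      by (rule summable_on_cmult_right[OF sy])
    have sx: "(\<lambda>i. norm (x i) powr ?q) summable_on UNIV"
      by (rule summable_on_comparison_test[OF sCy]) (use le2 in auto)
    have "(\<Sum>\<^sub>\<infinity>i. norm (x i) powr ?q) \<le> C powr ?q * (\<Sum>\<^sub>\<infinity>i. norm (y i) powr ?q)"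
      using infsum_mono[OF sx sCy le2] by (simp add: infsum_cmult_right'[symmetric])
    then have "lp_norm p x \<le> (C powr ?q * (\<Sum>\<^sub>\<infinity>i. norm (y i) powr ?q)) powr (1 / ?q)"
      unfolding lp_norm_finite_exponent[OF p] using q by (intro powr_mono2) (auto simp: infsum_nonneg)
    also have "\<dots> = C * lp_norm p y"
      using q C by (simp add: lp_norm_finite_exponent[OF p] powr_mult powr_powr infsum_nonneg)
    finally show ?thesis using sx lp_space_finite_exponent[OF p] by blast
  qed
  then show "x \<in> lp_space p" "lp_norm p x \<le> C * lp_norm p y" by auto
qed

lemma lp_norm_cong: "(\<And>i. norm (x i) = norm (y i)) \<Longrightarrow> lp_norm p x = lp_norm p y"
  by (simp add: lp_norm_def sup_norm_def)

lemma lp_zero [simp]: "(\<lambda>i. 0) \<in> lp_space p" and lp_norm_zero [simp]: "lp_norm p (\<lambda>i. 0) = 0"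
proof -
  show "(\<lambda>i. 0) \<in> lp_space p"
  proof (cases "p = 0")
    case True
    then show ?thesis using lp_space_0_iff[of "\<lambda>i. 0"] by (simp add: not_le)
  next
    case False
    then show ?thesis by (auto simp: lp_space_def)
  qed
  show "lp_norm p (\<lambda>i. 0) = 0" by (simp add: lp_norm_def sup_norm_def)
qed

lemma lp_scaleC [simp]: "x \<in> lp_space p \<Longrightarrow> (\<lambda>i. z *\<^sub>C x i) \<in> lp_space p"
  by (rule lp_solid(1)[where C = "cmod z" and y = x]) (auto simp: norm_scaleC)

lemma lp_scaleR [simp]: "x \<in> lp_space p \<Longrightarrow> (\<lambda>i. r *\<^sub>R x i) \<in> lp_space p"
  by (rule lp_solid(1)[where C = "\<bar>r\<bar>" and y = x]) auto

lemma lp_norm_scaleR: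
  assumes "x \<in> lp_space p"
  shows "lp_norm p (\<lambda>i. r *\<^sub>R x i) = \<bar>r\<bar> * lp_norm p x"
proof (cases "r = 0")
  case False
  have "lp_norm p (\<lambda>i. r *\<^sub>R x i) \<le> \<bar>r\<bar> * lp_norm p x"
    by (rule lp_solid(2)) (use assms in auto)
  moreover have "lp_norm p x \<le> \<bar>1 / r\<bar> * lp_norm p (\<lambda>i. r *\<^sub>R x i)"
    by (rule lp_solid(2)) (use assms False in auto)
  ultimately show ?thesis using False by (simp add: field_simps abs_divide)
qed simp

lemma lp_eq_zero: "x \<in> lp_space p \<Longrightarrow> lp_norm p x \<le> 0 \<Longrightarrow> x = (\<lambda>i. 0)"
proof
  fix i assume "x \<in> lp_space p" "lp_norm p x \<le> 0"
  then show "x i = 0" using norm_le_lp_norm[of x i] by (simp add: order_trans[of _ "lp_norm p x" 0] flip: norm_le_zero_iff)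
qed

lemma lp_norm_pos_iff: "x \<in> lp_space p \<Longrightarrow> 0 < lp_norm p x \<longleftrightarrow> x \<noteq> (\<lambda>i. 0)"
  using lp_eq_zero[of x] lp_norm_zero lp_norm_nonneg[of x] by (auto simp: less_le)

lemma lp_add_aux:
  assumes x: "x \<in> lp_space p" and y: "y \<in> lp_space p"
  shows "(\<lambda>i. x i + y i) \<in> lp_space p \<and> lp_norm p (\<lambda>i. x i + y i) \<le> lp_norm p x + lp_norm p y"
proof (cases "p = 0 \<or> p = \<infinity>")
  case True
  have le: "norm (x i + y i) \<le> lp_norm p x + lp_norm p y" for i
    using norm_le_lp_norm[OF x, of i] norm_le_lp_norm[OF y, of i] norm_triangle_ineq[of "x i" "y i"] by linarith
  then have b: "bounded (range (\<lambda>i. x i + y i))" unfolding bounded_iff by blast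
  have "(\<lambda>i. x i + y i) \<in> lp_space p"
  proof (cases "p = 0")
    case p0: True
    show ?thesis unfolding p0 lp_space_0_iff
    proof (intro allI impI)
      fix e :: real assume "e > 0"
      then have "finite ({i. e / 2 \<le> norm (x i)} \<union> {i. e / 2 \<le> norm (y i)})"
        using x y half_gt_zero unfolding p0 lp_space_0_iff by blast
      moreover have "{i. e \<le> norm (x i + y i)} \<subseteq> {i. e / 2 \<le> norm (x i)} \<union> {i. e / 2 \<le> norm (y i)}"
      proof
        fix i assume "i \<in> {i. e \<le> norm (x i + y i)}"
        then show "i \<in> {i. e / 2 \<le> norm (x i)} \<union> {i. e / 2 \<le> norm (y i)}"
          using norm_triangle_ineq[of "x i" "y i"] by auto
      qed
      ultimately show "finite {i. e \<le> norm (x i + y i)}" using finite_subset by blast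
    qed
  next
    case False
    then show ?thesis using True b by (simp add: lp_space_def)
  qed
  then show ?thesis using le sup_norm_le_iff[OF b] lp_norm_sup[OF True, of "\<lambda>i. x i + y i"] by simp
next
  case False
  then have p: "p \<noteq> 0" "p \<noteq> \<infinity>" by auto
  let ?q = "enn2real p"
  have q: "?q \<ge> 1" by (rule exponent_ge_1[OF p])
  show ?thesis
  proof (cases "lp_norm p x = 0 \<or> lp_norm p y = 0")
    case True
    then consider "x = (\<lambda>i. 0)" | "y = (\<lambda>i. 0)" using x y lp_eq_zero by fastforce
    then show ?thesis using x y by cases simp_all
  next
    case False
    then have pos: "lp_norm p x > 0" "lp_norm p y > 0" using x y lp_norm_nonneg by (simp_all add: order_less_le)
    define s t where "s = lp_norm p x" and "t = lp_norm p y"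
    have st: "s > 0" "t > 0" using pos s_def t_def by auto
    have sx: "(\<lambda>i. norm (x i) powr ?q) summable_on UNIV" and sy: "(\<lambda>i. norm (y i) powr ?q) summable_on UNIV"
      using x y lp_space_finite_exponent[OF p] by auto
    let ?M = "\<lambda>i. (s + t) powr (?q - 1) * (s powr (1 - ?q) * norm (x i) powr ?q + t powr (1 - ?q) * norm (y i) powr ?q)"
    have sM: "?M summable_on UNIV"
      by (intro summable_on_cmult_right summable_on_add sx sy)
    have le: "norm (x i + y i) powr ?q \<le> ?M i" for i
    proof -
      have "norm (x i + y i) powr ?q \<le> (norm (x i) + norm (y i)) powr ?q"
        using q by (intro powr_mono2 norm_triangle_ineq) auto
      also have "\<dots> \<le> ?M i" using q st by (intro powr_add_le_weighted) auto
      finally show ?thesis .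
    qed
    have sxy: "(\<lambda>i. norm (x i + y i) powr ?q) summable_on UNIV"
      by (rule summable_on_comparison_test[OF sM]) (use le in auto)
    have "(\<Sum>\<^sub>\<infinity>i. norm (x i + y i) powr ?q) \<le> infsum ?M UNIV"
      by (rule infsum_mono[OF sxy sM le])
    also have "\<dots> = (s + t) powr (?q - 1) * (s powr (1 - ?q) * s powr ?q + t powr (1 - ?q) * t powr ?q)"
      unfolding s_def t_def lp_norm_powr[OF p]
      by (simp add: infsum_cmult_right' infsum_add summable_on_cmult_right sx sy)
    also have "\<dots> = (s + t) powr ?q"
      using st by (simp add: powr_diff)
    finally have "lp_norm p (\<lambda>i. x i + y i) \<le> ((s + t) powr ?q) powr (1 / ?q)"
      unfolding lp_norm_finite_exponent[OF p] using q by (intro powr_mono2) (auto simp: infsum_nonneg)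
    also have "\<dots> = s + t" using q st by (simp add: powr_powr)
    finally show ?thesis using sxy lp_space_finite_exponent[OF p] s_def t_def by blast
  qed
qed

lemmas lp_add [simp] = lp_add_aux[THEN conjunct1]
lemmas lp_norm_triangle = lp_add_aux[THEN conjunct2]

lemma lp_diff [simp]:
  assumes "x \<in> lp_space p" "y \<in> lp_space p"
  shows "(\<lambda>i. x i - y i) \<in> lp_space p"
  using lp_add[OF assms(1) lp_scaleR[OF assms(2), of "- 1"]] by simp

lemma lp_norm_triangle_diff:
  assumes "x \<in> lp_space p" "y \<in> lp_space p"
  shows "lp_norm p (\<lambda>i. x i - y i) \<le> lp_norm p x + lp_norm p y"
  using lp_norm_triangle[OF assms(1) lp_scaleR[OF assms(2), of "- 1"]] lp_norm_scaleR[OF assms(2), of "- 1"] by simp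

lemma lp_norm_minus_commute:
  "lp_norm p (\<lambda>i. x i - y i) = lp_norm p (\<lambda>i. y i - x i)"
  by (rule lp_norm_cong) (rule norm_minus_commute)

lemma lp_norm_le_diff:
  assumes "x \<in> lp_space p" "y \<in> lp_space p"
  shows "lp_norm p x \<le> lp_norm p y + lp_norm p (\<lambda>i. x i - y i)"
  using lp_norm_triangle[OF assms(2) lp_diff[OF assms]] by simp

lemma lp_norm_triangle3:
  assumes "x \<in> lp_space p" "y \<in> lp_space p" "z \<in> lp_space p"
  shows "lp_norm p (\<lambda>i. x i - z i) \<le> lp_norm p (\<lambda>i. x i - y i) + lp_norm p (\<lambda>i. y i - z i)"
  using lp_norm_triangle[OF lp_diff[OF assms(1,2)] lp_diff[OF assms(2,3)]] by simp

lemma lp_sum: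
  assumes "\<And>a. a \<in> F \<Longrightarrow> f a \<in> lp_space p"
  shows "(\<lambda>i. \<Sum>a\<in>F. f a i) \<in> lp_space p \<and> lp_norm p (\<lambda>i. \<Sum>a\<in>F. f a i) \<le> (\<Sum>a\<in>F. lp_norm p (f a))"
  using assms
proof (induction F rule: infinite_finite_induct)
  case (insert a F)
  then have IH: "(\<lambda>i. \<Sum>a\<in>F. f a i) \<in> lp_space p" "lp_norm p (\<lambda>i. \<Sum>a\<in>F. f a i) \<le> (\<Sum>a\<in>F. lp_norm p (f a))"
    by auto
  have fa: "f a \<in> lp_space p" using insert by auto
  show ?case using insert(1,2) lp_add[OF fa IH(1)] lp_norm_triangle[OF fa IH(1)] IH(2) by auto
qed auto

lemma lp_Shift [simp]:
  fixes x :: "int^'n::finite \<Rightarrow> 'a::complex_banach"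
  assumes "x \<in> lp_space p"
  shows "Shift k x \<in> lp_space p"
proof -
  have bij: "bij_betw (\<lambda>i::int^'n. i - k) UNIV UNIV"
    by (rule bij_betw_byWitness[where f' = "\<lambda>i. i + k"]) auto
  consider "p = 0" | "p = \<infinity>" | "p \<noteq> 0" "p \<noteq> \<infinity>" by blast
  then show ?thesis
  proof cases
    case 1
    have "{i. e \<le> norm (x (i - k))} = (\<lambda>i. i + k) ` {i. e \<le> norm (x i)}" for e
      by (auto simp: image_iff) (metis diff_add_cancel)
    then show ?thesis using assms unfolding 1 lp_space_0_iff Shift_def by simp
  next
    case 2
    then show ?thesis using assms unfolding lp_space_def Shift_def bounded_iff by auto
  next
    case 3
    then show ?thesis using assms summable_on_reindex_bij_betw[OF bij, of "\<lambda>i. norm (x i) powr enn2real p"]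
      by (simp add: lp_space_finite_exponent Shift_def)
  qed
qed

lemma lp_norm_Shift [simp]:
  fixes x :: "int^'n::finite \<Rightarrow> 'a::complex_banach"
  shows "lp_norm p (Shift k x) = lp_norm p x"
proof -
  have bij: "bij_betw (\<lambda>i::int^'n. i - k) UNIV UNIV"
    by (rule bij_betw_byWitness[where f' = "\<lambda>i. i + k"]) auto
  have "range (\<lambda>i. norm (x (i - k))) = range (\<lambda>i. norm (x i))"
    using image_image[of "\<lambda>i. norm (x i)" "\<lambda>i. i - k" UNIV] bij_betw_imp_surj_on[OF bij] by simp
  then show ?thesis
    using infsum_reindex_bij_betw[OF bij, of "\<lambda>i. norm (x i) powr enn2real p"]
    by (simp add: lp_norm_def sup_norm_def Shift_def)
qed

lemma lp_finite_support:
  fixes x :: "int^'n::finite \<Rightarrow> 'a::complex_banach"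
  assumes "finite F" "\<And>i. i \<notin> F \<Longrightarrow> x i = 0"
  shows "x \<in> lp_space p" "lp_norm p x \<le> (\<Sum>i\<in>F. norm (x i))"
proof -
  have single: "(\<lambda>i. if i = j then v else 0) \<in> lp_space p \<and> lp_norm p (\<lambda>i. if i = j then v else 0) = norm v"
    for j :: "int^'n" and v :: 'a
  proof (cases "p = 0 \<or> p = \<infinity>")
    case True
    let ?x = "\<lambda>i. if i = j then v else 0"
    have b: "bounded (range ?x)" unfolding bounded_iff by (auto intro!: exI[of _ "norm v"])
    have "?x \<in> lp_space p"
    proof (cases "p = 0")
      case p0: True
      have "{i. e \<le> norm (?x i)} \<subseteq> {j}" if "e > 0" for e using that by auto
      then show ?thesis unfolding p0 lp_space_0_iff by (meson finite.simps finite_subset)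
    next
      case False
      then show ?thesis using True b by (simp add: lp_space_def)
    qed
    moreover have "sup_norm ?x \<le> norm v" using sup_norm_le_iff[OF b] by auto
    moreover have "norm v \<le> sup_norm ?x" using norm_le_sup_norm[OF b, of j] by simp
    ultimately show ?thesis by (simp add: lp_norm_sup[OF True])
  next
    case False
    then have p: "p \<noteq> 0" "p \<noteq> \<infinity>" by auto
    have q: "enn2real p \<ge> 1" by (rule exponent_ge_1[OF p])
    have "((\<lambda>i. norm (if i = j then v else 0) powr enn2real p) has_sum (norm v powr enn2real p)) UNIV"
      by (subst has_sum_cong_neutral[where T = "{j}" and g = "\<lambda>_. norm v powr enn2real p"]) (use q in \<open>auto intro!: has_sum_finiteI\<close>)
    then show ?thesis using q
      by (simp add: lp_space_finite_exponent[OF p] lp_norm_finite_exponent[OF p] has_sum_iff powr_powr)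
  qed
  have eq: "x = (\<lambda>i. \<Sum>j\<in>F. if i = j then x j else 0)"
    using assms by (auto simp: fun_eq_iff)
  have "(\<lambda>i. \<Sum>j\<in>F. if i = j then x j else 0) \<in> lp_space p \<and>
      lp_norm p (\<lambda>i. \<Sum>j\<in>F. if i = j then x j else 0) \<le> (\<Sum>j\<in>F. lp_norm p (\<lambda>i. if i = j then x j else 0))"
    by (rule lp_sum) (use single in blast)
  then show "x \<in> lp_space p" "lp_norm p x \<le> (\<Sum>i\<in>F. norm (x i))"
    using eq single by simp_all
qed

lemma lp_Proj [simp]: "Proj n x \<in> lp_space p"
  by (rule lp_finite_support(1)[of "{i. idx_norm i \<le> int n}"]) (auto simp: Proj_def)

lemma lp_norm_Proj_le: "x \<in> lp_space p \<Longrightarrow> lp_norm p (Proj n x) \<le> lp_norm p x"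
  using lp_solid(2)[of x 1 "Proj n x"] by (auto simp: Proj_def)

text \<open>Fatou's lemma for the sequence spaces: all norms are suprema of the norms of truncations. Membership
  fails for \<open>l\<^sup>0\<close>, whose truncated norms do not distinguish it from \<open>l\<^sup>\<infinity>\<close>.\<close>

lemma lp_norm_le_if_Proj_le:
  fixes x :: "int^'n::finite \<Rightarrow> 'a::complex_banach"
  assumes "\<And>n. lp_norm p (Proj n x) \<le> M"
  shows "p \<noteq> 0 \<Longrightarrow> x \<in> lp_space p" and "x \<in> lp_space p \<Longrightarrow> lp_norm p x \<le> M"
proof -
  have M: "M \<ge> 0" using assms[of 0] lp_norm_nonneg[OF lp_Proj[of 0 x]] by linarith
  have "(p \<noteq> 0 \<longrightarrow> x \<in> lp_space p) \<and> (x \<in> lp_space p \<longrightarrow> lp_norm p x \<le> M)"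
  proof (cases "p = 0 \<or> p = \<infinity>")
    case True
    have le: "norm (x i) \<le> M" for i
      using norm_le_lp_norm[OF lp_Proj[of "nat (idx_norm i)" x], of i] assms[of "nat (idx_norm i)"]
      by (simp add: Proj_def)
    then have b: "bounded (range x)" unfolding bounded_iff by blast
    show ?thesis using True b le sup_norm_le_iff[OF b] by (auto simp: lp_space_def lp_norm_sup)
  next
    case False
    then have p: "p \<noteq> 0" "p \<noteq> \<infinity>" by auto
    let ?q = "enn2real p"
    have q: "?q \<ge> 1" by (rule exponent_ge_1[OF p])
    have fin: "(\<Sum>i\<in>F. norm (x i) powr ?q) \<le> M powr ?q" if "finite F" for F
    proof -
      define n where "n = nat (Max (insert 0 (idx_norm ` F)))"
      have n: "idx_norm i \<le> int n" if "i \<in> F" for i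
      proof -
        have "idx_norm i \<le> Max (insert 0 (idx_norm ` F))" using that \<open>finite F\<close> by auto
        then show ?thesis by (simp add: n_def)
      qed
      have "(\<Sum>i\<in>F. norm (x i) powr ?q) = (\<Sum>i\<in>F. norm (Proj n x i) powr ?q)"
        by (rule sum.cong) (use n in \<open>auto simp: Proj_def\<close>)
      also have "\<dots> \<le> (\<Sum>\<^sub>\<infinity>i. norm (Proj n x i) powr ?q)"
        using lp_Proj[of n x] that by (intro finite_sum_le_infsum) (auto simp: lp_space_finite_exponent[OF p])
      also have "\<dots> = lp_norm p (Proj n x) powr ?q" by (simp add: lp_norm_powr[OF p])
      also have "\<dots> \<le> M powr ?q" using q assms by (intro powr_mono2) auto
      finally show ?thesis .
    qed
    have s: "(\<lambda>i. norm (x i) powr ?q) summable_on UNIV"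
      by (rule nonneg_bdd_above_summable_on) (use fin in \<open>auto simp: bdd_above_def\<close>)
    have "(\<Sum>\<^sub>\<infinity>i. norm (x i) powr ?q) \<le> M powr ?q"
      by (rule infsum_le_finite_sums[OF s]) (use fin in auto)
    then have "lp_norm p x \<le> (M powr ?q) powr (1 / ?q)"
      unfolding lp_norm_finite_exponent[OF p] using q by (intro powr_mono2) (auto simp: infsum_nonneg)
    then show ?thesis using s q M by (simp add: lp_space_finite_exponent[OF p] powr_powr)
  qed
  then show "p \<noteq> 0 \<Longrightarrow> x \<in> lp_space p" and "x \<in> lp_space p \<Longrightarrow> lp_norm p x \<le> M" by auto
qed

text \<open>The norm of a direct sum over a cube and its complement is a monotone function of the norms of the
  two parts, hence a common lower bound of two diagonal blocks is one of the whole without any loss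
  of constant. This is needed for \<open>A\<^sub>n\<close> and the multiple of the identity in an extended section.\<close>

lemma lp_norm_block_lower_bound:
  fixes x y :: "int^'n::finite \<Rightarrow> 'a::complex_banach"
  assumes x: "x \<in> lp_space p" and y: "y \<in> lp_space p" and \<nu>: "\<nu> \<ge> 0"
    and inner: "\<nu> * lp_norm p (Proj n x) \<le> lp_norm p (Proj n y)"
    and outer: "\<And>i. \<not> idx_norm i \<le> int n \<Longrightarrow> \<nu> * norm (x i) \<le> norm (y i)"
  shows "\<nu> * lp_norm p x \<le> lp_norm p y"
proof (cases "p = 0 \<or> p = \<infinity>")
  case True
  have "norm (\<nu> *\<^sub>R x i) \<le> lp_norm p y" for i
  proof (cases "idx_norm i \<le> int n")
    case i: True
    have "norm (\<nu> *\<^sub>R x i) = \<nu> * norm (Proj n x i)" using i \<nu> by (simp add: Proj_def)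
    also have "\<dots> \<le> \<nu> * lp_norm p (Proj n x)" by (intro mult_left_mono norm_le_lp_norm lp_Proj \<nu>)
    also have "\<dots> \<le> lp_norm p y" using inner lp_norm_Proj_le[OF y, of n] by linarith
    finally show ?thesis .
  next
    case False
    then show ?thesis using outer[OF False] norm_le_lp_norm[OF y, of i] \<nu> by simp
  qed
  moreover have "bounded (range (\<lambda>i. \<nu> *\<^sub>R x i))"
    using lp_bounded[OF True lp_scaleR[OF x]] .
  ultimately have "lp_norm p (\<lambda>i. \<nu> *\<^sub>R x i) \<le> lp_norm p y"
    by (simp add: lp_norm_sup[OF True] sup_norm_le_iff)
  then show ?thesis using lp_norm_scaleR[OF x, of \<nu>] \<nu> by simp
next
  case False
  then have p: "p \<noteq> 0" "p \<noteq> \<infinity>" by auto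
  let ?q = "enn2real p"
  have q: "?q \<ge> 1" by (rule exponent_ge_1[OF p])
  let ?K = "{i::int^'n. idx_norm i \<le> int n}"
  have split: "lp_norm p z powr ?q = lp_norm p (Proj n z) powr ?q + (\<Sum>\<^sub>\<infinity>i\<in>-?K. norm (z i) powr ?q)"
    and sz: "(\<lambda>i. norm (z i) powr ?q) summable_on -?K" if z: "z \<in> lp_space p" for z :: "int^'n \<Rightarrow> 'a"
  proof -
    have s: "(\<lambda>i. norm (z i) powr ?q) summable_on UNIV" using z lp_space_finite_exponent[OF p] by blast
    show sc: "(\<lambda>i. norm (z i) powr ?q) summable_on -?K"
      by (rule summable_on_subset_banach[OF s]) auto
    have "(\<Sum>\<^sub>\<infinity>i. norm (z i) powr ?q) = (\<Sum>\<^sub>\<infinity>i\<in>?K. norm (z i) powr ?q) + (\<Sum>\<^sub>\<infinity>i\<in>-?K. norm (z i) powr ?q)"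
      using infsum_Un_disjoint[of "\<lambda>i. norm (z i) powr ?q" ?K "-?K"] sc by (simp del: infsum_finite)
    moreover have "(\<Sum>\<^sub>\<infinity>i\<in>?K. norm (z i) powr ?q) = (\<Sum>\<^sub>\<infinity>i. norm (Proj n z i) powr ?q)"
      by (rule infsum_cong_neutral) (use q in \<open>auto simp: Proj_def\<close>)
    ultimately show "lp_norm p z powr ?q = lp_norm p (Proj n z) powr ?q + (\<Sum>\<^sub>\<infinity>i\<in>-?K. norm (z i) powr ?q)"
      by (simp add: lp_norm_powr[OF p])
  qed
  have "(\<nu> * lp_norm p x) powr ?q = (\<nu> * lp_norm p (Proj n x)) powr ?q + (\<Sum>\<^sub>\<infinity>i\<in>-?K. \<nu> powr ?q * norm (x i) powr ?q)"
    using split[OF x] \<nu> x by (simp add: powr_mult distrib_left infsum_cmult_right')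
  also have "\<dots> \<le> lp_norm p (Proj n y) powr ?q + (\<Sum>\<^sub>\<infinity>i\<in>-?K. norm (y i) powr ?q)"
  proof (rule add_mono)
    show "(\<nu> * lp_norm p (Proj n x)) powr ?q \<le> lp_norm p (Proj n y) powr ?q"
      using q \<nu> inner by (intro powr_mono2) auto
    show "(\<Sum>\<^sub>\<infinity>i\<in>-?K. \<nu> powr ?q * norm (x i) powr ?q) \<le> (\<Sum>\<^sub>\<infinity>i\<in>-?K. norm (y i) powr ?q)"
    proof (rule infsum_mono[OF summable_on_cmult_right[OF sz[OF x]] sz[OF y]])
      fix i assume "i \<in> -?K"
      then have "(\<nu> * norm (x i)) powr ?q \<le> norm (y i) powr ?q"
        using q \<nu> outer by (intro powr_mono2) auto
      then show "\<nu> powr ?q * norm (x i) powr ?q \<le> norm (y i) powr ?q" using \<nu> by (simp add: powr_mult)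
    qed
  qed
  also have "\<dots> = lp_norm p y powr ?q" using split[OF y] by simp
  finally have le: "(\<nu> * lp_norm p x) powr ?q \<le> lp_norm p y powr ?q" .
  show ?thesis
  proof (rule ccontr)
    assume "\<not> ?thesis"
    then have "lp_norm p y powr ?q < (\<nu> * lp_norm p x) powr ?q"
      using q y by (intro powr_less_mono2) auto
    then show False using le by simp
  qed
qed

lemma lp_Mult_aux:
  assumes "x \<in> lp_space p" "\<And>i. \<bar>\<phi> i\<bar> \<le> 1"
  shows "Mult \<phi> x \<in> lp_space p \<and> lp_norm p (Mult \<phi> x) \<le> lp_norm p x"
  using lp_solid[OF assms(1), of 1 "Mult \<phi> x"] assms(2)
  by (auto simp: Mult_def mult_left_le_one_le)

lemmas lp_Mult [simp] = lp_Mult_aux[THEN conjunct1]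
lemmas lp_norm_Mult_le = lp_Mult_aux[THEN conjunct2]

lemma lp_Mult_cutoff [simp]: "x \<in> lp_space p \<Longrightarrow> lip_cutoff r \<phi> \<Longrightarrow> Mult \<phi> x \<in> lp_space p"
  by (simp add: lip_cutoff_abs_le)

section \<open>Bounded operators and their norms\<close>

lemma scaling_closed_lp [simp]: "scaling_closed p (lp_space p :: (int ^ 'n::finite \<Rightarrow> 'a::complex_banach) set)"
  by (simp add: scaling_closed_def)

lemma im_Proj_iff: "x \<in> im_Proj p n \<longleftrightarrow> Proj n x = x"
  unfolding im_Proj_def image_iff by (metis Proj_Proj lp_Proj min.idem)

lemma Proj_in_im_Proj [simp]: "Proj n x \<in> im_Proj p n"
  by (simp add: im_Proj_iff Proj_Proj)

lemma im_Proj_lp: "x \<in> im_Proj p n \<Longrightarrow> x \<in> lp_space p"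
  by (metis im_Proj_iff lp_Proj)

lemma scaling_closed_im_Proj [simp]: "scaling_closed p (im_Proj p n :: (int ^ 'n::finite \<Rightarrow> 'a::complex_banach) set)"
  unfolding scaling_closed_def using im_Proj_lp by (auto simp: im_Proj_iff Proj_eq_iff)

lemma bounded_ops_scaleC:
  assumes "T \<in> bounded_ops p E" "x \<in> E"
  shows "T (\<lambda>i. z *\<^sub>C x i) = (\<lambda>i. z *\<^sub>C T x i)"
proof -
  have "\<forall>x\<in>E. \<forall>z. T (\<lambda>i. z *\<^sub>C x i) = (\<lambda>i. z *\<^sub>C T x i)"
    using assms(1) by (simp add: bounded_ops_def)
  then show ?thesis using assms(2) by simp
qed

lemma bounded_ops_scaleR:
  assumes "T \<in> bounded_ops p E" "x \<in> E"
  shows "T (\<lambda>i. r *\<^sub>R x i) = (\<lambda>i. r *\<^sub>R T x i)"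
  using bounded_ops_scaleC[OF assms, of "complex_of_real r"] by (simp add: scaleC_of_real)

lemma bounded_ops_zero:
  assumes "T \<in> bounded_ops p E" "scaling_closed p E"
  shows "T (\<lambda>i. 0) = (\<lambda>i. 0)"
  using bounded_ops_scaleR[OF assms(1), of "\<lambda>i. 0" 0] assms(2) by (auto simp: scaling_closed_def)

lemma bounded_ops_add:
  assumes "T \<in> bounded_ops p E" "x \<in> E" "y \<in> E"
  shows "T (\<lambda>i. x i + y i) = (\<lambda>i. T x i + T y i)"
proof -
  have "\<forall>x\<in>E. \<forall>y\<in>E. T (\<lambda>i. x i + y i) = (\<lambda>i. T x i + T y i)"
    using assms(1) by (simp add: bounded_ops_def)
  then show ?thesis using assms(2,3) by simp
qed

lemma bounded_ops_diff:
  assumes "T \<in> bounded_ops p E" "scaling_closed p E" "x \<in> E" "y \<in> E"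
  shows "T (\<lambda>i. x i - y i) = (\<lambda>i. T x i - T y i)"
proof -
  have y: "(\<lambda>i. (- 1) *\<^sub>R y i) \<in> E" using assms(2,4) unfolding scaling_closed_def by blast
  have "T (\<lambda>i. x i + (- 1) *\<^sub>R y i) = (\<lambda>i. T x i + T (\<lambda>i. (- 1) *\<^sub>R y i) i)"
    by (rule bounded_ops_add[OF assms(1,3) y])
  then show ?thesis using bounded_ops_scaleR[OF assms(1,4), of "- 1"] by simp
qed

lemma op_norm_bdd:
  assumes "T \<in> bounded_ops p E" "scaling_closed p E"
  shows "bdd_above ((\<lambda>x. lp_norm p (T x)) ` {x \<in> E. lp_norm p x \<le> 1})"
proof -
  obtain C where C: "\<And>x. x \<in> E \<Longrightarrow> lp_norm p (T x) \<le> C * lp_norm p x"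
    using assms(1) unfolding bounded_ops_def by blast
  have "lp_norm p (T x) \<le> \<bar>C\<bar>" if "x \<in> E" "lp_norm p x \<le> 1" for x
  proof -
    have "C * lp_norm p x \<le> \<bar>C\<bar> * 1"
      using that assms(2) by (intro mult_mono) (auto simp: scaling_closed_def subset_iff)
    then show ?thesis using C[OF that(1)] by linarith
  qed
  then show ?thesis unfolding bdd_above_def by auto
qed

lemma op_norm_ge:
  assumes "T \<in> bounded_ops p E" "scaling_closed p E" "x \<in> E" "lp_norm p x \<le> 1"
  shows "lp_norm p (T x) \<le> op_norm p E T"
  unfolding op_norm_def by (rule cSUP_upper[OF _ op_norm_bdd]) (use assms in auto)

text \<open>The norm is a supremum over the unit ball, so this is scaling; the vector zero has to be treated apart.\<close>

lemma op_norm_bound: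
  assumes T: "T \<in> bounded_ops p E" and E: "scaling_closed p E" and x: "x \<in> E"
  shows "lp_norm p (T x) \<le> op_norm p E T * lp_norm p x"
proof (cases "lp_norm p x = 0")
  case True
  have xl: "x \<in> lp_space p" using x E by (auto simp: scaling_closed_def)
  have "x = (\<lambda>i. 0)" using lp_eq_zero[OF xl] True by simp
  then show ?thesis using bounded_ops_zero[OF T E] by simp
next
  case False
  have xl: "x \<in> lp_space p" and Tx: "T x \<in> lp_space p"
    using x E T by (auto simp: scaling_closed_def bounded_ops_def)
  have pos: "lp_norm p x > 0" using False lp_norm_nonneg[OF xl] by linarith
  let ?y = "\<lambda>i. (1 / lp_norm p x) *\<^sub>R x i"
  have "?y \<in> E" using x E by (auto simp: scaling_closed_def)
  moreover have "lp_norm p ?y \<le> 1" using lp_norm_scaleR[OF xl] pos by simp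
  ultimately have "lp_norm p (T ?y) \<le> op_norm p E T" using op_norm_ge[OF T E] by blast
  then have "1 / lp_norm p x * lp_norm p (T x) \<le> op_norm p E T"
    using bounded_ops_scaleR[OF T x, of "1 / lp_norm p x"] lp_norm_scaleR[OF Tx, of "1 / lp_norm p x"] pos
    by simp
  then show ?thesis using pos by (simp add: field_simps)
qed

lemma op_norm_le:
  assumes E: "scaling_closed p E" and "C \<ge> 0" and "\<And>x. x \<in> E \<Longrightarrow> lp_norm p (T x) \<le> C * lp_norm p x"
  shows "op_norm p E T \<le> C"
  unfolding op_norm_def
proof (rule cSUP_least)
  show "{x \<in> E. lp_norm p x \<le> 1} \<noteq> {}" using E by (auto simp: scaling_closed_def intro!: exI[of _ "\<lambda>i. 0"])
  fix x assume x: "x \<in> {x \<in> E. lp_norm p x \<le> 1}"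
  then have "C * lp_norm p x \<le> C * 1" using assms(2) by (intro mult_left_mono) auto
  then show "lp_norm p (T x) \<le> C" using assms(3)[of x] x by auto
qed

lemma op_norm_nonneg:
  assumes "T \<in> bounded_ops p E" "scaling_closed p E"
  shows "0 \<le> op_norm p E T"
  using op_norm_ge[OF assms, of "\<lambda>i. 0"] assms(2) bounded_ops_zero[OF assms] by (simp add: scaling_closed_def)

lemma Lp_lp [simp]: "T \<in> Lp p \<Longrightarrow> x \<in> lp_space p \<Longrightarrow> T x \<in> lp_space p"
  by (auto simp: bounded_ops_def)

lemma Lp_diff: "T \<in> Lp p \<Longrightarrow> x \<in> lp_space p \<Longrightarrow> y \<in> lp_space p \<Longrightarrow> T (\<lambda>i. x i - y i) = (\<lambda>i. T x i - T y i)"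
  by (rule bounded_ops_diff) auto

lemma Lp_add: "T \<in> Lp p \<Longrightarrow> x \<in> lp_space p \<Longrightarrow> y \<in> lp_space p \<Longrightarrow> T (\<lambda>i. x i + y i) = (\<lambda>i. T x i + T y i)"
  by (rule bounded_ops_add)

lemma Lp_bound: "T \<in> Lp p \<Longrightarrow> x \<in> lp_space p \<Longrightarrow> lp_norm p (T x) \<le> Lp_norm p T * lp_norm p x"
  by (rule op_norm_bound) auto

lemma Lp_norm_nonneg [simp]: "T \<in> Lp p \<Longrightarrow> 0 \<le> Lp_norm p T"
  by (rule op_norm_nonneg) auto

lemma Lp_norm_le: "C \<ge> 0 \<Longrightarrow> (\<And>x. x \<in> lp_space p \<Longrightarrow> lp_norm p (T x) \<le> C * lp_norm p x) \<Longrightarrow> Lp_norm p T \<le> C"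
  by (rule op_norm_le) auto

lemma Lp_I:
  assumes "\<And>x. x \<in> lp_space p \<Longrightarrow> T x \<in> lp_space p"
    and "\<And>x y. x \<in> lp_space p \<Longrightarrow> y \<in> lp_space p \<Longrightarrow> T (\<lambda>i. x i + y i) = (\<lambda>i. T x i + T y i)"
    and "\<And>x z. x \<in> lp_space p \<Longrightarrow> T (\<lambda>i. z *\<^sub>C x i) = (\<lambda>i. z *\<^sub>C T x i)"
    and "\<And>x. x \<in> lp_space p \<Longrightarrow> lp_norm p (T x) \<le> C * lp_norm p x"
  shows "T \<in> Lp p"
  using assms unfolding bounded_ops_def mem_Collect_eq by (intro conjI ballI allI) (auto, blast)

lemma Lp_comp [simp]:
  assumes "S \<in> Lp p" "T \<in> Lp p"
  shows "S \<circ> T \<in> Lp p"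
proof (rule Lp_I)
  show "lp_norm p ((S \<circ> T) x) \<le> (Lp_norm p S * Lp_norm p T) * lp_norm p x" if "x \<in> lp_space p" for x
    using Lp_bound[OF assms(1), of "T x"] Lp_bound[OF assms(2) that] assms that
    by simp (metis Lp_norm_nonneg mult_left_mono order_trans mult.assoc)
qed (use assms in \<open>simp_all add: Lp_add bounded_ops_scaleC\<close>)

lemma Lp_plus:
  assumes "S \<in> Lp p" "T \<in> Lp p"
  shows "(\<lambda>x i. S x i + T x i) \<in> Lp p"
proof (rule Lp_I)
  show "lp_norm p (\<lambda>i. S x i + T x i) \<le> (Lp_norm p S + Lp_norm p T) * lp_norm p x" if "x \<in> lp_space p" for x
    using lp_norm_triangle[of "S x" "T x"] Lp_bound[OF assms(1) that] Lp_bound[OF assms(2) that] assms that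
    by (simp add: distrib_right)
qed (use assms in \<open>simp_all add: Lp_add bounded_ops_scaleC scaleC_add_right algebra_simps\<close>)

lemma Lp_Mult [simp]:
  assumes "\<And>i. \<bar>\<phi> i\<bar> \<le> 1"
  shows "Mult \<phi> \<in> Lp p"
proof (rule Lp_I)
  show "lp_norm p (Mult \<phi> x) \<le> 1 * lp_norm p x" if "x \<in> lp_space p" for x
    using lp_norm_Mult_le[OF that assms] by simp
  show "Mult \<phi> (\<lambda>i. z *\<^sub>C x i) = (\<lambda>i. z *\<^sub>C Mult \<phi> x i)" for x z
    by (simp add: Mult_def scaleC_scaleC mult.commute flip: scaleC_of_real)
  show "Mult \<phi> x \<in> lp_space p" if "x \<in> lp_space p" for x
    using that assms by simp
qed (auto simp: Mult_def scaleR_add_right)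

lemma Proj_eq_Mult: "Proj n = Mult (\<lambda>i. if idx_norm i \<le> int n then 1 else 0)"
  by (auto simp: Proj_def Mult_def fun_eq_iff)

lemma Coproj_eq_Mult: "Coproj n = Mult (\<lambda>i. if idx_norm i \<le> int n then 0 else 1)"
  by (auto simp: Coproj_def Proj_def Mult_def fun_eq_iff)

lemma Lp_Proj [simp]: "Proj n \<in> Lp p" and Lp_Coproj [simp]: "Coproj n \<in> Lp p"
  by (auto simp: Proj_eq_Mult Coproj_eq_Mult)

lemma Lp_Shift [simp]:
  fixes h :: "int^'n::finite"
  shows "(Shift h :: ('n, 'a::complex_banach) seq_op) \<in> Lp p"
proof (rule Lp_I[where C = 1])
  fix x y :: "int^'n \<Rightarrow> 'a" and z
  show "Shift h (\<lambda>i. x i + y i) = (\<lambda>i. Shift h x i + Shift h y i)"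
    "Shift h (\<lambda>i. z *\<^sub>C x i) = (\<lambda>i. z *\<^sub>C Shift h x i)"
    by (simp_all add: Shift_def)
qed auto

lemma Lp_scaleR:
  assumes "T \<in> Lp p"
  shows "(\<lambda>x i. c *\<^sub>R T x i) \<in> Lp p"
proof (rule Lp_I)
  show "lp_norm p (\<lambda>i. c *\<^sub>R T x i) \<le> (\<bar>c\<bar> * Lp_norm p T) * lp_norm p x" if "x \<in> lp_space p" for x
    using lp_norm_scaleR[of "T x" c] assms that Lp_bound[OF assms that]
    by (simp add: mult.assoc mult_left_mono)
  show "(\<lambda>i. c *\<^sub>R T (\<lambda>i. z *\<^sub>C x i) i) = (\<lambda>i. z *\<^sub>C c *\<^sub>R T x i)" if "x \<in> lp_space p" for x z
    using assms that by (simp add: bounded_ops_scaleC scaleC_scaleC mult.commute flip: scaleC_of_real)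
qed (use assms in \<open>simp_all add: Lp_add scaleR_add_right\<close>)

lemma Lp_minus [simp]:
  assumes "S \<in> Lp p" "T \<in> Lp p"
  shows "S - T \<in> Lp p"
  using Lp_plus[OF assms(1) Lp_scaleR[OF assms(2), of "- 1"]]
  by (simp add: fun_diff_def)

section \<open>Commutators with slowly varying functions\<close>

lemma comm_boundD:
  "comm_bound p r \<epsilon> T \<Longrightarrow> lip_cutoff r \<phi> \<Longrightarrow> x \<in> lp_space p \<Longrightarrow>
     lp_norm p (\<lambda>i. T (Mult \<phi> x) i - Mult \<phi> (T x) i) \<le> \<epsilon> * lp_norm p x"
  by (simp add: comm_bound_def)

text \<open>The two forms in which a commutator estimate is used: a cutoff may be moved through \<open>T\<close> in either direction.\<close>

lemma comm_bound_upper: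
  assumes T: "T \<in> Lp p" "comm_bound p r \<epsilon> T" and \<phi>: "lip_cutoff r \<phi>" and x: "x \<in> lp_space p"
  shows "lp_norm p (T (Mult \<phi> x)) \<le> lp_norm p (Mult \<phi> (T x)) + \<epsilon> * lp_norm p x"
    and "lp_norm p (Mult \<phi> (T x)) \<le> lp_norm p (T (Mult \<phi> x)) + \<epsilon> * lp_norm p x"
proof -
  have "T (Mult \<phi> x) \<in> lp_space p" "Mult \<phi> (T x) \<in> lp_space p"
    using T(1) \<phi> x by auto
  note l = lp_norm_le_diff[OF this] lp_norm_le_diff[OF this(2,1)]
  then show "lp_norm p (T (Mult \<phi> x)) \<le> lp_norm p (Mult \<phi> (T x)) + \<epsilon> * lp_norm p x"
    "lp_norm p (Mult \<phi> (T x)) \<le> lp_norm p (T (Mult \<phi> x)) + \<epsilon> * lp_norm p x"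
    using comm_boundD[OF T(2) \<phi> x]
    by (auto simp: lp_norm_minus_commute[of "Mult \<phi> (T x)" "T (Mult \<phi> x)"])
qed

text \<open>On the diagonal \<open>\<alpha>\<close> the commutator multiplies by \<open>\<phi>(i - \<alpha>) - \<phi>(i)\<close>, which is at most \<open>|\<alpha>|/r\<close>; there are
  finitely many diagonals.\<close>

lemma band_operator_Lp_and_comm:
  fixes B :: "('n::finite, 'a::complex_banach) seq_op"
  assumes "band_operator B"
  shows "B \<in> Lp p" and "\<exists>D\<ge>0. \<forall>r>0. comm_bound p r (D / r) B"
proof -
  obtain F a where F: "finite F" and a: "\<And>\<alpha>. \<alpha> \<in> F \<Longrightarrow> bounded_coeff (a \<alpha>)"
    and B: "B = (\<lambda>x i. \<Sum>\<alpha>\<in>F. blinfun_apply (a \<alpha> i) (Shift \<alpha> x i))"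
    using assms unfolding band_operator_def by blast
  have "\<forall>\<alpha>\<in>F. \<exists>K\<ge>0. \<forall>i. norm (a \<alpha> i) \<le> K"
    using a unfolding bounded_coeff_def bounded_iff by (metis norm_ge_zero order_trans rangeI)
  then obtain K where K: "\<And>\<alpha>. \<alpha> \<in> F \<Longrightarrow> K \<alpha> \<ge> 0" "\<And>\<alpha> i. \<alpha> \<in> F \<Longrightarrow> norm (a \<alpha> i) \<le> K \<alpha>" by metis
  have le: "norm (blinfun_apply (a \<alpha> i) v) \<le> K \<alpha> * norm v" if "\<alpha> \<in> F" for \<alpha> i v
    using norm_blinfun[of "a \<alpha> i" v] mult_right_mono[OF K(2)[OF that, of i], of "norm v"] by simp
  have 1: "(\<lambda>i. blinfun_apply (a \<alpha> i) (Shift \<alpha> x i)) \<in> lp_space p"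
      "lp_norm p (\<lambda>i. blinfun_apply (a \<alpha> i) (Shift \<alpha> x i)) \<le> K \<alpha> * lp_norm p x"
    if "\<alpha> \<in> F" "x \<in> lp_space p" for \<alpha> x
    using lp_solid[of "Shift \<alpha> x" "K \<alpha>" "\<lambda>i. blinfun_apply (a \<alpha> i) (Shift \<alpha> x i)"] le K that by auto
  show "B \<in> Lp p"
  proof (rule Lp_I)
    fix x y :: "int^'n \<Rightarrow> 'a" and z assume x: "x \<in> lp_space p"
    show "B x \<in> lp_space p" unfolding B by (rule lp_sum[THEN conjunct1]) (use 1 x in simp)
    show "lp_norm p (B x) \<le> (\<Sum>\<alpha>\<in>F. K \<alpha>) * lp_norm p x"
      unfolding B sum_distrib_right
      by (rule order_trans[OF lp_sum[THEN conjunct2]]) (use 1 x in \<open>auto intro: sum_mono\<close>)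
    show "B (\<lambda>i. x i + y i) = (\<lambda>i. B x i + B y i)"
      unfolding B by (simp add: Shift_def blinfun.add_right sum.distrib)
    have "blinfun_apply (a \<alpha> i) (z *\<^sub>C v) = z *\<^sub>C blinfun_apply (a \<alpha> i) v" if "\<alpha> \<in> F" for \<alpha> i v
      using a[OF that] unfolding bounded_coeff_def by blast
    then show "B (\<lambda>i. z *\<^sub>C x i) = (\<lambda>i. z *\<^sub>C B x i)"
      unfolding B by (simp add: Shift_def scaleC_sum_right cong: sum.cong)
  qed
  define D where "D = (\<Sum>\<alpha>\<in>F. K \<alpha> * of_int (idx_norm \<alpha>))"
  have "comm_bound p r (D / r) B" if r: "r > 0" for r
    unfolding comm_bound_def
  proof (intro allI impI)
    fix \<phi> :: "int^'n \<Rightarrow> real" and x :: "int^'n \<Rightarrow> 'a" assume \<phi>: "lip_cutoff r \<phi>" and x: "x \<in> lp_space p"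
    let ?f = "\<lambda>\<alpha> i. blinfun_apply (a \<alpha> i) ((\<phi> (i - \<alpha>) - \<phi> i) *\<^sub>R x (i - \<alpha>))"
    have eq: "(\<lambda>i. B (Mult \<phi> x) i - Mult \<phi> (B x) i) = (\<lambda>i. \<Sum>\<alpha>\<in>F. ?f \<alpha> i)"
      unfolding B Mult_def Shift_def
      by (simp add: sum_subtractf scaleR_sum_right blinfun.scaleR_right scaleR_diff_left blinfun.diff_right)
    have f: "?f \<alpha> \<in> lp_space p \<and> lp_norm p (?f \<alpha>) \<le> (K \<alpha> * of_int (idx_norm \<alpha>) / r) * lp_norm p x" if "\<alpha> \<in> F" for \<alpha>
    proof -
      have "norm (?f \<alpha> i) \<le> (K \<alpha> * of_int (idx_norm \<alpha>) / r) * norm (Shift \<alpha> x i)" for i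
      proof -
        have "r * \<bar>\<phi> (i - \<alpha>) - \<phi> i\<bar> \<le> of_int (idx_norm \<alpha>)"
          using lip_cutoffD(3)[OF \<phi>, of "i - \<alpha>" i] by simp
        then have "\<bar>\<phi> (i - \<alpha>) - \<phi> i\<bar> \<le> of_int (idx_norm \<alpha>) / r" using r by (simp add: field_simps)
        then have "K \<alpha> * (\<bar>\<phi> (i - \<alpha>) - \<phi> i\<bar> * norm (x (i - \<alpha>))) \<le> K \<alpha> * (of_int (idx_norm \<alpha>) / r * norm (x (i - \<alpha>)))"
          using K(1)[OF that] by (intro mult_left_mono mult_right_mono) auto
        then show ?thesis using le[OF that, of i "(\<phi> (i - \<alpha>) - \<phi> i) *\<^sub>R x (i - \<alpha>)"] by (simp add: Shift_def)
      qed
      then show ?thesis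
        using lp_solid[of "Shift \<alpha> x" "K \<alpha> * of_int (idx_norm \<alpha>) / r" "?f \<alpha>"] K(1)[OF that] r x by simp
    qed
    have "lp_norm p (\<lambda>i. \<Sum>\<alpha>\<in>F. ?f \<alpha> i) \<le> (\<Sum>\<alpha>\<in>F. lp_norm p (?f \<alpha>))"
      by (rule lp_sum[THEN conjunct2]) (use f in blast)
    also have "\<dots> \<le> (\<Sum>\<alpha>\<in>F. (K \<alpha> * of_int (idx_norm \<alpha>) / r) * lp_norm p x)"
      by (rule sum_mono) (use f in blast)
    also have "\<dots> = D / r * lp_norm p x"
      by (simp add: D_def sum_distrib_right sum_divide_distrib)
    finally show "lp_norm p (\<lambda>i. B (Mult \<phi> x) i - Mult \<phi> (B x) i) \<le> D / r * lp_norm p x" unfolding eq .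
  qed
  moreover have "D \<ge> 0" unfolding D_def using K by (intro sum_nonneg) auto
  ultimately show "\<exists>D\<ge>0. \<forall>r>0. comm_bound p r (D / r) B" by blast
qed

text \<open>The key property of band-dominated operators. The commutator norm is continuous in the operator, uniformly
  over all cutoffs, so the estimate for band operators extends to their closure.\<close>

lemma band_dominated_comm_bound:
  fixes A :: "('n::finite, 'a::complex_banach) seq_op"
  assumes A: "A \<in> band_dominated p" and "\<epsilon> > 0"
  shows "\<exists>r>0. comm_bound p r \<epsilon> A"
proof -
  have "\<epsilon> / 3 > 0" using assms by simp
  then obtain B where B: "band_operator B" and AB: "Lp_norm p (A - B) < \<epsilon> / 3"
    using A unfolding band_dominated_def by blast
  have A': "A \<in> Lp p" using A by (simp add: band_dominated_def)
  note B' = band_operator_Lp_and_comm(1)[OF B]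
  obtain D where D: "D \<ge> 0" "\<And>r. r > 0 \<Longrightarrow> comm_bound p r (D / r) B"
    using band_operator_Lp_and_comm(2)[OF B] by blast
  define r where "r = 3 * (D + 1) / \<epsilon>"
  have r: "r > 0" "D / r \<le> \<epsilon> / 3" using D(1) \<open>\<epsilon> > 0\<close> by (auto simp: r_def field_simps)
  have close: "lp_norm p (\<lambda>i. A x i - B x i) \<le> \<epsilon> / 3 * lp_norm p x" if "x \<in> lp_space p" for x
  proof -
    have "lp_norm p (\<lambda>i. A x i - B x i) \<le> Lp_norm p (A - B) * lp_norm p x"
      using Lp_bound[OF Lp_minus[OF A' B'] that] by (simp add: fun_diff_def)
    also have "\<dots> \<le> \<epsilon> / 3 * lp_norm p x" using AB that by (intro mult_right_mono) auto
    finally show ?thesis .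
  qed
  have "comm_bound p r \<epsilon> A" unfolding comm_bound_def
  proof (intro allI impI)
    fix \<phi> :: "int^'n \<Rightarrow> real" and x :: "int^'n \<Rightarrow> 'a" assume \<phi>: "lip_cutoff r \<phi>" and x: "x \<in> lp_space p"
    have \<phi>x: "Mult \<phi> x \<in> lp_space p" "lp_norm p (Mult \<phi> x) \<le> lp_norm p x"
      using \<phi> x lp_norm_Mult_le[OF x] lip_cutoff_abs_le[OF \<phi>] by auto
    have m: "Mult \<phi> (A x) \<in> lp_space p" "Mult \<phi> (B x) \<in> lp_space p" using A' B' x \<phi> by auto
    have 1: "lp_norm p (\<lambda>i. A (Mult \<phi> x) i - B (Mult \<phi> x) i) \<le> \<epsilon> / 3 * lp_norm p x"
      using close[OF \<phi>x(1)] \<phi>x(2) \<open>\<epsilon> > 0\<close> by (meson divide_nonneg_nonneg less_imp_le mult_left_mono order_trans zero_le_numeral)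
    have 2: "lp_norm p (\<lambda>i. B (Mult \<phi> x) i - Mult \<phi> (B x) i) \<le> \<epsilon> / 3 * lp_norm p x"
      using comm_boundD[OF D(2)[OF r(1)] \<phi> x] r(2) x by (meson lp_norm_nonneg mult_right_mono order_trans)
    have "lp_norm p (\<lambda>i. Mult \<phi> (B x) i - Mult \<phi> (A x) i) \<le> lp_norm p (\<lambda>i. B x i - A x i)"
      using lp_norm_Mult_le[of "\<lambda>i. B x i - A x i" \<phi>] A' B' x lip_cutoff_abs_le[OF \<phi>] by (simp add: Mult_diff)
    also have "\<dots> \<le> \<epsilon> / 3 * lp_norm p x"
      using close[OF x] lp_norm_minus_commute[of "B x" "A x"] by simp
    finally have 3: "lp_norm p (\<lambda>i. Mult \<phi> (B x) i - Mult \<phi> (A x) i) \<le> \<epsilon> / 3 * lp_norm p x" .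
    have "lp_norm p (\<lambda>i. A (Mult \<phi> x) i - Mult \<phi> (A x) i) \<le>
        lp_norm p (\<lambda>i. A (Mult \<phi> x) i - B (Mult \<phi> x) i) + lp_norm p (\<lambda>i. B (Mult \<phi> x) i - Mult \<phi> (A x) i)"
      by (rule lp_norm_triangle3) (use A' B' \<phi>x m in auto)
    also have "lp_norm p (\<lambda>i. B (Mult \<phi> x) i - Mult \<phi> (A x) i) \<le>
        lp_norm p (\<lambda>i. B (Mult \<phi> x) i - Mult \<phi> (B x) i) + lp_norm p (\<lambda>i. Mult \<phi> (B x) i - Mult \<phi> (A x) i)"
      by (rule lp_norm_triangle3) (use A' B' \<phi>x m in auto)
    finally show "lp_norm p (\<lambda>i. A (Mult \<phi> x) i - Mult \<phi> (A x) i) \<le> \<epsilon> * lp_norm p x" using 1 2 3 by linarith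
  qed
  then show ?thesis using r(1) by blast
qed

lemma fin_section_Lp [simp]: "A \<in> Lp p \<Longrightarrow> fin_section A n \<in> Lp p"
  by (simp add: fin_section_def)

lemma ext_section_Lp [simp]: "A \<in> Lp p \<Longrightarrow> ext_section A c n \<in> Lp p"
  using Lp_plus[OF fin_section_Lp Lp_scaleR[OF Lp_Coproj]] unfolding ext_section_def[abs_def] by blast

text \<open>Multiplication operators commute with \<open>P\<^sub>n\<close>, so the commutator of a section is the section of a commutator.\<close>

lemma comm_bound_fin_section:
  fixes A :: "('n::finite, 'a::complex_banach) seq_op"
  assumes A: "A \<in> Lp p" "comm_bound p r \<epsilon> A" and "\<epsilon> \<ge> 0"
  shows "comm_bound p r \<epsilon> (fin_section A n)"
  unfolding comm_bound_def
proof (intro allI impI)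
  fix \<phi> :: "int^'n \<Rightarrow> real" and x :: "int^'n \<Rightarrow> 'a" assume \<phi>: "lip_cutoff r \<phi>" and x: "x \<in> lp_space p"
  let ?d = "\<lambda>i. A (Mult \<phi> (Proj n x)) i - Mult \<phi> (A (Proj n x)) i"
  have eq: "(\<lambda>i. fin_section A n (Mult \<phi> x) i - Mult \<phi> (fin_section A n x) i) = Proj n ?d"
    by (simp add: fin_section_def Mult_Proj Proj_diff)
  have "lp_norm p (Proj n ?d) \<le> lp_norm p ?d"
    by (rule lp_norm_Proj_le) (use A \<phi> in simp)
  moreover have "lp_norm p ?d \<le> \<epsilon> * lp_norm p (Proj n x)" by (rule comm_boundD[OF A(2) \<phi>]) simp
  moreover have "\<epsilon> * lp_norm p (Proj n x) \<le> \<epsilon> * lp_norm p x"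
    using lp_norm_Proj_le[OF x] assms(3) by (rule mult_left_mono)
  ultimately show "lp_norm p (\<lambda>i. fin_section A n (Mult \<phi> x) i - Mult \<phi> (fin_section A n x) i) \<le> \<epsilon> * lp_norm p x"
    unfolding eq by linarith
qed

text \<open>The added part \<open>cQ\<^sub>n\<close> commutes with multiplication operators.\<close>

lemma comm_bound_ext_section:
  assumes A: "A \<in> Lp p" "comm_bound p r \<epsilon> A" and "\<epsilon> \<ge> 0"
  shows "comm_bound p r \<epsilon> (ext_section A c n)"
proof -
  have "(\<lambda>i. ext_section A c n (Mult \<phi> x) i - Mult \<phi> (ext_section A c n x) i) =
      (\<lambda>i. fin_section A n (Mult \<phi> x) i - Mult \<phi> (fin_section A n x) i)" for \<phi> x
    by (simp add: ext_section_def Coproj_eq_Mult Mult_def algebra_simps)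
  then show ?thesis using comm_bound_fin_section[OF assms, of n] by (simp add: comm_bound_def)
qed

lemma comm_bound_Shift:
  fixes T :: "('n::finite, 'a::complex_banach) seq_op"
  assumes "T \<in> Lp p" "comm_bound p r \<epsilon> T"
  shows "comm_bound p r \<epsilon> (Shift_conj h T)"
  unfolding comm_bound_def
proof (intro allI impI)
  fix \<phi> :: "int^'n \<Rightarrow> real" and x :: "int^'n \<Rightarrow> 'a" assume \<phi>: "lip_cutoff r \<phi>" and x: "x \<in> lp_space p"
  let ?\<psi> = "\<lambda>i. \<phi> (i - h)"
  let ?d = "\<lambda>i. T (Mult ?\<psi> (Shift h x)) i - Mult ?\<psi> (T (Shift h x)) i"
  have "(\<lambda>i. (Shift_conj h T) (Mult \<phi> x) i - Mult \<phi> (Shift_conj h T x) i) = Shift (- h) ?d"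
    by (simp add: Shift_def Mult_def)
  moreover have "lp_norm p ?d \<le> \<epsilon> * lp_norm p (Shift h x)"
    by (rule comm_boundD[OF assms(2) lip_cutoff_translate[OF \<phi>]]) (use x in simp)
  ultimately show "lp_norm p (\<lambda>i. (Shift_conj h T) (Mult \<phi> x) i - Mult \<phi> (Shift_conj h T x) i)
      \<le> \<epsilon> * lp_norm p x"
    by simp
qed

text \<open>Off-diagonal decay. A bump that is one on the ball vanishes at distance \<open>r\<close> from it, so the block of \<open>T\<close> between the two regions
  is a block of its commutator with the bump.\<close>

lemma off_diagonal_out:
  assumes T: "T \<in> Lp p" "comm_bound p r \<epsilon> T" and r: "r > 0" and x: "x \<in> lp_space p"
    and supp: "\<And>i. x i \<noteq> 0 \<Longrightarrow> of_int (idx_norm (i - h)) \<le> m"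
    and far: "\<And>i. \<kappa> i \<noteq> 0 \<Longrightarrow> m + r \<le> of_int (idx_norm (i - h))"
    and \<kappa>: "\<And>i. \<bar>\<kappa> i\<bar> \<le> 1"
  shows "lp_norm p (Mult \<kappa> (T x)) \<le> \<epsilon> * lp_norm p x"
proof -
  let ?\<phi> = "bump h m r"
  have "Mult ?\<phi> x = x"
  proof
    show "Mult ?\<phi> x i = x i" for i
      using supp[of i] bump_eq_1[OF r, of i h m] by (cases "x i = 0") (auto simp: Mult_def)
  qed
  moreover have "Mult \<kappa> (Mult ?\<phi> (T x)) = (\<lambda>i. 0)"
  proof
    show "Mult \<kappa> (Mult ?\<phi> (T x)) i = 0" for i
      using far[of i] bump_eq_0[OF r, of m i h] by (cases "\<kappa> i = 0") (auto simp: Mult_def)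
  qed
  ultimately have "Mult \<kappa> (T x) = Mult \<kappa> (\<lambda>i. T (Mult ?\<phi> x) i - Mult ?\<phi> (T x) i)"
    by (simp add: Mult_diff)
  moreover have "lp_norm p \<dots> \<le> lp_norm p (\<lambda>i. T (Mult ?\<phi> x) i - Mult ?\<phi> (T x) i)"
    by (rule lp_norm_Mult_le) (use T x \<kappa> in auto)
  ultimately show ?thesis using comm_boundD[OF T(2) lip_cutoff_bump[OF r] x, of h m] by simp
qed

text \<open>The transposed block, with the bump now equal to one on the target region.\<close>

lemma off_diagonal_in:
  assumes T: "T \<in> Lp p" "comm_bound p r \<epsilon> T" and r: "r > 0" and x: "x \<in> lp_space p"
    and supp: "\<And>i. x i \<noteq> 0 \<Longrightarrow> m + r \<le> of_int (idx_norm (i - h))"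
    and near: "\<And>i. \<kappa> i \<noteq> 0 \<Longrightarrow> of_int (idx_norm (i - h)) \<le> m"
    and \<kappa>: "\<And>i. \<bar>\<kappa> i\<bar> \<le> 1"
  shows "lp_norm p (Mult \<kappa> (T x)) \<le> \<epsilon> * lp_norm p x"
proof -
  let ?\<phi> = "bump h m r"
  have "Mult ?\<phi> x = (\<lambda>i. 0)"
  proof
    show "Mult ?\<phi> x i = 0" for i
      using supp[of i] bump_eq_0[OF r, of m i h] by (cases "x i = 0") (auto simp: Mult_def)
  qed
  then have "T (Mult ?\<phi> x) = (\<lambda>i. 0)" using bounded_ops_zero[OF T(1)] by simp
  moreover have "Mult \<kappa> (T x) = Mult \<kappa> (Mult ?\<phi> (T x))"
  proof
    show "Mult \<kappa> (T x) i = Mult \<kappa> (Mult ?\<phi> (T x)) i" for i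
      using near[of i] bump_eq_1[OF r, of i h m] by (cases "\<kappa> i = 0") (auto simp: Mult_def)
  qed
  ultimately have "Mult \<kappa> (T x) = Mult \<kappa> (\<lambda>i. Mult ?\<phi> (T x) i - T (Mult ?\<phi> x) i)"
    by simp
  moreover have "lp_norm p \<dots> \<le> lp_norm p (\<lambda>i. Mult ?\<phi> (T x) i - T (Mult ?\<phi> x) i)"
    by (rule lp_norm_Mult_le) (use T x \<kappa> in auto)
  ultimately show ?thesis
    using comm_boundD[OF T(2) lip_cutoff_bump[OF r] x, of h m] lp_norm_minus_commute[of "Mult ?\<phi> (T x)" "T (Mult ?\<phi> x)"]
    by simp
qed

section \<open>Convergence against the ideal of P-compact operators\<close>

lemma Proj_in_K_ops [simp]: "(Proj m :: ('n::finite, 'a::complex_banach) seq_op) \<in> K_ops p"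
proof -
  have "Lp_norm p (Coproj n \<circ> (Proj m :: ('n, 'a) seq_op)) + Lp_norm p ((Proj m :: ('n, 'a) seq_op) \<circ> Coproj n) = 0" if "n \<ge> m" for n
  proof -
    have "Coproj n (Proj m x) = (\<lambda>i. 0)" "Proj m (Coproj n x) = (\<lambda>i. 0)" for x :: "int^'n \<Rightarrow> 'a"
      using that by (auto simp: Coproj_def Proj_def fun_eq_iff)
    then have "Lp_norm p (Coproj n \<circ> (Proj m :: ('n, 'a) seq_op)) \<le> 0"
      "Lp_norm p ((Proj m :: ('n, 'a) seq_op) \<circ> Coproj n) \<le> 0"
      by (auto intro!: Lp_norm_le)
    moreover have "0 \<le> Lp_norm p (Coproj n \<circ> (Proj m :: ('n, 'a) seq_op))"
      "0 \<le> Lp_norm p ((Proj m :: ('n, 'a) seq_op) \<circ> Coproj n)"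
      by (simp_all del: comp_apply)
    ultimately show ?thesis by linarith
  qed
  then have "(\<lambda>n. Lp_norm p (Coproj n \<circ> (Proj m :: ('n, 'a) seq_op)) + Lp_norm p ((Proj m :: ('n, 'a) seq_op) \<circ> Coproj n)) \<longlonglongrightarrow> 0"
    by (intro tendsto_eventually eventually_sequentiallyI[of m]) auto
  then show ?thesis by (simp add: K_ops_def)
qed

lemma loc_convD:
  assumes "loc_conv p B S" "\<epsilon> > 0"
  shows "\<exists>k0. \<forall>k\<ge>k0. \<forall>x\<in>lp_space p. lp_norm p (Proj m (\<lambda>i. B k x i - S x i)) \<le> \<epsilon> * lp_norm p x"
    and "\<exists>k0. \<forall>k\<ge>k0. \<forall>x\<in>lp_space p. lp_norm p (\<lambda>i. B k (Proj m x) i - S (Proj m x) i) \<le> \<epsilon> * lp_norm p x"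
  using assms unfolding loc_conv_def eventually_sequentially by meson+

lemma P_strong_lim_imp_loc_conv:
  fixes S :: "('n::finite, 'a::complex_banach) seq_op"
  assumes "P_strong_lim p B S"
  shows "loc_conv p B S"
  unfolding loc_conv_def
proof (intro allI impI)
  fix m :: nat and \<epsilon> :: real assume \<epsilon>: "\<epsilon> > 0"
  have L: "B k \<in> Lp p" "S \<in> Lp p" for k using assms by (auto simp: P_strong_lim_def)
  have "(\<lambda>k. Lp_norm p (Proj m \<circ> (B k - S)) + Lp_norm p ((B k - S) \<circ> Proj m)) \<longlonglongrightarrow> 0"
    using assms Proj_in_K_ops unfolding P_strong_lim_def by blast
  then have "\<forall>\<^sub>F k in sequentially. Lp_norm p (Proj m \<circ> (B k - S)) + Lp_norm p ((B k - S) \<circ> Proj m) < \<epsilon>"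
    using \<epsilon> by (rule order_tendstoD(2))
  then show "\<forall>\<^sub>F k in sequentially. \<forall>x\<in>lp_space p.
     lp_norm p (Proj m (\<lambda>i. B k x i - S x i)) \<le> \<epsilon> * lp_norm p x \<and>
     lp_norm p (\<lambda>i. B k (Proj m x) i - S (Proj m x) i) \<le> \<epsilon> * lp_norm p x"
  proof eventually_elim
    case (elim k)
    have L1: "Proj m \<circ> (B k - S) \<in> Lp p" and L2: "(B k - S) \<circ> Proj m \<in> Lp p" using L by auto
    have le: "Lp_norm p (Proj m \<circ> (B k - S)) \<le> \<epsilon>" "Lp_norm p ((B k - S) \<circ> Proj m) \<le> \<epsilon>"
      using elim Lp_norm_nonneg[OF L1] Lp_norm_nonneg[OF L2] by auto
    show ?case
    proof (intro ballI conjI)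
      fix x :: "int^'n \<Rightarrow> 'a" assume x: "x \<in> lp_space p"
      show "lp_norm p (Proj m (\<lambda>i. B k x i - S x i)) \<le> \<epsilon> * lp_norm p x"
        using order_trans[OF Lp_bound[OF L1 x] mult_right_mono[OF le(1)]] x by (simp add: fun_diff_def)
      show "lp_norm p (\<lambda>i. B k (Proj m x) i - S (Proj m x) i) \<le> \<epsilon> * lp_norm p x"
        using order_trans[OF Lp_bound[OF L2 x] mult_right_mono[OF le(2)]] x by (simp add: fun_diff_def)
    qed
  qed
qed

text \<open>An operator \<open>K\<close> in the ideal is approximated in norm by \<open>KP\<^sub>m\<close> and by \<open>P\<^sub>mK\<close>, and the error \<open>KQ\<^sub>m\<close> or \<open>Q\<^sub>mK\<close> is
  multiplied by a bounded sequence.\<close>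

lemma loc_conv_imp_P_strong_lim:
  fixes B :: "nat \<Rightarrow> ('n::finite, 'a::complex_banach) seq_op"
  assumes conv: "loc_conv p B S" and B: "\<And>k. B k \<in> Lp p" and S: "S \<in> Lp p"
    and bound: "\<And>k x. x \<in> lp_space p \<Longrightarrow> lp_norm p (B k x) \<le> M * lp_norm p x"
  shows "P_strong_lim p B S"
  unfolding P_strong_lim_def
proof (intro conjI allI ballI B S)
  fix K :: "('n, 'a) seq_op" assume K: "K \<in> K_ops p"
  have KL: "K \<in> Lp p" using K by (simp add: K_ops_def)
  define M' where "M' = \<bar>M\<bar> + Lp_norm p S"
  have M': "M' \<ge> 0" using S by (simp add: M'_def)
  have D: "(B k - S) \<in> Lp p" for k using B S by simp
  have DM: "lp_norm p ((B k - S) x) \<le> M' * lp_norm p x" if x: "x \<in> lp_space p" for k x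
  proof -
    have "lp_norm p ((B k - S) x) \<le> lp_norm p (B k x) + lp_norm p (S x)"
      using lp_norm_triangle_diff[of "B k x" "S x"] B S x by (simp add: fun_diff_def)
    also have "\<dots> \<le> M * lp_norm p x + Lp_norm p S * lp_norm p x"
      using bound[OF x, of k] Lp_bound[OF S x] by simp
    also have "\<dots> \<le> M' * lp_norm p x"
      using mult_right_mono[of M "\<bar>M\<bar>" "lp_norm p x"] x by (simp add: M'_def distrib_right)
    finally show ?thesis .
  qed
  show "(\<lambda>k. Lp_norm p (K \<circ> (B k - S)) + Lp_norm p ((B k - S) \<circ> K)) \<longlonglongrightarrow> 0"
  proof (rule tendstoI)
    fix e :: real assume e: "e > 0"
    define N where "N = Lp_norm p K + M' + 1"
    have N: "N > 0" using M' KL by (simp add: N_def add_nonneg_pos)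
    define d where "d = e / (5 * N)"
    have d: "d > 0" using e N by (simp add: d_def)
    have "\<forall>\<^sub>F m in sequentially. Lp_norm p (Coproj m \<circ> K) + Lp_norm p (K \<circ> Coproj m) < d"
      using K d unfolding K_ops_def by (auto intro: order_tendstoD(2))
    then obtain m where m: "Lp_norm p (Coproj m \<circ> K) + Lp_norm p (K \<circ> Coproj m) < d"
      by (meson eventually_sequentially order_refl)
    have Q1: "Coproj m \<circ> K \<in> Lp p" and Q2: "K \<circ> Coproj m \<in> Lp p" using KL by auto
    have m1: "Lp_norm p (Coproj m \<circ> K) \<le> d" and m2: "Lp_norm p (K \<circ> Coproj m) \<le> d"
      using m Lp_norm_nonneg[OF Q1] Lp_norm_nonneg[OF Q2] by auto
    have split: "x = (\<lambda>i. Proj m x i + Coproj m x i)" for x :: "int^'n \<Rightarrow> 'a"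
      by (auto simp: Coproj_def)
    have "\<forall>\<^sub>F k in sequentially. \<forall>x\<in>lp_space p.
        lp_norm p (Proj m (\<lambda>i. B k x i - S x i)) \<le> d * lp_norm p x \<and>
        lp_norm p (\<lambda>i. B k (Proj m x) i - S (Proj m x) i) \<le> d * lp_norm p x"
      using conv d unfolding loc_conv_def by blast
    then show "\<forall>\<^sub>F k in sequentially. dist (Lp_norm p (K \<circ> (B k - S)) + Lp_norm p ((B k - S) \<circ> K)) 0 < e"
    proof eventually_elim
      case (elim k)
      have 1: "Lp_norm p (K \<circ> (B k - S)) \<le> 2 * d * N"
      proof (rule Lp_norm_le)
        fix x :: "int^'n \<Rightarrow> 'a" assume x: "x \<in> lp_space p"
        let ?y = "(B k - S) x"
        have y: "?y \<in> lp_space p" by (rule Lp_lp[OF D x])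
        have "K ?y = (\<lambda>i. K (Proj m ?y) i + K (Coproj m ?y) i)"
          using Lp_add[OF KL, of "Proj m ?y" "Coproj m ?y"] split[of ?y] y by simp
        then have "lp_norm p (K ?y) \<le> lp_norm p (K (Proj m ?y)) + lp_norm p (K (Coproj m ?y))"
          using lp_norm_triangle[of "K (Proj m ?y)" "K (Coproj m ?y)"] KL y by simp
        also have "lp_norm p (K (Proj m ?y)) \<le> Lp_norm p K * (d * lp_norm p x)"
        proof -
          have "lp_norm p (Proj m ?y) \<le> d * lp_norm p x" using elim x by (simp add: fun_diff_def)
          then show ?thesis using Lp_bound[OF KL, of "Proj m ?y"] mult_left_mono[OF _ Lp_norm_nonneg[OF KL]]
            by (meson lp_Proj order_trans)
        qed
        also have "lp_norm p (K (Coproj m ?y)) \<le> d * (M' * lp_norm p x)"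
          using order_trans[OF Lp_bound[OF Q2 y] mult_mono[OF m2 DM[OF x, of k]]] d y by simp
        finally have "lp_norm p (K ?y) \<le> d * (Lp_norm p K + M') * lp_norm p x" by (simp add: algebra_simps)
        also have "\<dots> \<le> 2 * d * N * lp_norm p x"
          using d N M' KL x unfolding N_def by (intro mult_right_mono) (auto simp: algebra_simps)
        finally show "lp_norm p ((K \<circ> (B k - S)) x) \<le> 2 * d * N * lp_norm p x" by simp
      qed (use d N in simp)
      have 2: "Lp_norm p ((B k - S) \<circ> K) \<le> 2 * d * N"
      proof (rule Lp_norm_le)
        fix x :: "int^'n \<Rightarrow> 'a" assume x: "x \<in> lp_space p"
        let ?y = "K x"
        have y: "?y \<in> lp_space p" using KL x by simp
        have "(B k - S) ?y = (\<lambda>i. (B k - S) (Proj m ?y) i + (B k - S) (Coproj m ?y) i)"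
          using Lp_add[OF D, of "Proj m ?y" "Coproj m ?y" k] split[of ?y] y by simp
        then have "lp_norm p ((B k - S) ?y) \<le> lp_norm p ((B k - S) (Proj m ?y)) + lp_norm p ((B k - S) (Coproj m ?y))"
          using lp_norm_triangle[OF Lp_lp[OF D lp_Proj] Lp_lp[OF D Lp_lp[OF Lp_Coproj y]], of k m ?y k m]
          by simp
        also have "lp_norm p ((B k - S) (Proj m ?y)) \<le> d * (Lp_norm p K * lp_norm p x)"
        proof -
          have "lp_norm p ((B k - S) (Proj m ?y)) \<le> d * lp_norm p ?y" using elim y by (simp add: fun_diff_def)
          also have "\<dots> \<le> d * (Lp_norm p K * lp_norm p x)" using d by (intro mult_left_mono Lp_bound KL x) auto
          finally show ?thesis .
        qed
        also have "lp_norm p ((B k - S) (Coproj m ?y)) \<le> M' * (d * lp_norm p x)"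
        proof -
          have "lp_norm p (Coproj m ?y) \<le> d * lp_norm p x"
            using order_trans[OF Lp_bound[OF Q1 x] mult_right_mono[OF m1]] x by simp
          then show ?thesis using DM[OF Lp_lp[OF Lp_Coproj y], of k m] mult_left_mono[OF _ M'] by (meson order_trans)
        qed
        finally have "lp_norm p ((B k - S) ?y) \<le> d * (Lp_norm p K + M') * lp_norm p x" by (simp add: algebra_simps)
        also have "\<dots> \<le> 2 * d * N * lp_norm p x"
          using d N M' KL x unfolding N_def by (intro mult_right_mono) (auto simp: algebra_simps)
        finally show "lp_norm p (((B k - S) \<circ> K) x) \<le> 2 * d * N * lp_norm p x" by simp
      qed (use d N in simp)
      have "4 * d * N < e" using e N by (simp add: d_def field_simps)
      moreover have "0 \<le> Lp_norm p (K \<circ> (B k - S))" "0 \<le> Lp_norm p ((B k - S) \<circ> K)"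
        using KL D by (auto intro!: Lp_norm_nonneg)
      ultimately show ?case using 1 2 by simp
    qed
  qed
qed

text \<open>Each truncation of the commutator converges in norm, and the norm is determined by truncations.\<close>

lemma comm_bound_limit:
  fixes B :: "nat \<Rightarrow> ('n::finite, 'a::complex_banach) seq_op"
  assumes conv: "loc_conv p B S" and B: "\<And>k. B k \<in> Lp p" and S: "S \<in> Lp p"
    and comm: "\<And>k. comm_bound p r \<epsilon> (B k)"
  shows "comm_bound p r \<epsilon> S"
  unfolding comm_bound_def
proof (intro allI impI)
  fix \<phi> :: "int^'n \<Rightarrow> real" and x :: "int^'n \<Rightarrow> 'a" assume \<phi>: "lip_cutoff r \<phi>" and x: "x \<in> lp_space p"
  let ?c = "\<lambda>T i. T (Mult \<phi> x) i - Mult \<phi> (T x) i"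
  have cl: "?c T \<in> lp_space p" if "T \<in> Lp p" for T using that \<phi> x by simp
  show "lp_norm p (?c S) \<le> \<epsilon> * lp_norm p x"
  proof (rule lp_norm_le_if_Proj_le(2)[OF _ cl[OF S]])
    fix m
    show "lp_norm p (Proj m (?c S)) \<le> \<epsilon> * lp_norm p x"
    proof (rule field_le_epsilon)
      fix e :: real assume e: "e > 0"
      define d where "d = e / (2 * (lp_norm p x + 1))"
      have d: "d > 0" "2 * d * lp_norm p x \<le> e"
      proof -
        have n: "lp_norm p x + 1 > 0" using lp_norm_nonneg[OF x] by linarith
        then show "d > 0" using e by (simp add: d_def)
        then have "2 * d * lp_norm p x \<le> 2 * d * (lp_norm p x + 1)" by simp
        also have "\<dots> = e" using n by (simp add: d_def field_simps)
        finally show "2 * d * lp_norm p x \<le> e" .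
      qed
      obtain k where k: "\<And>x. x \<in> lp_space p \<Longrightarrow> lp_norm p (Proj m (\<lambda>i. B k x i - S x i)) \<le> d * lp_norm p x"
        using loc_convD(1)[OF conv d(1), of m] by (meson order_refl)
      let ?u = "Proj m (\<lambda>i. S (Mult \<phi> x) i - B k (Mult \<phi> x) i)"
      let ?v = "Mult \<phi> (Proj m (\<lambda>i. B k x i - S x i))"
      have "Proj m (?c S) = (\<lambda>i. Proj m (?c (B k)) i + (?u i + ?v i))"
        by (auto simp: Proj_def Mult_def algebra_simps)
      moreover have u: "lp_norm p ?u \<le> d * lp_norm p x"
      proof -
        have "lp_norm p ?u = lp_norm p (Proj m (\<lambda>i. B k (Mult \<phi> x) i - S (Mult \<phi> x) i))"
          unfolding Proj_diff by (rule lp_norm_minus_commute)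
        also have "\<dots> \<le> d * lp_norm p (Mult \<phi> x)" by (rule k) (use x \<phi> in simp)
        also have "\<dots> \<le> d * lp_norm p x"
          using d(1) by (intro mult_left_mono lp_norm_Mult_le x lip_cutoff_abs_le[OF \<phi>]) auto
        finally show ?thesis .
      qed
      moreover have v: "lp_norm p ?v \<le> d * lp_norm p x"
        using lp_norm_Mult_le[of "Proj m (\<lambda>i. B k x i - S x i)" \<phi>, OF _ lip_cutoff_abs_le[OF \<phi>]] k[OF x] by simp
      moreover have "?u \<in> lp_space p" "?v \<in> lp_space p" using \<phi> by auto
      moreover have "lp_norm p (Proj m (?c (B k))) \<le> \<epsilon> * lp_norm p x"
        using lp_norm_Proj_le[OF cl[OF B], of m k] comm_boundD[OF comm \<phi> x, of k] by linarith
      ultimately show "lp_norm p (Proj m (?c S)) \<le> \<epsilon> * lp_norm p x + e"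
        using lp_norm_triangle[of "Proj m (?c (B k))" "\<lambda>i. ?u i + ?v i"]
          lp_norm_triangle[of ?u ?v] d(2) by simp
    qed
  qed
qed

section \<open>Invertibility of limits\<close>

lemma op_invertible_lower_bound:
  assumes "op_invertible p E T" "scaling_closed p E" "x \<in> E"
  shows "lp_norm p x \<le> op_norm p E (inv_into E T) * lp_norm p (T x)"
proof -
  have inv: "bij_betw T E E" "inv_into E T \<in> bounded_ops p E" using assms(1) by (auto simp: op_invertible_def)
  then have "T x \<in> E" "inv_into E T (T x) = x"
    using assms(3) by (auto simp: bij_betw_def)
  then show ?thesis using op_norm_bound[OF inv(2) assms(2), of "T x"] by simp
qed

lemma op_invertible_if_lower_bound:
  fixes S :: "('n::finite, 'a::complex_banach) seq_op"
  assumes S: "S \<in> Lp p" and \<nu>: "\<nu> > 0"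
    and lower: "\<And>x. x \<in> lp_space p \<Longrightarrow> \<nu> * lp_norm p x \<le> lp_norm p (S x)"
    and surj: "\<And>y. y \<in> lp_space p \<Longrightarrow> \<exists>x\<in>lp_space p. S x = y"
  shows "op_invertible p (lp_space p) S" and "Lp_norm p (inv_into (lp_space p) S) \<le> 1 / \<nu>"
proof -
  let ?E = "lp_space p :: (int^'n \<Rightarrow> 'a) set"
  let ?J = "inv_into ?E S"
  have inj: "inj_on S ?E"
  proof (rule inj_onI)
    fix x y assume xy: "x \<in> ?E" "y \<in> ?E" "S x = S y"
    have "\<nu> * lp_norm p (\<lambda>i. x i - y i) \<le> 0"
      using lower[OF lp_diff[OF xy(1,2)]] Lp_diff[OF S xy(1,2)] xy(3) by simp
    then have "lp_norm p (\<lambda>i. x i - y i) \<le> 0" using \<nu> by (simp add: mult_le_0_iff)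
    then have "(\<lambda>i. x i - y i) = (\<lambda>i. 0)" by (rule lp_eq_zero[OF lp_diff[OF xy(1,2)]])
    then show "x = y" by (simp add: fun_eq_iff)
  qed
  have im: "S ` ?E = ?E" using surj S by (auto simp: image_iff; metis)
  have J: "?J y \<in> ?E" "S (?J y) = y" if "y \<in> ?E" for y
    using that im inv_into_into[of y S ?E] f_inv_into_f[of y S ?E] by auto
  have J_eq: "?J y = x" if "x \<in> ?E" "S x = y" for x y
    using that inj by (metis inv_into_f_f)
  have bound: "lp_norm p (?J y) \<le> 1 / \<nu> * lp_norm p y" if "y \<in> ?E" for y
    using lower[OF J(1)[OF that]] J(2)[OF that] \<nu> by (simp add: field_simps)
  have "?J \<in> Lp p"
  proof (rule Lp_I)
    fix x y :: "int^'n \<Rightarrow> 'a" and z assume x: "x \<in> ?E"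
    show "?J x \<in> ?E" by (rule J(1)[OF x])
    show "lp_norm p (?J x) \<le> 1 / \<nu> * lp_norm p x" by (rule bound[OF x])
    show "?J (\<lambda>i. z *\<^sub>C x i) = (\<lambda>i. z *\<^sub>C ?J x i)"
      by (rule J_eq) (use J[OF x] bounded_ops_scaleC[OF S, of "?J x" z] in auto)
    assume y: "y \<in> ?E"
    show "?J (\<lambda>i. x i + y i) = (\<lambda>i. ?J x i + ?J y i)"
      by (rule J_eq) (use J[OF x] J[OF y] Lp_add[OF S, of "?J x" "?J y"] in auto)
  qed
  then show "op_invertible p ?E S"
    using S inj im by (auto simp: op_invertible_def bij_betw_def)
  show "Lp_norm p ?J \<le> 1 / \<nu>"
    by (rule Lp_norm_le) (use bound \<nu> in auto)
qed

lemma bump_Proj: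
  fixes x :: "int^'n::finite \<Rightarrow> 'a::complex_banach"
  assumes "r > 0" "t + r \<le> real m"
  shows "Mult (bump 0 t r) (Proj m x) = Mult (bump 0 t r) x"
proof
  fix i :: "int^'n"
  have "bump 0 t r i = 0" if "\<not> idx_norm i \<le> int m"
  proof (rule bump_eq_0[OF assms(1)])
    have "int m < idx_norm i" using that by simp
    then have "real m < of_int (idx_norm i)" by (metis of_int_less_iff of_int_of_nat_eq)
    then show "t + r \<le> real_of_int (idx_norm (i - 0))" using assms(2) by simp
  qed
  then show "Mult (bump 0 t r) (Proj m x) i = Mult (bump 0 t r) x i"
    by (auto simp: Mult_def Proj_def)
qed

lemma norm_le_bump:
  assumes "r > 0" "x \<in> lp_space p" "of_int (idx_norm (i - h)) \<le> t"
  shows "norm (x i) \<le> lp_norm p (Mult (bump h t r) x)"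
  using norm_le_lp_norm[OF lp_Mult[OF assms(2)], of "bump h t r" i] bump_eq_1[OF assms(1,3)]
  by (simp add: Mult_def)

lemma Proj_le_bump:
  fixes x :: "int^'n::finite \<Rightarrow> 'a::complex_banach"
  assumes "r > 0" "x \<in> lp_space p"
  shows "lp_norm p (Proj m x) \<le> lp_norm p (Mult (bump 0 (real m) r) x)"
proof -
  have "Proj m x = Proj m (Mult (bump 0 (real m) r) x)"
  proof
    fix i :: "int^'n"
    have "bump 0 (real m) r i = 1" if "idx_norm i \<le> int m"
      using that by (intro bump_eq_1[OF assms(1)]) (metis diff_zero of_int_le_iff of_int_of_nat_eq)
    then show "Proj m x i = Proj m (Mult (bump 0 (real m) r) x) i" by (auto simp: Proj_def Mult_def)
  qed
  then show ?thesis using lp_norm_Proj_le[OF lp_Mult[OF assms(2)], of "bump 0 (real m) r" m] by simp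
qed

lemma Proj_pointwise_tendsto:
  fixes x :: "nat \<Rightarrow> int^'n::finite \<Rightarrow> 'a::complex_banach"
  assumes "\<And>i. (\<lambda>k. x k i) \<longlonglongrightarrow> y i"
  shows "(\<lambda>k. lp_norm p (Proj m (\<lambda>i. y i - x k i))) \<longlonglongrightarrow> 0"
proof (rule tendsto_sandwich[OF _ _ tendsto_const])
  show "\<forall>\<^sub>F k in sequentially. 0 \<le> lp_norm p (Proj m (\<lambda>i. y i - x k i))" by simp
  show "\<forall>\<^sub>F k in sequentially. lp_norm p (Proj m (\<lambda>i. y i - x k i)) \<le> (\<Sum>i\<in>{i. idx_norm i \<le> int m}. norm (y i - x k i))"
  proof (rule always_eventually, rule allI)
    fix k
    have "lp_norm p (Proj m (\<lambda>i. y i - x k i)) \<le> (\<Sum>i\<in>{i. idx_norm i \<le> int m}. norm (Proj m (\<lambda>i. y i - x k i) i))"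
      by (rule lp_finite_support(2)) (auto simp: Proj_def)
    then show "lp_norm p (Proj m (\<lambda>i. y i - x k i)) \<le> (\<Sum>i\<in>{i. idx_norm i \<le> int m}. norm (y i - x k i))"
      by (simp add: Proj_def)
  qed
  have "(\<lambda>k. norm (y i - x k i)) \<longlonglongrightarrow> 0" for i
    using tendsto_norm[OF tendsto_diff[OF tendsto_const[of "y i"] assms[of i]]] by simp
  then show "(\<lambda>k. \<Sum>i\<in>{i. idx_norm i \<le> int m}. norm (y i - x k i)) \<longlonglongrightarrow> 0"
    using tendsto_sum[of "{i::int^'n. idx_norm i \<le> int m}" "\<lambda>i k. norm (y i - x k i)" "\<lambda>_. 0" sequentially] by simp
qed

text \<open>On a finitely supported vector the operators converge in norm. The truncations of a general vector need not converge to it,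
  so it is reduced to this case by wide bumps, which almost commute with \<open>S\<close> and exhaust the norm of the vector.\<close>

lemma lower_bound_limit:
  fixes B :: "nat \<Rightarrow> ('n::finite, 'a::complex_banach) seq_op"
  assumes conv: "loc_conv p B S" and B: "\<And>k. B k \<in> Lp p" and S: "S \<in> Lp p"
    and comm: "almost_local p S" and \<nu>: "\<nu> > 0"
    and lower: "\<And>k x. x \<in> lp_space p \<Longrightarrow> \<nu> * lp_norm p x \<le> lp_norm p (B k x)"
    and x: "x \<in> lp_space p"
  shows "\<nu> * lp_norm p x \<le> lp_norm p (S x)"
proof -
  have fin: "\<nu> * lp_norm p (Proj m x) \<le> lp_norm p (S (Proj m x))" for m and x :: "int^'n \<Rightarrow> 'a"
  proof (rule field_le_epsilon)
    fix e :: real assume e: "e > 0"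
    let ?y = "Proj m x"
    define d where "d = e / (lp_norm p ?y + 1)"
    have n: "lp_norm p ?y + 1 > 0" by (simp add: add_nonneg_pos)
    then have d: "d > 0" using e by (simp add: d_def)
    obtain k where "\<forall>z\<in>lp_space p. lp_norm p (\<lambda>i. B k (Proj m z) i - S (Proj m z) i) \<le> d * lp_norm p z"
      using loc_convD(2)[OF conv d, of m] by blast
    from this[rule_format, of ?y]
    have "lp_norm p (\<lambda>i. B k ?y i - S ?y i) \<le> d * lp_norm p ?y" by (simp add: Proj_Proj)
    also have "\<dots> \<le> d * (lp_norm p ?y + 1)" using d by simp
    also have "\<dots> = e" using n by (simp add: d_def)
    finally show "\<nu> * lp_norm p ?y \<le> lp_norm p (S ?y) + e"
      using lower[of ?y k] lp_norm_le_diff[of "B k ?y" "S ?y"] B S by simp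
  qed
  have "\<nu> * lp_norm p x \<le> lp_norm p (S x) + \<epsilon> * lp_norm p x" if \<epsilon>: "\<epsilon> > 0" for \<epsilon>
  proof -
    obtain r where r: "r > 0" "comm_bound p r \<epsilon> S" using comm \<epsilon> by blast
    have "lp_norm p (Proj n x) \<le> (lp_norm p (S x) + \<epsilon> * lp_norm p x) / \<nu>" for n
    proof -
      let ?\<phi> = "bump (0::int^'n) (real n) r"
      obtain m where m: "real n + r \<le> real m" using nat_ge_real by blast
      let ?y = "Mult ?\<phi> x"
      have y: "Proj m ?y = ?y" using bump_Proj[OF r(1) m, of x] by (simp add: Mult_Proj)
      have "\<nu> * lp_norm p (Proj n x) \<le> \<nu> * lp_norm p ?y"
        using Proj_le_bump[OF r(1) x, of n] \<nu> by simp
      also have "\<dots> \<le> lp_norm p (S ?y)" using fin[of m ?y] y by simp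
      also have "\<dots> \<le> lp_norm p (Mult ?\<phi> (S x)) + \<epsilon> * lp_norm p x"
        by (rule comm_bound_upper(1)[OF S r(2) lip_cutoff_bump[OF r(1)] x])
      also have "\<dots> \<le> lp_norm p (S x) + \<epsilon> * lp_norm p x"
        using lp_norm_Mult_le[of "S x" ?\<phi>] S x by simp
      finally show ?thesis using \<nu> by (simp add: field_simps)
    qed
    then have "lp_norm p x \<le> (lp_norm p (S x) + \<epsilon> * lp_norm p x) / \<nu>"
      by (rule lp_norm_le_if_Proj_le(2)[OF _ x])
    then show ?thesis using \<nu> by (simp add: field_simps)
  qed
  note * = this
  show ?thesis
  proof (rule field_le_epsilon)
    fix e :: real assume e: "e > 0"
    have n: "lp_norm p x + 1 > 0" using x by (simp add: add_nonneg_pos)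
    have "e / (lp_norm p x + 1) * lp_norm p x \<le> e / (lp_norm p x + 1) * (lp_norm p x + 1)"
      using e n by (intro mult_left_mono) auto
    also have "\<dots> = e" using n by simp
    finally show "\<nu> * lp_norm p x \<le> lp_norm p (S x) + e"
      using *[of "e / (lp_norm p x + 1)"] e n by simp
  qed
qed

text \<open>The solutions \<open>x\<^sub>k\<close> of \<open>B\<^sub>k x\<^sub>k = y\<close> are bounded, and they converge entrywise: on a ball, \<open>B\<^sub>k\<close> and \<open>B\<^sub>l\<close> almost agree, so
  \<open>B\<^sub>k (x\<^sub>k - x\<^sub>l)\<close> is small there, and the lower bound transfers this to \<open>x\<^sub>k - x\<^sub>l\<close> after a cutoff. The
  limit then solves \<open>S w = y\<close>.\<close>

lemma surj_limit:
  fixes B :: "nat \<Rightarrow> ('n::finite, 'a::complex_banach) seq_op"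
  assumes conv: "loc_conv p B S" and B: "\<And>k. B k \<in> Lp p" and S: "S \<in> Lp p"
    and comm: "\<And>\<epsilon>. \<epsilon> > 0 \<Longrightarrow> \<exists>r>0. \<forall>k. comm_bound p r \<epsilon> (B k)" and \<nu>: "\<nu> > 0"
    and lower: "\<And>k x. x \<in> lp_space p \<Longrightarrow> \<nu> * lp_norm p x \<le> lp_norm p (B k x)"
    and surj: "\<And>k y. y \<in> lp_space p \<Longrightarrow> \<exists>x\<in>lp_space p. B k x = y"
    and y: "y \<in> lp_space p"
  shows "\<exists>x\<in>lp_space p. S x = y"
proof -
  obtain x where x: "\<And>k. x k \<in> lp_space p" and Bx: "\<And>k. B k (x k) = y"
    using surj[OF y] by metis
  define M where "M = lp_norm p y / \<nu>"
  have M0: "M \<ge> 0" using y \<nu> by (simp add: M_def)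
  have M: "lp_norm p (x k) \<le> M" for k
    using lower[OF x, of k k] Bx \<nu> by (simp add: M_def field_simps)
  have loc: "\<exists>k0. \<forall>k\<ge>k0. \<forall>l. lp_norm p (Proj m (\<lambda>i. B k (x l) i - S (x l) i)) \<le> \<epsilon> * M" if "\<epsilon> > 0" for m \<epsilon>
  proof -
    obtain k0 where k0: "\<forall>k\<ge>k0. \<forall>z\<in>lp_space p. lp_norm p (Proj m (\<lambda>i. B k z i - S z i)) \<le> \<epsilon> * lp_norm p z"
      using loc_convD(1)[OF conv \<open>\<epsilon> > 0\<close>, of m] by blast
    have "lp_norm p (Proj m (\<lambda>i. B k (x l) i - S (x l) i)) \<le> \<epsilon> * M" if "k \<ge> k0" for k l
    proof -
      have "lp_norm p (Proj m (\<lambda>i. B k (x l) i - S (x l) i)) \<le> \<epsilon> * lp_norm p (x l)"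
        using k0 that x by blast
      also have "\<dots> \<le> \<epsilon> * M" using M \<open>\<epsilon> > 0\<close> by (intro mult_left_mono) auto
      finally show ?thesis .
    qed
    then show ?thesis by blast
  qed
  \<comment> \<open>Entrywise convergence; the four contributions of at most \<open>\<epsilon> M\<close> explain the factor 4 in \<open>\<epsilon>\<close>.\<close>
  have "convergent (\<lambda>k. x k i)" for i
    unfolding Cauchy_convergent_iff[symmetric]
  proof (rule metric_CauchyI)
    fix e :: real assume e: "e > 0"
    define \<epsilon> where "\<epsilon> = \<nu> * e / (4 * (M + 1))"
    have \<epsilon>: "\<epsilon> > 0" using \<nu> e M0 by (simp add: \<epsilon>_def)
    have "4 * \<epsilon> * M < 4 * \<epsilon> * (M + 1)" using \<epsilon> by simp
    also have "\<dots> = \<nu> * e" using M0 by (simp add: \<epsilon>_def field_simps)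
    finally have small: "4 * \<epsilon> * M < \<nu> * e" .
    obtain r where r: "r > 0" "\<And>k. comm_bound p r \<epsilon> (B k)" using comm[OF \<epsilon>] by blast
    let ?t = "of_int (idx_norm i) :: real"
    let ?\<phi> = "bump (0::int^'n) ?t r"
    obtain m where m: "?t + r \<le> real m" using nat_ge_real by blast
    obtain k0 where k0: "\<And>k l. k \<ge> k0 \<Longrightarrow> lp_norm p (Proj m (\<lambda>i. B k (x l) i - S (x l) i)) \<le> \<epsilon> * M"
      using loc[OF \<epsilon>, of m] by blast
    have "dist (x k i) (x l i) < e" if kl: "k \<ge> k0" "l \<ge> k0" for k l
    proof -
      let ?z = "\<lambda>i. x k i - x l i"
      have z: "?z \<in> lp_space p" "lp_norm p ?z \<le> 2 * M"
        using lp_norm_triangle_diff[OF x x, of k l] M[of k] M[of l] x by auto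
      have Bz: "B k ?z = (\<lambda>i. B l (x l) i - B k (x l) i)"
        using Lp_diff[OF B x x, of k k l] Bx by simp
      have u: "(\<lambda>i. B l (x l) i - S (x l) i) \<in> lp_space p" "(\<lambda>i. B k (x l) i - S (x l) i) \<in> lp_space p"
        using B S x by simp_all
      have "lp_norm p (Mult ?\<phi> (B k ?z)) = lp_norm p (Mult ?\<phi> (Proj m (B k ?z)))"
        by (simp only: bump_Proj[OF r(1) m])
      also have "\<dots> \<le> lp_norm p (Proj m (B k ?z))" by (rule lp_norm_Mult_le) auto
      also have "Proj m (B k ?z) = (\<lambda>i. Proj m (\<lambda>i. B l (x l) i - S (x l) i) i - Proj m (\<lambda>i. B k (x l) i - S (x l) i) i)"
        unfolding Bz by (auto simp: Proj_def)
      also have "lp_norm p \<dots> \<le> \<epsilon> * M + \<epsilon> * M"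
        using lp_norm_triangle_diff[OF lp_Proj lp_Proj,
            of m "\<lambda>i. B l (x l) i - S (x l) i" m "\<lambda>i. B k (x l) i - S (x l) i"]
          k0[OF kl(1), of l] k0[OF kl(2), of l] by linarith
      finally have 1: "lp_norm p (Mult ?\<phi> (B k ?z)) \<le> \<epsilon> * M + \<epsilon> * M" .
      have "\<nu> * norm (?z i) \<le> \<nu> * lp_norm p (Mult ?\<phi> ?z)"
        using norm_le_bump[OF r(1) z(1), of i 0 ?t] \<nu> by simp
      also have "\<dots> \<le> lp_norm p (B k (Mult ?\<phi> ?z))" by (rule lower) (use z in simp)
      also have "\<dots> \<le> lp_norm p (Mult ?\<phi> (B k ?z)) + \<epsilon> * lp_norm p ?z"
        by (rule comm_bound_upper(1)[OF B r(2) lip_cutoff_bump[OF r(1)] z(1)])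
      also have "\<dots> \<le> (\<epsilon> * M + \<epsilon> * M) + \<epsilon> * (2 * M)"
        by (intro add_mono 1 mult_left_mono z(2)) (use \<epsilon> in simp)
      also have "\<dots> < \<nu> * e" using small by (simp add: algebra_simps)
      finally show ?thesis using \<nu> by (simp add: dist_norm)
    qed
    then show "\<exists>k0. \<forall>k\<ge>k0. \<forall>l\<ge>k0. dist (x k i) (x l i) < e" by blast
  qed
  then have "\<forall>i. \<exists>v. (\<lambda>k. x k i) \<longlonglongrightarrow> v" by (simp add: convergent_def)
  then obtain w where w: "\<And>i. (\<lambda>k. x k i) \<longlonglongrightarrow> w i" by metis
  note tends = Proj_pointwise_tendsto[OF w]
  have PM: "lp_norm p (Proj n w) \<le> M" for n
  proof (rule LIMSEQ_le_const)
    show "(\<lambda>k. M + lp_norm p (Proj n (\<lambda>i. w i - x k i))) \<longlonglongrightarrow> M"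
      using tendsto_add[OF tendsto_const tends[of n]] by simp
    have "lp_norm p (Proj n w) \<le> M + lp_norm p (Proj n (\<lambda>i. w i - x k i))" for k
      using lp_norm_le_diff[OF lp_Proj lp_Proj, of n w n "x k"]
        lp_norm_Proj_le[OF x, of n k] M[of k] by (simp add: Proj_diff)
    then show "\<exists>N. \<forall>k\<ge>N. lp_norm p (Proj n w) \<le> M + lp_norm p (Proj n (\<lambda>i. w i - x k i))" by blast
  qed
  have wl: "w \<in> lp_space p"
  proof (cases "p = 0")
    case False
    show ?thesis by (rule lp_norm_le_if_Proj_le(1)[OF PM False])
  next
    \<comment> \<open>A bump at a site far from the large entries of \<open>y\<close> shows that all \<open>x\<^sub>k\<close>, and hence \<open>w\<close>, are small there.\<close>
    case p0: True
    show ?thesis unfolding p0 lp_space_0_iff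
    proof (intro allI impI)
      fix e :: real assume e: "e > 0"
      define \<epsilon> where "\<epsilon> = \<nu> * e / (4 * (M + 1))"
      have \<epsilon>: "\<epsilon> > 0" using \<nu> e M0 by (simp add: \<epsilon>_def)
      have "4 * \<epsilon> * M < 4 * \<epsilon> * (M + 1)" using \<epsilon> by simp
      also have "\<dots> = \<nu> * e" using M0 by (simp add: \<epsilon>_def field_simps)
      finally have small: "\<epsilon> * M < \<nu> * e / 4" by (simp add: algebra_simps)
      obtain r where r: "r > 0" "\<And>k. comm_bound p r \<epsilon> (B k)" using comm[OF \<epsilon>] by blast
      define F where "F = {j. \<nu> * e / 4 \<le> norm (y j)}"
      have "\<nu> * e / 4 > 0" using e \<nu> by simp
      then have F: "finite F" using y unfolding p0 lp_space_0_iff F_def by blast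
      have "{i. e \<le> norm (w i)} \<subseteq> (\<Union>j\<in>F. {i. idx_norm (i - j) \<le> \<lfloor>r\<rfloor>})"
      proof (rule subsetI, rule ccontr)
        fix i assume i: "i \<in> {i. e \<le> norm (w i)}" and n: "i \<notin> (\<Union>j\<in>F. {i. idx_norm (i - j) \<le> \<lfloor>r\<rfloor>})"
        let ?\<phi> = "bump i 0 r"
        have small_y: "norm (Mult ?\<phi> y j) \<le> \<nu> * e / 4" for j
        proof (cases "j \<in> F")
          case True
          then have "\<not> idx_norm (i - j) \<le> \<lfloor>r\<rfloor>" using n by auto
          then have "r \<le> of_int (idx_norm (j - i))" by (simp add: idx_norm_minus_commute[of j i] le_floor_iff)
          then have "?\<phi> j = 0" by (intro bump_eq_0[OF r(1)]) simp
          then show ?thesis using \<nu> e by (simp add: Mult_def)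
        next
          case False
          have "norm (Mult ?\<phi> y j) \<le> norm (y j)" by (simp add: Mult_def mult_left_le_one_le)
          then show ?thesis using False by (simp add: F_def)
        qed
        have my: "Mult ?\<phi> y \<in> lp_space p" using y by simp
        have "lp_norm p (Mult ?\<phi> y) \<le> \<nu> * e / 4"
        proof -
          have "bounded (range (Mult ?\<phi> y))" using lp_bounded[OF _ my] p0 by blast
          then have "sup_norm (Mult ?\<phi> y) \<le> \<nu> * e / 4" using small_y sup_norm_le_iff by blast
          moreover have "lp_norm p (Mult ?\<phi> y) = sup_norm (Mult ?\<phi> y)"
            using lp_norm_sup p0 by blast
          ultimately show ?thesis by simp
        qed
        have "norm (x k i) \<le> e / 2" for k
        proof -
          have "\<nu> * norm (x k i) \<le> \<nu> * lp_norm p (Mult ?\<phi> (x k))"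
            using norm_le_bump[OF r(1) x, of i i 0 k] \<nu> by simp
          also have "\<dots> \<le> lp_norm p (B k (Mult ?\<phi> (x k)))" by (rule lower) (use x in simp)
          also have "\<dots> \<le> lp_norm p (Mult ?\<phi> (B k (x k))) + \<epsilon> * lp_norm p (x k)"
            by (rule comm_bound_upper(1)[OF B r(2) lip_cutoff_bump[OF r(1)] x])
          also have "\<dots> \<le> \<nu> * e / 4 + \<epsilon> * M"
            unfolding Bx by (intro add_mono mult_left_mono M) (use \<epsilon> \<open>lp_norm p (Mult ?\<phi> y) \<le> \<nu> * e / 4\<close> in auto)
          also have "\<dots> \<le> \<nu> * (e / 2)" using small by simp
          finally show ?thesis using \<nu> by simp
        qed
        then have "norm (w i) \<le> e / 2"
          by (intro LIMSEQ_le_const2[OF tendsto_norm[OF w[of i]]]) auto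
        then show False using i e by simp
      qed
      then show "finite {i. e \<le> norm (w i)}" by (rule finite_subset) (use F in simp)
    qed
  qed
  have wM: "lp_norm p w \<le> M" by (rule lp_norm_le_if_Proj_le(2)[OF PM wl])
  have "norm (S w i - y i) \<le> 0" for i
  proof (rule field_le_epsilon)
    fix e :: real assume e: "e > 0"
    define \<epsilon> where "\<epsilon> = e / (3 * (M + 1))"
    have \<epsilon>: "\<epsilon> > 0" using e M0 by (simp add: \<epsilon>_def)
    have "3 * \<epsilon> * M < 3 * \<epsilon> * (M + 1)" using \<epsilon> by simp
    also have "\<dots> = e" using M0 by (simp add: \<epsilon>_def field_simps)
    finally have small: "3 * \<epsilon> * M < e" .
    obtain r where r: "r > 0" "\<And>k. comm_bound p r \<epsilon> (B k)" using comm[OF \<epsilon>] by blast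
    have cS: "comm_bound p r \<epsilon> S" by (rule comm_bound_limit[OF conv B S r(2)])
    let ?t = "of_int (idx_norm i) :: real"
    let ?\<phi> = "bump (0::int^'n) ?t r"
    obtain m where m: "m \<ge> nat (idx_norm i)" "?t + r \<le> real m" using nat_ge_real by blast
    obtain k0 where k0: "\<And>k l. k \<ge> k0 \<Longrightarrow> lp_norm p (Proj m (\<lambda>i. B k (x l) i - S (x l) i)) \<le> \<epsilon> * M"
      using loc[OF \<epsilon>, of m] by blast
    let ?b = "\<lambda>k. Lp_norm p S * lp_norm p (Proj m (\<lambda>i. w i - x k i)) + 3 * \<epsilon> * M"
    have "norm (S w i - y i) \<le> ?b k" if k: "k \<ge> k0" for k
    proof -
      let ?u = "\<lambda>i. w i - x k i"
      have u: "?u \<in> lp_space p" "lp_norm p ?u \<le> 2 * M"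
        using lp_norm_triangle_diff[OF wl x, of k] M[of k] wM wl x by auto
      have "norm (S ?u i) \<le> lp_norm p (Mult ?\<phi> (S ?u))"
        by (rule norm_le_bump[OF r(1)]) (use S u in auto)
      also have "\<dots> \<le> lp_norm p (S (Mult ?\<phi> ?u)) + \<epsilon> * lp_norm p ?u"
        by (rule comm_bound_upper(2)[OF S cS lip_cutoff_bump[OF r(1)] u(1)])
      also have "lp_norm p (S (Mult ?\<phi> ?u)) \<le> Lp_norm p S * lp_norm p (Mult ?\<phi> ?u)"
        by (rule Lp_bound[OF S]) (use u in simp)
      also have "lp_norm p (Mult ?\<phi> ?u) \<le> lp_norm p (Proj m ?u)"
        using lp_norm_Mult_le[OF lp_Proj, of ?\<phi> m ?u] bump_Proj[OF r(1) m(2), of ?u] by simp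
      finally have 1: "norm (S ?u i) \<le> Lp_norm p S * lp_norm p (Proj m ?u) + \<epsilon> * (2 * M)"
        using S \<epsilon> u(2) by (smt (verit) Lp_norm_nonneg mult_left_mono)
      have im: "idx_norm i \<le> int m" using m(1) by simp
      have "norm (S (x k) i - y i) = norm (Proj m (\<lambda>i. B k (x k) i - S (x k) i) i)"
        using im by (simp add: Proj_def Bx norm_minus_commute)
      also have "\<dots> \<le> \<epsilon> * M"
        using norm_le_lp_norm[OF lp_Proj, of m _ i] k0[OF k, of k] order_trans by blast
      finally have 2: "norm (S (x k) i - y i) \<le> \<epsilon> * M" .
      have "S w i - y i = S ?u i + (S (x k) i - y i)"
        using Lp_diff[OF S wl x, of k] by simp
      then have "norm (S w i - y i) \<le> norm (S ?u i) + norm (S (x k) i - y i)"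
        using norm_triangle_ineq by metis
      then show ?thesis using 1 2 by linarith
    qed
    then have "norm (S w i - y i) \<le> 3 * \<epsilon> * M"
      by (intro LIMSEQ_le_const[of ?b]) (auto intro!: tendsto_eq_intros tends)
    then show "norm (S w i - y i) \<le> 0 + e" using small by simp
  qed
  then have "S w = y" by auto
  then show ?thesis using wl by blast
qed

text \<open>The cutoffs that transfer the lower bound and the solvability of \<open>B\<^sub>k x = y\<close> to the limit have to be chosen before \<open>k\<close>, which is why
  the commutator estimates are shared by all \<open>B\<^sub>k\<close>.\<close>

theorem limit_invertible:
  fixes B :: "nat \<Rightarrow> ('n::finite, 'a::complex_banach) seq_op"
  assumes conv: "loc_conv p B S" and B: "\<And>k. B k \<in> Lp p" and S: "S \<in> Lp p"
    and comm: "\<And>\<epsilon>. \<epsilon> > 0 \<Longrightarrow> \<exists>r>0. \<forall>k. comm_bound p r \<epsilon> (B k)" and \<nu>: "\<nu> > 0"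
    and lower: "\<And>k x. x \<in> lp_space p \<Longrightarrow> \<nu> * lp_norm p x \<le> lp_norm p (B k x)"
    and surj: "\<And>k y. y \<in> lp_space p \<Longrightarrow> \<exists>x\<in>lp_space p. B k x = y"
  shows "op_invertible p (lp_space p) S" and "Lp_norm p (inv_into (lp_space p) S) \<le> 1 / \<nu>"
proof -
  have "almost_local p S"
    using comm comm_bound_limit[OF conv B S] by metis
  note lowerS = lower_bound_limit[OF conv B S this \<nu> lower]
  show "op_invertible p (lp_space p) S" "Lp_norm p (inv_into (lp_space p) S) \<le> 1 / \<nu>"
    using op_invertible_if_lower_bound[OF S \<nu> lowerS surj_limit[OF conv B S comm \<nu> lower surj]] by auto
qed

section \<open>Finite sections\<close>

lemma fin_section_bounded_ops:
  fixes A :: "('n::finite, 'a::complex_banach) seq_op"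
  assumes A: "A \<in> Lp p"
  shows "fin_section A n \<in> bounded_ops p (im_Proj p n)"
proof -
  have S: "fin_section A n \<in> Lp p" using A by simp
  have lp: "x \<in> lp_space p" if "x \<in> im_Proj p n" for x using im_Proj_lp[OF that] .
  show ?thesis
    unfolding bounded_ops_def mem_Collect_eq
  proof (intro conjI ballI allI exI)
    show "fin_section A n ` im_Proj p n \<subseteq> im_Proj p n" by (auto simp: fin_section_def)
    fix x :: "int^'n \<Rightarrow> 'a" assume x: "x \<in> im_Proj p n"
    show "lp_norm p (fin_section A n x) \<le> Lp_norm p (fin_section A n) * lp_norm p x"
      by (rule Lp_bound[OF S lp[OF x]])
    show "fin_section A n (\<lambda>i. a *\<^sub>C x i) = (\<lambda>i. a *\<^sub>C fin_section A n x i)" for a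
      by (rule bounded_ops_scaleC[OF S lp[OF x]])
    fix y :: "int^'n \<Rightarrow> 'a" assume y: "y \<in> im_Proj p n"
    show "fin_section A n (\<lambda>i. x i + y i) = (\<lambda>i. fin_section A n x i + fin_section A n y i)"
      by (rule Lp_add[OF S lp[OF x] lp[OF y]])
  qed
qed

lemma fin_section_norm_le:
  fixes A :: "('n::finite, 'a::complex_banach) seq_op"
  assumes A: "A \<in> Lp p"
  shows "op_norm p (im_Proj p n) (fin_section A n) \<le> Lp_norm p A"
proof (rule op_norm_le)
  fix x :: "int^'n \<Rightarrow> 'a" assume "x \<in> im_Proj p n"
  then have x: "x \<in> lp_space p" "Proj n x = x" using im_Proj_lp im_Proj_iff by auto
  have "lp_norm p (fin_section A n x) \<le> lp_norm p (A x)"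
    unfolding fin_section_def using x lp_norm_Proj_le[of "A x" n] A by simp
  also have "\<dots> \<le> Lp_norm p A * lp_norm p x" by (rule Lp_bound[OF A x(1)])
  finally show "lp_norm p (fin_section A n x) \<le> Lp_norm p A * lp_norm p x" .
qed (use A in auto)

text \<open>If infinitely many sections had norm at most \<open>a\<close>, then \<open>\<phi>Ax\<close>, which is almost \<open>A\<phi>x\<close>, would be bounded by \<open>a\<close> for every
  bump \<open>\<phi>\<close>, because a large section agrees with \<open>A\<close> on \<open>\<phi>x\<close> as seen from any fixed cube.\<close>

lemma fin_section_norm_tendsto:
  fixes A :: "('n::finite, 'a::complex_banach) seq_op"
  assumes A: "A \<in> Lp p" and comm: "almost_local p A"
  shows "(\<lambda>n. op_norm p (im_Proj p n) (fin_section A n)) \<longlonglongrightarrow> Lp_norm p A"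
proof (rule order_tendstoI)
  fix a assume "Lp_norm p A < a"
  then show "\<forall>\<^sub>F n in sequentially. op_norm p (im_Proj p n) (fin_section A n) < a"
    using fin_section_norm_le[OF A] by (intro always_eventually) (metis le_less_trans)
next
  fix a assume a: "a < Lp_norm p A"
  show "\<forall>\<^sub>F n in sequentially. a < op_norm p (im_Proj p n) (fin_section A n)"
  proof (rule ccontr)
    assume "\<not> ?thesis"
    then have freq: "\<exists>n\<ge>m. op_norm p (im_Proj p n) (fin_section A n) \<le> a" for m
      unfolding eventually_sequentially by (meson not_le)
    have a0: "a \<ge> 0"
      using freq[of 0] op_norm_nonneg[OF fin_section_bounded_ops[OF A]] order_trans
      by (metis scaling_closed_im_Proj)
    have le: "lp_norm p (A x) \<le> (a + \<epsilon>) * lp_norm p x" if x: "x \<in> lp_space p" and \<epsilon>: "\<epsilon> > 0" for x \<epsilon>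
    proof -
      obtain r where r: "r > 0" "comm_bound p r \<epsilon> A" using comm \<epsilon> by blast
      have Ax: "A x \<in> lp_space p" using A x by simp
      have "lp_norm p (Proj t (A x)) \<le> (a + \<epsilon>) * lp_norm p x" for t
      proof -
        let ?\<phi> = "bump (0::int^'n) (real t) r"
        obtain m where m: "real t + r \<le> real m" using nat_ge_real by blast
        obtain n where n: "n \<ge> m" "op_norm p (im_Proj p n) (fin_section A n) \<le> a" using freq by blast
        have tn: "real t + r \<le> real n" using m n(1) by linarith
        let ?y = "Mult ?\<phi> x"
        have y: "?y \<in> lp_space p" "lp_norm p ?y \<le> lp_norm p x" using x lp_norm_Mult_le[OF x, of ?\<phi>] by auto
        have yn: "Proj n ?y = ?y" using bump_Proj[OF r(1) tn, of x] by (simp add: Mult_Proj)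
        have "lp_norm p (Proj n (A ?y)) \<le> a * lp_norm p x"
        proof -
          have "lp_norm p (fin_section A n ?y) \<le> op_norm p (im_Proj p n) (fin_section A n) * lp_norm p ?y"
            by (rule op_norm_bound[OF fin_section_bounded_ops[OF A]])
               (use yn im_Proj_iff in auto)
          also have "\<dots> \<le> a * lp_norm p x" using n(2) y a0 by (intro mult_mono) auto
          finally show ?thesis by (simp add: fin_section_def yn)
        qed
        moreover have "lp_norm p (Proj t (A x)) \<le> lp_norm p (Mult ?\<phi> (A x))"
          by (rule Proj_le_bump[OF r(1) Ax])
        moreover have "Mult ?\<phi> (A x) = Proj n (Mult ?\<phi> (A x))"
          using bump_Proj[OF r(1) tn, of "A x"] by (simp add: Mult_Proj)
        moreover have "lp_norm p (Proj n (Mult ?\<phi> (A x))) \<le> lp_norm p (Proj n (A ?y)) + \<epsilon> * lp_norm p x"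
        proof -
          have "lp_norm p (Proj n (Mult ?\<phi> (A x))) \<le> lp_norm p (Proj n (A ?y)) + lp_norm p (Proj n (\<lambda>i. Mult ?\<phi> (A x) i - A ?y i))"
            unfolding Proj_diff by (rule lp_norm_le_diff) auto
          also have "lp_norm p (Proj n (\<lambda>i. Mult ?\<phi> (A x) i - A ?y i)) \<le> lp_norm p (\<lambda>i. Mult ?\<phi> (A x) i - A ?y i)"
            by (rule lp_norm_Proj_le) (use A Ax y in simp)
          also have "\<dots> = lp_norm p (\<lambda>i. A ?y i - Mult ?\<phi> (A x) i)" by (rule lp_norm_minus_commute)
          also have "\<dots> \<le> \<epsilon> * lp_norm p x" by (rule comm_boundD[OF r(2) lip_cutoff_bump[OF r(1)] x])
          finally show ?thesis by simp
        qed
        ultimately show ?thesis by (simp add: distrib_right)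
      qed
      then show ?thesis by (rule lp_norm_le_if_Proj_le(2)[OF _ Ax])
    qed
    have "Lp_norm p A \<le> a + \<epsilon>" if "\<epsilon> > 0" for \<epsilon>
      by (rule Lp_norm_le) (use le that a0 in auto)
    then have "Lp_norm p A \<le> a" by (rule field_le_epsilon)
    then show False using a by simp
  qed
qed

lemma Proj_ext_section: "Proj n (ext_section A c n x) = fin_section A n (Proj n x)"
proof -
  have "Proj n (ext_section A c n x) = Proj n (fin_section A n x)"
    by (auto simp: ext_section_def Coproj_def Proj_def)
  then show ?thesis by (simp add: fin_section_def Proj_Proj)
qed

lemma ext_section_lower_bound:
  fixes A :: "('n::finite, 'a::complex_banach) seq_op"
  assumes A: "A \<in> Lp p" and \<nu>: "0 < \<nu>" "\<nu> \<le> c"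
    and lower: "\<And>x. x \<in> im_Proj p n \<Longrightarrow> \<nu> * lp_norm p x \<le> lp_norm p (fin_section A n x)"
    and x: "x \<in> lp_space p"
  shows "\<nu> * lp_norm p x \<le> lp_norm p (ext_section A c n x)"
proof (rule lp_norm_block_lower_bound[OF x])
  show "ext_section A c n x \<in> lp_space p" using A x by simp
  show "\<nu> * lp_norm p (Proj n x) \<le> lp_norm p (Proj n (ext_section A c n x))"
    unfolding Proj_ext_section by (rule lower) simp
  fix i :: "int^'n" assume "\<not> idx_norm i \<le> int n"
  then have "ext_section A c n x i = c *\<^sub>R x i"
    by (auto simp: ext_section_def fin_section_def Proj_def Coproj_def)
  then show "\<nu> * norm (x i) \<le> norm (ext_section A c n x i)"
    using \<nu> by (simp add: mult_right_mono)
qed (use \<nu> in simp)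

lemma ext_section_surj:
  fixes A :: "('n::finite, 'a::complex_banach) seq_op"
  assumes "c > 0" and surj: "fin_section A n ` im_Proj p n = im_Proj p n" and y: "y \<in> lp_space p"
  shows "\<exists>x\<in>lp_space p. ext_section A c n x = y"
proof -
  obtain u where u: "u \<in> im_Proj p n" "fin_section A n u = Proj n y"
    using surj Proj_in_im_Proj[of n y] by (metis imageE)
  have pu: "Proj n u = u" using u(1) im_Proj_iff by blast
  let ?x = "\<lambda>i. u i + (1 / c) *\<^sub>R Coproj n y i"
  have "?x \<in> lp_space p"
    by (intro lp_add lp_scaleR im_Proj_lp[OF u(1)]) (use y Lp_lp[OF Lp_Coproj] in auto)
  moreover have "Proj n ?x = u" "Coproj n ?x = (\<lambda>i. (1 / c) *\<^sub>R Coproj n y i)"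
    using pu by (auto simp: Proj_def Coproj_def fun_eq_iff split: if_splits)
  then have "ext_section A c n ?x = (\<lambda>i. fin_section A n u i + c *\<^sub>R ((1 / c) *\<^sub>R Coproj n y i))"
    unfolding ext_section_def fin_section_def comp_def by (simp add: pu)
  then have "ext_section A c n ?x = y"
    using u(2) \<open>c > 0\<close> by (auto simp: Coproj_def)
  ultimately show ?thesis by blast
qed

section \<open>Truncated limit operators\<close>

lemma Shift_conj_lower_bound:
  assumes "\<And>x. x \<in> lp_space p \<Longrightarrow> \<nu> * lp_norm p x \<le> lp_norm p (T x)" "x \<in> lp_space p"
  shows "\<nu> * lp_norm p x \<le> lp_norm p (Shift_conj h T x)"
  using assms(1)[of "Shift h x"] assms(2) by simp

lemma Shift_conj_surj:
  assumes "\<And>y. y \<in> lp_space p \<Longrightarrow> \<exists>x\<in>lp_space p. T x = y" "y \<in> lp_space p"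
  shows "\<exists>x\<in>lp_space p. Shift_conj h T x = y"
proof -
  obtain x where "x \<in> lp_space p" "T x = Shift h y" using assms(1)[of "Shift h y"] assms(2) by auto
  then show ?thesis by (intro bexI[of _ "Shift (- h) x"]) auto
qed

text \<open>The difference to \<open>A\<close> only involves blocks of \<open>A\<close> between a fixed cube and the complement of a large one,
  and these are small by off-diagonal decay.\<close>

lemma ext_section_loc_conv:
  fixes A :: "('n::finite, 'a::complex_banach) seq_op"
  assumes A: "A \<in> Lp p" and comm: "almost_local p A"
  shows "loc_conv p (\<lambda>k. ext_section A c k) A"
  unfolding loc_conv_def
proof (intro allI impI)
  fix m :: nat and \<epsilon> :: real assume "\<epsilon> > 0"
  then obtain r where r: "r > 0" "comm_bound p r \<epsilon> A" using comm by blast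
  obtain k0 where k0: "k0 \<ge> m" "real m + r \<le> real k0" using nat_ge_real by blast
  show "\<forall>\<^sub>F k in sequentially. \<forall>x\<in>lp_space p.
     lp_norm p (Proj m (\<lambda>i. ext_section A c k x i - A x i)) \<le> \<epsilon> * lp_norm p x \<and>
     lp_norm p (\<lambda>i. ext_section A c k (Proj m x) i - A (Proj m x) i) \<le> \<epsilon> * lp_norm p x"
  proof (rule eventually_sequentiallyI[of k0], intro ballI conjI)
    fix k and x :: "int^'n \<Rightarrow> 'a" assume k: "k0 \<le> k" and x: "x \<in> lp_space p"
    have mk: "m \<le> k" "real m + r \<le> real k" using k k0 by linarith+
    have far: "real m + r \<le> of_int (idx_norm (i - 0))" if "\<not> idx_norm i \<le> int k" for i :: "int^'n"
      using that mk(2) by (simp; linarith)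
    have near: "of_int (idx_norm (i - 0)) \<le> real m" if "idx_norm i \<le> int m" for i :: "int^'n"
      using that by (simp; linarith)
    let ?q = "Coproj k x"
    let ?\<kappa>m = "\<lambda>i::int^'n. if idx_norm i \<le> int m then 1 else 0 :: real"
    let ?\<kappa>k = "\<lambda>i::int^'n. if idx_norm i \<le> int k then 0 else 1 :: real"
    have q: "?q \<in> lp_space p" using Lp_lp[OF Lp_Coproj x] .
    have Aq: "A ?q = (\<lambda>i. A x i - A (Proj k x) i)"
      using Lp_diff[OF A x, of "Proj k x"] by (simp add: Coproj_def fun_diff_def)
    have "Proj m (\<lambda>i. ext_section A c k x i - A x i) = Mult (\<lambda>i. - ?\<kappa>m i) (A ?q)"
      unfolding Aq using mk(1) by (auto simp: ext_section_def fin_section_def Coproj_def Proj_def Mult_def)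
    then have "lp_norm p (Proj m (\<lambda>i. ext_section A c k x i - A x i)) = lp_norm p (Mult (\<lambda>i. - ?\<kappa>m i) (A ?q))"
      by simp
    also have "\<dots> \<le> \<epsilon> * lp_norm p ?q"
      by (rule off_diagonal_in[OF A r(2,1) q, where m = m and h = 0])
        (use far near in \<open>auto simp: Coproj_def Proj_def split: if_splits\<close>)
    also have "\<dots> \<le> \<epsilon> * lp_norm p x"
      unfolding Coproj_eq_Mult using \<open>\<epsilon> > 0\<close> by (intro mult_left_mono lp_norm_Mult_le[OF x]) auto
    finally show "lp_norm p (Proj m (\<lambda>i. ext_section A c k x i - A x i)) \<le> \<epsilon> * lp_norm p x" .
    have "Proj k (Proj m x) = Proj m x" using mk(1) by (simp add: Proj_Proj min_absorb2)
    then have "(\<lambda>i. ext_section A c k (Proj m x) i - A (Proj m x) i) = Mult (\<lambda>i. - ?\<kappa>k i) (A (Proj m x))"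
      by (simp add: ext_section_def fin_section_def Coproj_def fun_eq_iff) (simp add: Proj_def Mult_def)
    then have "lp_norm p (\<lambda>i. ext_section A c k (Proj m x) i - A (Proj m x) i) = lp_norm p (Mult (\<lambda>i. - ?\<kappa>k i) (A (Proj m x)))"
      by simp
    also have "\<dots> \<le> \<epsilon> * lp_norm p (Proj m x)"
      by (rule off_diagonal_out[OF A r(2,1) lp_Proj, where m = m and h = 0])
        (use far near in \<open>auto simp: Proj_def split: if_splits\<close>)
    also have "\<dots> \<le> \<epsilon> * lp_norm p x"
      using \<open>\<epsilon> > 0\<close> by (intro mult_left_mono lp_norm_Proj_le[OF x]) auto
    finally show "lp_norm p (\<lambda>i. ext_section A c k (Proj m x) i - A (Proj m x) i) \<le> \<epsilon> * lp_norm p x" .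
  qed
qed

lemma ext_section_bound:
  assumes A: "A \<in> Lp p" and x: "x \<in> lp_space p"
  shows "lp_norm p (ext_section A c n x) \<le> (Lp_norm p A + \<bar>c\<bar>) * lp_norm p x"
proof -
  have q: "Coproj n x \<in> lp_space p" using Lp_lp[OF Lp_Coproj x] .
  have 1: "lp_norm p (fin_section A n x) \<le> Lp_norm p A * lp_norm p x"
  proof -
    have "lp_norm p (fin_section A n x) \<le> lp_norm p (A (Proj n x))"
      unfolding fin_section_def using lp_norm_Proj_le[of "A (Proj n x)" n] A by simp
    also have "\<dots> \<le> Lp_norm p A * lp_norm p (Proj n x)" by (rule Lp_bound[OF A]) simp
    also have "\<dots> \<le> Lp_norm p A * lp_norm p x"
      using A by (intro mult_left_mono lp_norm_Proj_le[OF x]) simp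
    finally show ?thesis .
  qed
  have "lp_norm p (\<lambda>i. c *\<^sub>R Coproj n x i) = \<bar>c\<bar> * lp_norm p (Coproj n x)"
    by (rule lp_norm_scaleR[OF q])
  also have "\<dots> \<le> \<bar>c\<bar> * lp_norm p x"
    unfolding Coproj_eq_Mult by (intro mult_left_mono lp_norm_Mult_le[OF x]) auto
  finally have 2: "lp_norm p (\<lambda>i. c *\<^sub>R Coproj n x i) \<le> \<bar>c\<bar> * lp_norm p x" .
  have "lp_norm p (ext_section A c n x) \<le> lp_norm p (fin_section A n x) + lp_norm p (\<lambda>i. c *\<^sub>R Coproj n x i)"
    unfolding ext_section_def by (rule lp_norm_triangle) (use A x q in simp_all)
  then show ?thesis using 1 2 by (simp add: distrib_right)
qed

text \<open>Conjugation by the shift turns the extended section into \<open>\<kappa>\<^sub>k T\<^sub>k \<kappa>\<^sub>k + c(1 - \<kappa>\<^sub>k)\<close>, where \<open>T\<^sub>k\<close> is the shifted operator and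
  \<open>\<kappa>\<^sub>k\<close> the indicator of the shifted cube. As \<open>\<kappa>\<^sub>k\<close> is eventually constant on each fixed cube, the limit is the same
  expression with the limits of \<open>T\<^sub>k\<close> and \<open>\<kappa>\<^sub>k\<close>; the error far outside is controlled by off-diagonal decay.\<close>

lemma truncated_limit:
  fixes A A' :: "('n::finite, 'a::complex_banach) seq_op"
  assumes A: "A \<in> Lp p" and comm: "almost_local p A" and A': "A' \<in> Lp p"
    and conv: "loc_conv p (\<lambda>k. Shift_conj (h k) A) A'"
    and cubes: "\<And>i. \<forall>\<^sub>F k in sequentially. (idx_norm (i + h k) \<le> int (m k)) = (i \<in> U)"
  shows "\<exists>S. P_strong_lim p (\<lambda>k. Shift_conj (h k) (ext_section A c (m k))) S"
proof -
  define \<kappa> where "\<kappa> = (\<lambda>i. if i \<in> U then 1 else 0 :: real)"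
  define \<kappa>' where "\<kappa>' k = (\<lambda>i. if idx_norm (i + h k) \<le> int (m k) then 1 else 0 :: real)" for k
  define T where "T k = Shift_conj (h k) A" for k
  define B where "B k = Shift_conj (h k) (ext_section A c (m k))" for k
  define S where "S = (\<lambda>x i. Mult \<kappa> (A' (Mult \<kappa> x)) i + c *\<^sub>R Mult (\<lambda>i. 1 - \<kappa> i) x i)"
  have ab: "\<bar>\<kappa> i\<bar> \<le> 1" "\<bar>1 - \<kappa> i\<bar> \<le> 1" "\<bar>\<kappa>' k i\<bar> \<le> 1" "\<bar>\<kappa>' k i - \<kappa> i\<bar> \<le> 1" "\<bar>\<kappa> i * \<kappa>' k i\<bar> \<le> 1" for k i
    by (auto simp: \<kappa>_def \<kappa>'_def)
  have T: "T k \<in> Lp p" and B: "B k \<in> Lp p" for k using A by (simp_all add: T_def B_def)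
  have B_eq: "B k x = (\<lambda>i. Mult (\<kappa>' k) (T k (Mult (\<kappa>' k) x)) i + c *\<^sub>R Mult (\<lambda>i. 1 - \<kappa>' k i) x i)" for k x
  proof -
    have "Proj (m k) (Shift (h k) x) = Shift (h k) (Mult (\<kappa>' k) x)"
      by (auto simp: Proj_def Shift_def Mult_def \<kappa>'_def)
    then show ?thesis
      by (simp add: B_def T_def ext_section_def fin_section_def Coproj_def)
        (auto simp: Shift_def Proj_def Mult_def \<kappa>'_def)
  qed
  have S: "S \<in> Lp p"
    using Lp_plus[OF Lp_comp[OF Lp_Mult Lp_comp[OF A' Lp_Mult]] Lp_scaleR[OF Lp_Mult],
        of \<kappa> \<kappa> "\<lambda>i. 1 - \<kappa> i" c] ab unfolding S_def comp_def by blast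
  have commT: "\<exists>r>0. \<forall>k. comm_bound p r \<epsilon> (T k)" if "\<epsilon> > 0" for \<epsilon>
    using comm that comm_bound_Shift[OF A] unfolding T_def by blast
  have "loc_conv p B S"
    unfolding loc_conv_def
  proof (intro allI impI)
    fix n :: nat and \<epsilon> :: real assume "\<epsilon> > 0"
    then have e2: "\<epsilon> / 2 > 0" by simp
    obtain r where r: "r > 0" "\<And>k. comm_bound p r (\<epsilon> / 2) (T k)" using commT[OF e2] by blast
    have rA': "comm_bound p r (\<epsilon> / 2) A'"
      using comm_bound_limit[OF conv _ A'] T r(2) unfolding T_def by blast
    obtain M where M: "n \<le> M" "real n + r \<le> real M" using nat_ge_real by blast
    have "\<forall>\<^sub>F k in sequentially. \<forall>i\<in>{i. idx_norm i \<le> int M}. (idx_norm (i + h k) \<le> int (m k)) = (i \<in> U)"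
      by (rule eventually_ball_finite) (use cubes in auto)
    then have e1: "\<forall>\<^sub>F k in sequentially. \<forall>i. idx_norm i \<le> int M \<longrightarrow> \<kappa>' k i = \<kappa> i"
      by eventually_elim (auto simp: \<kappa>_def \<kappa>'_def)
    have "\<forall>\<^sub>F k in sequentially. \<forall>x\<in>lp_space p.
       lp_norm p (Proj n (\<lambda>i. T k x i - A' x i)) \<le> \<epsilon> / 2 * lp_norm p x \<and>
       lp_norm p (\<lambda>i. T k (Proj n x) i - A' (Proj n x) i) \<le> \<epsilon> / 2 * lp_norm p x"
      using conv e2 unfolding loc_conv_def T_def by blast
    with e1 show "\<forall>\<^sub>F k in sequentially. \<forall>x\<in>lp_space p.
       lp_norm p (Proj n (\<lambda>i. B k x i - S x i)) \<le> \<epsilon> * lp_norm p x \<and>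
       lp_norm p (\<lambda>i. B k (Proj n x) i - S (Proj n x) i) \<le> \<epsilon> * lp_norm p x"
    proof eventually_elim
      case (elim k)
      have eqM: "\<kappa>' k i = \<kappa> i" if "idx_norm i \<le> int M" for i using elim(1) that by blast
      have eqn: "\<kappa>' k i = \<kappa> i" if "idx_norm i \<le> int n" for i using eqM[of i] that M(1) by simp
      have far: "real n + r \<le> of_int (idx_norm (i - 0))" if "\<kappa>' k i - \<kappa> i \<noteq> 0" for i
      proof -
        have "\<not> idx_norm i \<le> int M" using eqM[of i] that by auto
        then show ?thesis using M(2) by (simp; linarith)
      qed
      have near: "of_int (idx_norm (i - 0)) \<le> real n" if "idx_norm i \<le> int n" for i :: "int^'n"
        using that by (simp; linarith)
      show ?case
      proof (intro ballI conjI)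
        fix x :: "int^'n \<Rightarrow> 'a" assume x: "x \<in> lp_space p"
        let ?y = "Mult (\<kappa>' k) x"
        let ?w = "Mult (\<lambda>i. \<kappa>' k i - \<kappa> i) x"
        have y: "?y \<in> lp_space p" "lp_norm p ?y \<le> lp_norm p x" and w: "?w \<in> lp_space p" "lp_norm p ?w \<le> lp_norm p x"
          and kx: "Mult \<kappa> x \<in> lp_space p" and ly: "A' ?y \<in> lp_space p" "T k ?y \<in> lp_space p" and lw: "A' ?w \<in> lp_space p"
          using x ab lp_norm_Mult_le[OF x] A' T by auto
        have w_eq: "A' ?w = (\<lambda>i. A' ?y i - A' (Mult \<kappa> x) i)"
          using Lp_diff[OF A' y(1) kx] by (simp add: Mult_def scaleR_diff_left)
        let ?u = "Mult \<kappa> (Proj n (\<lambda>i. T k ?y i - A' ?y i))"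
        let ?v = "Mult (\<lambda>i. if idx_norm i \<le> int n then \<kappa> i else 0) (A' ?w)"
        have "Proj n (\<lambda>i. B k x i - S x i) = (\<lambda>i. ?u i + ?v i)"
          unfolding B_eq S_def w_eq
        proof
          fix i
          show "Proj n (\<lambda>i. Mult (\<kappa>' k) (T k ?y) i + c *\<^sub>R Mult (\<lambda>i. 1 - \<kappa>' k i) x i -
              (Mult \<kappa> (A' (Mult \<kappa> x)) i + c *\<^sub>R Mult (\<lambda>i. 1 - \<kappa> i) x i)) i = ?u i + Mult (\<lambda>i. if idx_norm i \<le> int n then \<kappa> i else 0) (\<lambda>i. A' ?y i - A' (Mult \<kappa> x) i) i"
            using eqn[of i] by (auto simp: Proj_def Mult_def scaleR_diff_right)
        qed
        moreover have "lp_norm p ?u \<le> \<epsilon> / 2 * lp_norm p x"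
        proof -
          have "lp_norm p ?u \<le> lp_norm p (Proj n (\<lambda>i. T k ?y i - A' ?y i))"
            by (rule lp_norm_Mult_le) (use ab in auto)
          also have "\<dots> \<le> \<epsilon> / 2 * lp_norm p ?y" using elim(2) y(1) by blast
          also have "\<dots> \<le> \<epsilon> / 2 * lp_norm p x" using y(2) e2 by (intro mult_left_mono) auto
          finally show ?thesis .
        qed
        moreover have "lp_norm p ?v \<le> \<epsilon> / 2 * lp_norm p x"
        proof -
          have "lp_norm p ?v \<le> \<epsilon> / 2 * lp_norm p ?w"
            by (rule off_diagonal_in[OF A' rA' r(1) w(1), where m = n and h = 0])
              (use far near ab in \<open>auto simp: Mult_def split: if_splits\<close>)
          also have "\<dots> \<le> \<epsilon> / 2 * lp_norm p x" using w(2) e2 by (intro mult_left_mono) auto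
          finally show ?thesis .
        qed
        moreover have "lp_norm p (\<lambda>i. ?u i + ?v i) \<le> lp_norm p ?u + lp_norm p ?v"
          by (rule lp_norm_triangle) (use ab lw in \<open>auto intro!: lp_Mult\<close>)
        ultimately show "lp_norm p (Proj n (\<lambda>i. B k x i - S x i)) \<le> \<epsilon> * lp_norm p x" by simp
      next
        fix x :: "int^'n \<Rightarrow> 'a" assume x: "x \<in> lp_space p"
        let ?y = "Mult \<kappa> (Proj n x)"
        have yx: "?y = Proj n (Mult \<kappa> x)" by (rule Mult_Proj)
        have kx: "Mult \<kappa> x \<in> lp_space p" "lp_norm p (Mult \<kappa> x) \<le> lp_norm p x"
          using x ab lp_norm_Mult_le[OF x] by auto
        have y: "?y \<in> lp_space p" "lp_norm p ?y \<le> lp_norm p x"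
          using kx lp_norm_Proj_le[OF kx(1), of n] unfolding yx by auto
        have l: "A' ?y \<in> lp_space p" "T k ?y \<in> lp_space p" using y A' T by auto
        have k1: "Mult (\<kappa>' k) (Proj n x) = ?y"
        proof
          show "Mult (\<kappa>' k) (Proj n x) i = ?y i" for i using eqn[of i] by (auto simp: Mult_def Proj_def)
        qed
        have k2: "Mult (\<lambda>i. 1 - \<kappa>' k i) (Proj n x) = Mult (\<lambda>i. 1 - \<kappa> i) (Proj n x)"
        proof
          show "Mult (\<lambda>i. 1 - \<kappa>' k i) (Proj n x) i = Mult (\<lambda>i. 1 - \<kappa> i) (Proj n x) i" for i
            using eqn[of i] by (auto simp: Mult_def Proj_def)
        qed
        let ?u = "Mult (\<kappa>' k) (\<lambda>i. T k ?y i - A' ?y i)"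
        let ?v = "Mult (\<lambda>i. \<kappa>' k i - \<kappa> i) (A' ?y)"
        have "(\<lambda>i. B k (Proj n x) i - S (Proj n x) i) = (\<lambda>i. ?u i + ?v i)"
          unfolding B_eq S_def k1 k2 by (simp add: Mult_def algebra_simps)
        moreover have "lp_norm p ?u \<le> \<epsilon> / 2 * lp_norm p x"
        proof -
          have "lp_norm p ?u \<le> lp_norm p (\<lambda>i. T k ?y i - A' ?y i)"
            by (rule lp_norm_Mult_le) (use ab l in auto)
          also have "\<dots> \<le> \<epsilon> / 2 * lp_norm p (Mult \<kappa> x)" using elim(2) kx(1) unfolding yx by blast
          also have "\<dots> \<le> \<epsilon> / 2 * lp_norm p x" using kx(2) e2 by (intro mult_left_mono) auto
          finally show ?thesis .
        qed
        moreover have "lp_norm p ?v \<le> \<epsilon> / 2 * lp_norm p x"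
        proof -
          have "lp_norm p ?v \<le> \<epsilon> / 2 * lp_norm p ?y"
            by (rule off_diagonal_out[OF A' rA' r(1) y(1), where m = n and h = 0])
              (use far near ab in \<open>auto simp: Mult_def Proj_def split: if_splits\<close>)
          also have "\<dots> \<le> \<epsilon> / 2 * lp_norm p x" using y(2) e2 by (intro mult_left_mono) auto
          finally show ?thesis .
        qed
        moreover have "lp_norm p (\<lambda>i. ?u i + ?v i) \<le> lp_norm p ?u + lp_norm p ?v"
          by (rule lp_norm_triangle) (use ab l in \<open>auto intro!: lp_Mult\<close>)
        ultimately show "lp_norm p (\<lambda>i. B k (Proj n x) i - S (Proj n x) i) \<le> \<epsilon> * lp_norm p x" by simp
      qed
    qed
  qed
  moreover have "lp_norm p (B k x) \<le> (Lp_norm p A + \<bar>c\<bar>) * lp_norm p x" if "x \<in> lp_space p" for k x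
    using ext_section_bound[OF A, of "Shift (h k) x" c "m k"] that by (simp add: B_def)
  ultimately have "P_strong_lim p B S" by (intro loc_conv_imp_P_strong_lim[OF _ B S])
  then show ?thesis unfolding B_def by blast
qed

section \<open>Localisation of approximate minimisers\<close>

text \<open>Interchange of summation: every entry of \<open>x\<close> meets every value of \<open>g\<close> exactly once. On average over
  the translates, a weight therefore acts on the \<open>p\<close>-th power of the norm as a constant.\<close>

lemma sum_translates:
  fixes x :: "int^'n::finite \<Rightarrow> 'a::complex_banach" and g :: "int^'n \<Rightarrow> real"
  assumes p: "p \<noteq> 0" "p \<noteq> \<infinity>" and x: "Proj n x = x" and g: "\<And>j. 0 \<le> g j"
    and supp: "\<And>j. g j \<noteq> 0 \<Longrightarrow> idx_norm j \<le> K"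
    and H: "H = {h. idx_norm h \<le> int n + K}"
  shows "(\<Sum>h\<in>H. lp_norm p (Mult (\<lambda>i. g (h - i)) x) powr enn2real p)
    = (\<Sum>j | idx_norm j \<le> K. g j powr enn2real p) * lp_norm p x powr enn2real p"
proof -
  let ?q = "enn2real p" and ?C = "{i::int^'n. idx_norm i \<le> int n}"
  have q: "?q \<ge> 1" by (rule exponent_ge_1[OF p])
  have supp_x: "x i = 0" if "i \<notin> ?C" for i using x that unfolding Proj_eq_iff by simp
  have norm_eq: "lp_norm p y powr ?q = (\<Sum>i\<in>?C. norm (y i) powr ?q)" if "\<And>i. i \<notin> ?C \<Longrightarrow> y i = 0" for y :: "int^'n \<Rightarrow> 'a"
  proof -
    have "lp_norm p y powr ?q = (\<Sum>\<^sub>\<infinity>i\<in>?C. norm (y i) powr ?q)"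
      unfolding lp_norm_powr[OF p] by (rule infsum_cong_neutral) (use that q in auto)
    then show ?thesis by simp
  qed
  have inner: "(\<Sum>h\<in>H. g (h - i) powr ?q) = (\<Sum>j | idx_norm j \<le> K. g j powr ?q)" if "i \<in> ?C" for i
  proof -
    have "(\<Sum>j | idx_norm j \<le> K. g j powr ?q) = (\<Sum>h\<in>(\<lambda>j. j + i) ` {j. idx_norm j \<le> K}. g (h - i) powr ?q)"
      by (subst sum.reindex) (auto simp: inj_on_def)
    also have "\<dots> = (\<Sum>h\<in>H. g (h - i) powr ?q)"
    proof (rule sum.mono_neutral_left)
      show "finite H" unfolding H by simp
      show "(\<lambda>j. j + i) ` {j. idx_norm j \<le> K} \<subseteq> H"
        unfolding H using idx_norm_triangle that by (smt (verit) image_subset_iff mem_Collect_eq)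
      show "\<forall>h\<in>H - (\<lambda>j. j + i) ` {j. idx_norm j \<le> K}. g (h - i) powr ?q = 0"
      proof
        fix h assume "h \<in> H - (\<lambda>j. j + i) ` {j. idx_norm j \<le> K}"
        then have "\<not> idx_norm (h - i) \<le> K" using image_eqI[of h "\<lambda>j. j + i" "h - i"] by auto
        then have "g (h - i) = 0" using supp by blast
        then show "g (h - i) powr ?q = 0" using q by simp
      qed
    qed
    finally show ?thesis by simp
  qed
  have "(\<Sum>h\<in>H. lp_norm p (Mult (\<lambda>i. g (h - i)) x) powr ?q) = (\<Sum>h\<in>H. \<Sum>i\<in>?C. g (h - i) powr ?q * norm (x i) powr ?q)"
  proof (rule sum.cong[OF refl])
    fix h
    have "lp_norm p (Mult (\<lambda>i. g (h - i)) x) powr ?q = (\<Sum>i\<in>?C. norm (Mult (\<lambda>i. g (h - i)) x i) powr ?q)"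
      by (rule norm_eq) (use supp_x in \<open>auto simp: Mult_def\<close>)
    also have "\<dots> = (\<Sum>i\<in>?C. g (h - i) powr ?q * norm (x i) powr ?q)"
      using g by (simp add: Mult_def powr_mult)
    finally show "lp_norm p (Mult (\<lambda>i. g (h - i)) x) powr ?q = (\<Sum>i\<in>?C. g (h - i) powr ?q * norm (x i) powr ?q)" .
  qed
  also have "\<dots> = (\<Sum>i\<in>?C. (\<Sum>h\<in>H. g (h - i) powr ?q) * norm (x i) powr ?q)"
    by (subst sum.swap) (simp add: sum_distrib_right)
  also have "\<dots> = (\<Sum>i\<in>?C. (\<Sum>j | idx_norm j \<le> K. g j powr ?q) * norm (x i) powr ?q)"
    using inner by simp
  also have "\<dots> = (\<Sum>j | idx_norm j \<le> K. g j powr ?q) * lp_norm p x powr ?q"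
  proof -
    have "lp_norm p x powr ?q = (\<Sum>i\<in>?C. norm (x i) powr ?q)" by (rule norm_eq) (rule supp_x)
    then show ?thesis by (simp add: sum_distrib_left)
  qed
  finally show ?thesis .
qed

text \<open>For the supremum norm the cutoff is centred where \<open>x\<close> is largest, so it does not decrease the norm.\<close>

lemma localisation_sup:
  fixes A :: "('n::finite, 'a::complex_banach) seq_op"
  assumes ps: "p = 0 \<or> p = \<infinity>" and A: "A \<in> band_dominated p" and \<delta>: "\<delta> > 0"
  shows "\<exists>R. localises p A \<delta> R"
proof -
  have AL: "A \<in> Lp p" using A by (simp add: band_dominated_def)
  obtain r where r: "r > 0" "comm_bound p r \<delta> A"
    using band_dominated_comm_bound[OF A \<delta>] by blast
  show ?thesis
  proof (intro exI[of _ "\<lfloor>r\<rfloor>"] allI impI)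
    fix n and x :: "int^'n \<Rightarrow> 'a" assume x: "Proj n x = x" and x0: "x \<noteq> (\<lambda>i. 0)"
    let ?C = "{i::int^'n. idx_norm i \<le> int n}"
    have xl: "x \<in> lp_space p" using x lp_Proj[of n x] by simp
    define m where "m = Max ((\<lambda>i. norm (x i)) ` ?C)"
    have "(0::int^'n) \<in> ?C" by simp
    then have "m \<in> (\<lambda>i. norm (x i)) ` ?C" unfolding m_def by (intro Max_in finite_imageI finite_cube) blast
    then obtain h where "h \<in> ?C" "m = norm (x h)" by blast
    then have h: "norm (x i) \<le> norm (x h)" if "i \<in> ?C" for i
      using that Max_ge[of "(\<lambda>i. norm (x i)) ` ?C" "norm (x i)"] by (simp add: m_def)
    have "norm (x i) \<le> norm (x h)" for i
      using h[of i] x unfolding Proj_eq_iff by (cases "i \<in> ?C") auto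
    then have xh: "lp_norm p x \<le> norm (x h)"
      using lp_norm_sup[OF ps, of x] sup_norm_le_iff[OF lp_bounded[OF ps xl]] by simp
    have pos: "lp_norm p x > 0" using lp_norm_pos_iff[OF xl] x0 by simp
    let ?\<phi> = "bump h 0 r"
    let ?y = "Mult ?\<phi> x"
    have y: "lp_norm p x \<le> lp_norm p ?y"
      using norm_le_bump[OF r(1) xl, of h h 0] xh by simp
    have TL: "fin_section A n \<in> Lp p" using AL by simp
    have "lp_norm p (fin_section A n ?y) \<le> lp_norm p (Mult ?\<phi> (fin_section A n x)) + \<delta> * lp_norm p x"
      by (rule comm_bound_upper(1)[OF TL comm_bound_fin_section[OF AL r(2)] lip_cutoff_bump[OF r(1)] xl])
        (use \<delta> in simp)
    also have "\<dots> \<le> lp_norm p (fin_section A n x) + \<delta> * lp_norm p x"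
      using lp_norm_Mult_le[OF Lp_lp[OF TL xl], of ?\<phi>] by simp
    finally have "quot p A n ?y \<le> (lp_norm p (fin_section A n x) + \<delta> * lp_norm p x) / lp_norm p x"
      using y pos Lp_lp[OF TL xl] \<delta> by (intro frac_le) auto
    also have "\<dots> = quot p A n x + \<delta>" using pos by (simp add: add_divide_distrib)
    finally have "quot p A n ?y \<le> quot p A n x + \<delta>" .
    moreover have "?y \<noteq> (\<lambda>i. 0)" using y pos by auto
    moreover have "idx_norm (i - h) \<le> \<lfloor>r\<rfloor>" if "?\<phi> i \<noteq> 0" for i
      using that bump_eq_0[OF r(1), of 0 i h] by (cases "r \<le> of_int (idx_norm (i - h))") (auto simp: le_floor_iff)
    ultimately show "\<exists>h \<phi>. good_cutoff p A \<delta> \<lfloor>r\<rfloor> n x h \<phi>"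
      by (intro exI[of _ h] exI[of _ ?\<phi>]) auto
  qed
qed

text \<open>For finite exponents the centre is found by averaging over all translates of a bump \<open>g\<close>. For a band operator \<open>B\<close> close to \<open>A\<close> one has
  \<open>B\<phi>x = \<phi>Bx + [B, \<phi>]x\<close>. By translation invariance, the first term has on average the same quotient to \<open>\<phi>x\<close> as \<open>Bx\<close> has to \<open>x\<close>. The
  commutator only sees the part of \<open>x\<close> in a neighbourhood of the support of \<open>\<phi>\<close>, cut out by \<open>\<psi>\<close>; the averages of \<open>\<psi>x\<close> and
  \<open>\<phi>x\<close> are comparable with a constant that depends on the dimension alone, while the commutator carries a factor \<open>1/k\<close>.\<close>

lemma localisation_finite:
  fixes A :: "('n::finite, 'a::complex_banach) seq_op"
  assumes p: "p \<noteq> 0" "p \<noteq> \<infinity>" and A: "A \<in> band_dominated p" and \<delta>: "\<delta> > 0"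
  shows "\<exists>R. localises p A \<delta> R"
proof -
  let ?q = "enn2real p"
  have q: "?q \<ge> 1" by (rule exponent_ge_1[OF p])
  define \<eta> where "\<eta> = \<delta> / 4"
  have \<eta>: "\<eta> > 0" using \<delta> by (simp add: \<eta>_def)
  have AL: "A \<in> Lp p" using A by (simp add: band_dominated_def)
  obtain B where B: "band_operator B" and AB: "Lp_norm p (A - B) < \<eta>"
    using A \<eta> unfolding band_dominated_def by blast
  note BL = band_operator_Lp_and_comm(1)[OF B]
  obtain D where D: "D \<ge> 0" "\<And>r. r > 0 \<Longrightarrow> comm_bound p r (D / r) B"
    using band_operator_Lp_and_comm(2)[OF B] by blast
  obtain w :: nat where w: "\<And>x i. (\<And>j. idx_norm (i - j) \<le> int w \<Longrightarrow> x j = 0) \<Longrightarrow> B x i = 0"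
    using band_operator_width[OF B] by blast
  define c3 :: real where "c3 = 3 ^ CARD('n)"
  have c3: "c3 \<ge> 1" by (simp add: c3_def)
  obtain k where k: "w + 1 \<le> k" "D * c3 / \<eta> \<le> real k" using nat_ge_real by blast
  have k0: "real k > 0" "w \<le> k" using k(1) by auto
  \<comment> \<open>The cutoff width \<open>k\<close> exceeds the band width, and makes the commutator small even after the loss of \<open>c3\<close>.\<close>
  define \<epsilon> where "\<epsilon> = \<eta> / c3"
  have \<epsilon>: "\<epsilon> > 0" "D / real k \<le> \<epsilon>" using \<eta> c3 k(2) k0 by (simp_all add: \<epsilon>_def field_simps)
  define g where "g = bump (0::int^'n) (real k) (real k)"
  define g' where "g' j = (if idx_norm j \<le> 3 * int k then 1 else 0 :: real)" for j :: "int^'n"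
  have gb: "0 \<le> g j" "\<bar>g j\<bar> \<le> 1" "0 \<le> g' j" "\<bar>g' j\<bar> \<le> 1" for j by (auto simp: g_def g'_def)
  have g_supp: "idx_norm j \<le> 2 * int k" if "g j \<noteq> 0" for j
  proof (rule ccontr)
    assume "\<not> idx_norm j \<le> 2 * int k"
    then have "real_of_int (2 * int k) \<le> of_int (idx_norm (j - 0))" by (subst of_int_le_iff) simp
    then show False using that bump_eq_0[OF k0(1), of "real k" j 0] by (simp add: g_def)
  qed
  have lip: "lip_cutoff (real k) (\<lambda>i. g (h - i))" for h
  proof -
    have "(\<lambda>i. g (h - i)) = bump h (real k) (real k)"
      by (simp add: g_def bump_def fun_eq_iff idx_norm_minus_commute[of h])
    then show ?thesis using lip_cutoff_bump[OF k0(1)] by simp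
  qed
  define V where "V = (\<Sum>j | idx_norm j \<le> 3 * int k. g j powr ?q)"
  define W where "W = (\<Sum>j | idx_norm j \<le> 3 * int k. g' j powr ?q)"
  have V: "real (card {j::int^'n. idx_norm j \<le> int k}) \<le> V"
  proof -
    have "real (card {j::int^'n. idx_norm j \<le> int k}) = (\<Sum>j::int^'n | idx_norm j \<le> int k. g j powr ?q)"
    proof -
      have "g j = 1" if "idx_norm j \<le> int k" for j
        unfolding g_def using that by (intro bump_eq_1[OF k0(1)]) (simp; linarith)
      then show ?thesis by simp
    qed
    also have "\<dots> \<le> V" unfolding V_def by (rule sum_mono2) auto
    finally show ?thesis .
  qed
  have V0: "V > 0"
    using V card_cube[of "int k", where 'n = 'n] by (simp add: order_less_le_trans[OF _ V])
  \<comment> \<open>The neighbourhood has radius \<open>3k\<close> and the bump is one up to radius \<open>k\<close>; the cubes differ by at most \<open>3\<close> in each direction.\<close>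
  have W: "W \<le> c3 * V"
  proof -
    have "W = real (card {j::int^'n. idx_norm j \<le> 3 * int k})" by (simp add: W_def g'_def)
    also have "\<dots> = (6 * real k + 1) ^ CARD('n)" using card_cube[of "3 * int k", where 'n = 'n] by simp
    also have "\<dots> \<le> (3 * (2 * real k + 1)) ^ CARD('n)" by (intro power_mono) auto
    also have "\<dots> = c3 * real (card {j::int^'n. idx_norm j \<le> int k})"
      unfolding c3_def power_mult_distrib using card_cube[of "int k", where 'n = 'n] by simp
    also have "\<dots> \<le> c3 * V" using V c3 by (intro mult_left_mono) auto
    finally show ?thesis .
  qed
  have close: "lp_norm p (\<lambda>i. fin_section A n x i - fin_section B n x i) \<le> \<eta> * lp_norm p x" if x: "Proj n x = x" for n x
  proof -
    have xl: "x \<in> lp_space p" using x lp_Proj[of n x] by simp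
    have "lp_norm p (\<lambda>i. fin_section A n x i - fin_section B n x i) = lp_norm p (Proj n ((A - B) x))"
      by (simp add: fin_section_def x Proj_diff fun_diff_def)
    also have "\<dots> \<le> lp_norm p ((A - B) x)"
      by (rule lp_norm_Proj_le[OF Lp_lp[OF Lp_minus[OF AL BL] xl]])
    also have "\<dots> \<le> Lp_norm p (A - B) * lp_norm p x"
      by (rule Lp_bound[OF Lp_minus[OF AL BL] xl])
    also have "\<dots> \<le> \<eta> * lp_norm p x" using AB xl by (intro mult_right_mono) auto
    finally show ?thesis .
  qed
  have commB: "lp_norm p (\<lambda>i. fin_section B n (Mult (\<lambda>i. g (h - i)) x) i - Mult (\<lambda>i. g (h - i)) (fin_section B n x) i)
      \<le> \<epsilon> * lp_norm p (Mult (\<lambda>i. g' (h - i)) x)" if x: "Proj n x = x" for n h x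
  proof -
    have xl: "x \<in> lp_space p" using x lp_Proj[of n x] by simp
    let ?\<phi> = "\<lambda>i. g (h - i)" and ?\<psi> = "\<lambda>i. g' (h - i)"
    let ?z = "Mult ?\<psi> x"
    have z: "?z \<in> lp_space p" using xl gb by simp
    have 1: "Mult ?\<phi> x = Mult ?\<phi> ?z"
    proof
      show "Mult ?\<phi> x i = Mult ?\<phi> ?z i" for i
        using g_supp[of "h - i"] k0 by (cases "g (h - i) = 0") (auto simp: Mult_def g'_def)
    qed
    \<comment> \<open>Since \<open>B\<close> has width \<open>w\<close>, the commutator does not change if \<open>x\<close> is replaced by \<open>\<psi>x\<close>.\<close>
    have 2: "Mult ?\<phi> (B x) = Mult ?\<phi> (B ?z)"
    proof
      fix i
      show "Mult ?\<phi> (B x) i = Mult ?\<phi> (B ?z) i"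
      proof (cases "g (h - i) = 0")
        case False
        have "B (\<lambda>i. x i - ?z i) i = 0"
        proof (rule w)
          fix j assume "idx_norm (i - j) \<le> int w"
          then have "idx_norm (h - j) \<le> 3 * int k"
            using idx_norm_triangle_minus[of h j i] g_supp[OF False] k0(2) by linarith
          then show "x j - ?z j = 0" by (simp add: Mult_def g'_def)
        qed
        then show ?thesis using Lp_diff[OF BL xl z] by (simp add: Mult_def)
      qed (simp add: Mult_def)
    qed
    let ?d = "\<lambda>i. B (Mult ?\<phi> ?z) i - Mult ?\<phi> (B ?z) i"
    have "(\<lambda>i. fin_section B n (Mult ?\<phi> x) i - Mult ?\<phi> (fin_section B n x) i)
        = Proj n (\<lambda>i. B (Mult ?\<phi> x) i - Mult ?\<phi> (B x) i)"
      by (simp add: fin_section_def x Mult_Proj[symmetric] Proj_diff)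
    then have "lp_norm p (\<lambda>i. fin_section B n (Mult ?\<phi> x) i - Mult ?\<phi> (fin_section B n x) i) = lp_norm p (Proj n ?d)"
      by (simp only: 1 2)
    also have "\<dots> \<le> lp_norm p ?d"
      by (rule lp_norm_Proj_le) (use BL z gb in simp)
    also have "\<dots> \<le> D / real k * lp_norm p ?z"
      by (rule comm_boundD[OF D(2)[OF k0(1)] lip z])
    also have "\<dots> \<le> \<epsilon> * lp_norm p ?z" using \<epsilon>(2) z by (intro mult_right_mono) auto
    finally show ?thesis .
  qed
  show ?thesis
  proof (intro exI[of _ "2 * int k"] allI impI)
    fix n and x :: "int^'n \<Rightarrow> 'a" assume x: "Proj n x = x" and x0: "x \<noteq> (\<lambda>i. 0)"
    have xl: "x \<in> lp_space p" using x lp_Proj[of n x] by simp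
    have pos: "lp_norm p x > 0" using lp_norm_pos_iff[OF xl] x0 by simp
    define \<rho> where "\<rho> = quot p A n x"
    have \<rho>: "\<rho> \<ge> 0" "lp_norm p (fin_section A n x) = \<rho> * lp_norm p x"
      using pos AL xl by (simp_all add: \<rho>_def)
    \<comment> \<open>An upper bound for the quotient of \<open>B\<close>, made strictly positive.\<close>
    define s where "s = \<rho> + \<eta>"
    have s: "s > 0" using \<rho> \<eta> by (simp add: s_def)
    have FB: "fin_section B n \<in> Lp p" and FA: "fin_section A n \<in> Lp p" using BL AL by simp_all
    define u where "u = fin_section B n x"
    have ul: "u \<in> lp_space p" and uP: "Proj n u = u" using FB xl by (simp_all add: u_def fin_section_def Proj_Proj)
    have us: "lp_norm p u \<le> s * lp_norm p x"
      using lp_norm_le_diff[OF ul Lp_lp[OF FA xl]] close[OF x] \<rho>(2)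
        lp_norm_minus_commute[of u "fin_section A n x"]
      by (simp add: u_def s_def distrib_right)
    define H where "H = {h::int^'n. idx_norm h \<le> int n + 3 * int k}"
    let ?\<phi> = "\<lambda>h i. g (h - i)" and ?\<psi> = "\<lambda>h i. g' (h - i)"
    have gs: "idx_norm j \<le> 3 * int k" if "g j \<noteq> 0" for j using g_supp[OF that] by linarith
    have gs': "idx_norm j \<le> 3 * int k" if "g' j \<noteq> 0" for j using that by (simp add: g'_def split: if_splits)
    have f: "(\<Sum>h\<in>H. lp_norm p (Mult (?\<phi> h) x) powr ?q) = V * lp_norm p x powr ?q"
      unfolding V_def by (rule sum_translates[OF p x gb(1) gs H_def])
    have a: "(\<Sum>h\<in>H. lp_norm p (Mult (?\<phi> h) u) powr ?q) \<le> s powr ?q * (V * lp_norm p x powr ?q)"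
    proof -
      have "(\<Sum>h\<in>H. lp_norm p (Mult (?\<phi> h) u) powr ?q) = V * lp_norm p u powr ?q"
        unfolding V_def by (rule sum_translates[OF p uP gb(1) gs H_def])
      also have "\<dots> \<le> V * (s * lp_norm p x) powr ?q"
        using V0 us ul q by (intro mult_left_mono powr_mono2) auto
      finally show ?thesis using s xl by (simp add: powr_mult mult_ac)
    qed
    have b: "(\<Sum>h\<in>H. (\<epsilon> * lp_norm p (Mult (?\<psi> h) x)) powr ?q) \<le> \<eta> powr ?q * (V * lp_norm p x powr ?q)"
    proof -
      have "(\<Sum>h\<in>H. (\<epsilon> * lp_norm p (Mult (?\<psi> h) x)) powr ?q) = \<epsilon> powr ?q * (\<Sum>h\<in>H. lp_norm p (Mult (?\<psi> h) x) powr ?q)"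
        using \<epsilon> xl gb by (simp add: powr_mult sum_distrib_left)
      also have "(\<Sum>h\<in>H. lp_norm p (Mult (?\<psi> h) x) powr ?q) = W * lp_norm p x powr ?q"
        unfolding W_def by (rule sum_translates[OF p x gb(3) gs' H_def])
      also have "\<epsilon> powr ?q * (W * lp_norm p x powr ?q) \<le> \<epsilon> powr ?q * ((c3 powr ?q * V) * lp_norm p x powr ?q)"
      proof (intro mult_left_mono mult_right_mono)
        have "c3 powr 1 \<le> c3 powr ?q" using c3 q by (intro powr_mono) auto
        then have "c3 * V \<le> c3 powr ?q * V" using c3 V0 by (intro mult_right_mono) auto
        then show "W \<le> c3 powr ?q * V" using W by linarith
      qed auto
      also have "\<dots> = (\<epsilon> * c3) powr ?q * (V * lp_norm p x powr ?q)"
        using \<epsilon> c3 by (simp add: powr_mult)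
      also have "\<epsilon> * c3 = \<eta>" using c3 by (simp add: \<epsilon>_def)
      finally show ?thesis .
    qed
    have nn: "0 \<le> lp_norm p (Mult (?\<phi> h) x) \<and> 0 \<le> lp_norm p (Mult (?\<phi> h) u) \<and> 0 \<le> \<epsilon> * lp_norm p (Mult (?\<psi> h) x)" for h
      using xl ul gb \<epsilon> by simp
    have "\<exists>h\<in>H. lp_norm p (Mult (?\<phi> h) x) > 0 \<and>
        lp_norm p (Mult (?\<phi> h) u) + \<epsilon> * lp_norm p (Mult (?\<psi> h) x) \<le> (s + \<eta>) * lp_norm p (Mult (?\<phi> h) x)"
      by (rule weighted_pigeonhole[OF _ nn q s \<eta> f _ a b]) (use V0 pos in \<open>auto simp: H_def\<close>)
    then obtain h where h: "lp_norm p (Mult (?\<phi> h) x) > 0"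
      "lp_norm p (Mult (?\<phi> h) u) + \<epsilon> * lp_norm p (Mult (?\<psi> h) x) \<le> (s + \<eta>) * lp_norm p (Mult (?\<phi> h) x)"
      by blast
    let ?y = "Mult (?\<phi> h) x"
    have yl: "?y \<in> lp_space p" and yP: "Proj n ?y = ?y" using xl gb x by (simp_all add: Mult_Proj[symmetric])
    have "lp_norm p (fin_section A n ?y) \<le> lp_norm p (fin_section B n ?y) + \<eta> * lp_norm p ?y"
      using lp_norm_le_diff[OF Lp_lp[OF FA yl] Lp_lp[OF FB yl]] close[OF yP] by linarith
    also have "lp_norm p (fin_section B n ?y) \<le> lp_norm p (Mult (?\<phi> h) u) + \<epsilon> * lp_norm p (Mult (?\<psi> h) x)"
      using lp_norm_le_diff[OF Lp_lp[OF FB yl] lp_Mult[OF ul, of "?\<phi> h", OF gb(2)]] commB[OF x, of h]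
      unfolding u_def by linarith
    also note h(2)
    finally have "lp_norm p (fin_section A n ?y) \<le> (s + 2 * \<eta>) * lp_norm p ?y" by (simp add: algebra_simps)
    also have "\<dots> \<le> (\<rho> + \<delta>) * lp_norm p ?y"
      using h(1) \<eta> by (intro mult_right_mono) (auto simp: s_def \<eta>_def)
    finally have "quot p A n ?y \<le> \<rho> + \<delta>" using h(1) by (simp add: field_simps)
    moreover have "?y \<noteq> (\<lambda>i. 0)" using h(1) by auto
    moreover have "idx_norm (i - h) \<le> 2 * int k" if "g (h - i) \<noteq> 0" for i
      using g_supp[OF that] by (simp add: idx_norm_minus_commute)
    ultimately show "\<exists>h \<phi>. good_cutoff p A \<delta> (2 * int k) n x h \<phi>"
      using gb unfolding \<rho>_def by (intro exI[of _ h] exI[of _ "?\<phi> h"]) auto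
  qed
qed

lemma localisation:
  fixes A :: "('n::finite, 'a::complex_banach) seq_op"
  assumes A: "A \<in> band_dominated p" and \<delta>: "\<delta> > 0"
  shows "\<exists>R. localises p A \<delta> R"
  using localisation_sup[OF _ A \<delta>] localisation_finite[OF _ _ A \<delta>] by blast

text \<open>Localisation with loss \<open>2\<^sup>-\<^sup>l\<close> is applied for \<open>l = j - 1, \<dots>, 0\<close>, each time to the piece found before. A site in the last and smallest piece
  belongs to all of them, and the losses from \<open>l\<close> onwards add up to at most \<open>2 \<cdot> 2\<^sup>-\<^sup>l\<close>, independently of \<open>j\<close>.\<close>

lemma nested_localisation:
  fixes A :: "('n::finite, 'a::complex_banach) seq_op"
  assumes A: "A \<in> band_dominated p"
  shows "\<exists>R. \<forall>j n x. Proj n x = x \<longrightarrow> x \<noteq> (\<lambda>i. 0) \<longrightarrow>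
    (\<exists>y i0. x i0 \<noteq> 0 \<and> (\<forall>l<j. Proj n (y l) = y l \<and> y l i0 \<noteq> 0 \<and>
      (\<forall>i. y l i \<noteq> 0 \<longrightarrow> idx_norm (i - i0) \<le> R l) \<and>
      quot p A n (y l)
        \<le> quot p A n x + (\<Sum>s\<in>{l..<j}. (1/2) ^ s)))"
proof -
  have "\<forall>l. \<exists>R. localises p A ((1/2) ^ l) R"
    by (intro allI localisation[OF A]) simp
  then obtain R where R: "\<And>l n x. Proj n x = x \<Longrightarrow> x \<noteq> (\<lambda>i. 0) \<Longrightarrow>
    (\<exists>h \<phi>. good_cutoff p A ((1/2) ^ l) (R l) n x h \<phi>)" by metis
  have "\<exists>y i0. x i0 \<noteq> 0 \<and> (\<forall>l<j. Proj n (y l) = y l \<and> y l i0 \<noteq> 0 \<and>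
      (\<forall>i. y l i \<noteq> 0 \<longrightarrow> idx_norm (i - i0) \<le> 2 * R l) \<and>
      quot p A n (y l) \<le> quot p A n x + (\<Sum>s\<in>{l..<j}. (1/2) ^ s))"
    if "Proj n x = x" "x \<noteq> (\<lambda>i. 0)" for j n x
    using that
  proof (induction j arbitrary: x)
    case 0
    then show ?case by auto
  next
    case (Suc j)
    obtain h \<phi> where \<phi>: "\<And>i. \<phi> i \<noteq> 0 \<Longrightarrow> idx_norm (i - h) \<le> R j" "Mult \<phi> x \<noteq> (\<lambda>i. 0)"
      "quot p A n (Mult \<phi> x) \<le> quot p A n x + (1/2) ^ j"
      using R[OF Suc.prems, of j] by blast
    let ?z = "Mult \<phi> x"
    have zP: "Proj n ?z = ?z" using Suc.prems(1) by (simp add: Mult_Proj[symmetric])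
    obtain y i0 where i0: "?z i0 \<noteq> 0" and y: "\<And>l. l < j \<Longrightarrow> Proj n (y l) = y l \<and> y l i0 \<noteq> 0 \<and>
      (\<forall>i. y l i \<noteq> 0 \<longrightarrow> idx_norm (i - i0) \<le> 2 * R l) \<and>
      quot p A n (y l) \<le> quot p A n ?z + (\<Sum>s\<in>{l..<j}. (1/2) ^ s)"
      using Suc.IH[OF zP \<phi>(2)] by blast
    let ?y = "y(j := ?z)"
    have diam: "idx_norm (i - i0) \<le> 2 * R j" if "?z i \<noteq> 0" for i
    proof -
      have "\<phi> i \<noteq> 0" "\<phi> i0 \<noteq> 0" using that i0 by (auto simp: Mult_def)
      then show ?thesis using \<phi>(1)[of i] \<phi>(1)[of i0] idx_norm_triangle_minus[of i i0 h]
        by (simp add: idx_norm_minus_commute[of h])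
    qed
    have "Proj n (?y l) = ?y l \<and> ?y l i0 \<noteq> 0 \<and> (\<forall>i. ?y l i \<noteq> 0 \<longrightarrow> idx_norm (i - i0) \<le> 2 * R l) \<and>
        quot p A n (?y l) \<le> quot p A n x + (\<Sum>s\<in>{l..<Suc j}. (1/2) ^ s)" if l: "l < Suc j" for l
    proof (cases "l = j")
      case True
      then show ?thesis using zP i0 diam \<phi>(3) by simp
    next
      case False
      then have "l < j" using l by simp
      then show ?thesis using y[of l] \<phi>(3) False by simp
    qed
    moreover have "x i0 \<noteq> 0" using i0 by (auto simp: Mult_def)
    ultimately show ?case by blast
  qed
  then show ?thesis by (intro exI[of _ "\<lambda>l. 2 * R l"]) blast
qed

section \<open>The stability spectrum\<close>

lemma near_minimiser:
  assumes inv: "op_invertible p E T" and E: "scaling_closed p E"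
    and a: "0 < a" "a < op_norm p E (inv_into E T)"
  shows "\<exists>x\<in>E. x \<noteq> (\<lambda>i. 0) \<and> a * lp_norm p (T x) \<le> lp_norm p x"
proof (rule ccontr)
  assume no: "\<not> ?thesis"
  have bij: "bij_betw T E E" and J: "inv_into E T \<in> bounded_ops p E" using inv by (auto simp: op_invertible_def)
  have "op_norm p E (inv_into E T) \<le> a"
  proof (rule op_norm_le[OF E])
    fix y assume y: "y \<in> E"
    let ?x = "inv_into E T y"
    have "T ` E = E" using bij by (simp add: bij_betw_def)
    then have x: "?x \<in> E" "T ?x = y" using y inv_into_into[of y T E] f_inv_into_f[of y T E] by auto
    have yl: "y \<in> lp_space p" using y E by (auto simp: scaling_closed_def)
    show "lp_norm p ?x \<le> a * lp_norm p y"
      using no x a(1) yl by (cases "?x = (\<lambda>i. 0)") (auto simp: not_le)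
  qed (use a in simp)
  then show False using a by simp
qed

text \<open>The norm of the identity is one, because the range of \<open>P\<^sub>n\<close> is nonzero.\<close>

lemma fin_section_inverse_norm_ge:
  fixes A :: "('n::finite, 'a::complex_banach) seq_op"
  assumes A: "A \<in> Lp p" and v: "(v::'a) \<noteq> 0" and inv: "op_invertible p (im_Proj p n) (fin_section A n)"
  shows "1 \<le> op_norm p (im_Proj p n) (fin_section A n) * inv_norm p A n"
proof -
  let ?E = "im_Proj p n :: (int^'n \<Rightarrow> 'a) set" and ?T = "fin_section A n"
  let ?x = "Proj n (\<lambda>i. v) :: int^'n \<Rightarrow> 'a"
  have x: "?x \<in> ?E" by simp
  have "?x 0 \<noteq> 0" using v by (simp add: Proj_def)
  then have "?x \<noteq> (\<lambda>i. 0)" by (metis (mono_tags))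
  then have pos: "lp_norm p ?x > 0" using lp_norm_pos_iff[of ?x] by simp
  have J: "inv_into ?E ?T \<in> bounded_ops p ?E" using inv by (simp add: op_invertible_def)
  have "lp_norm p ?x \<le> op_norm p ?E (inv_into ?E ?T) * lp_norm p (?T ?x)"
    by (rule op_invertible_lower_bound[OF inv _ x]) simp
  also have "\<dots> \<le> op_norm p ?E (inv_into ?E ?T) * (op_norm p ?E ?T * lp_norm p ?x)"
    by (intro mult_left_mono op_norm_bound[OF fin_section_bounded_ops[OF A] _ x] op_norm_nonneg[OF J]) simp_all
  finally have "1 * lp_norm p ?x \<le> (op_norm p ?E ?T * op_norm p ?E (inv_into ?E ?T)) * lp_norm p ?x"
    by (simp add: mult_ac)
  then show ?thesis using pos by (simp only: mult_le_cancel_right_pos)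
qed

text \<open>The condition \<open>c M \<ge> 1\<close> makes the bound for the sections one for the extended sections. Passing to a tail of the
  approximating sequence discards the finitely many sections that need not be invertible.\<close>

lemma stability_spectrum_invertible:
  fixes A :: "('n::finite, 'a::complex_banach) seq_op"
  assumes A: "A \<in> band_dominated p" and M: "M > 0" "1 \<le> c * M"
    and inv: "\<And>n. n \<ge> n0 \<Longrightarrow> op_invertible p (im_Proj p n) (fin_section A n)"
    and le: "\<And>n. n \<ge> n0 \<Longrightarrow> inv_norm p A n \<le> M"
    and S: "S \<in> stability_spectrum p A c"
  shows "op_invertible p (lp_space p) S" and "Lp_norm p (inv_into (lp_space p) S) \<le> M"
proof -
  have AL: "A \<in> Lp p" using A by (simp add: band_dominated_def)
  have comm: "almost_local p A" using band_dominated_comm_bound[OF A] by blast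
  define \<nu> where "\<nu> = 1 / M"
  have c: "c > 0" using M by (smt (verit) mult_nonpos_nonneg)
  have \<nu>: "0 < \<nu>" "\<nu> \<le> c" using M by (simp_all add: \<nu>_def field_simps)
  have lowF: "\<nu> * lp_norm p x \<le> lp_norm p (fin_section A n x)" if "n \<ge> n0" "x \<in> im_Proj p n" for n x
  proof -
    have "lp_norm p x \<le> inv_norm p A n * lp_norm p (fin_section A n x)"
      by (rule op_invertible_lower_bound[OF inv[OF that(1)] _ that(2)]) simp
    also have "\<dots> \<le> M * lp_norm p (fin_section A n x)"
      using le[OF that(1)] AL im_Proj_lp[OF that(2)] by (intro mult_right_mono) auto
    finally show ?thesis using M by (simp add: \<nu>_def field_simps)
  qed
  have lowE: "\<nu> * lp_norm p x \<le> lp_norm p (ext_section A c n x)" if "n \<ge> n0" "x \<in> lp_space p" for n x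
    by (rule ext_section_lower_bound[OF AL \<nu> lowF[OF that(1)] that(2)])
  have surjE: "\<exists>x\<in>lp_space p. ext_section A c n x = y" if "n \<ge> n0" "y \<in> lp_space p" for n y
    using inv[OF that(1)] by (intro ext_section_surj[OF c _ that(2)]) (simp add: op_invertible_def bij_betw_def)
  have commE: "\<exists>r>0. \<forall>n. comm_bound p r \<epsilon> (ext_section A c n)" if "\<epsilon> > 0" for \<epsilon>
    using comm that comm_bound_ext_section[OF AL] by (meson less_imp_le)
  have "op_invertible p (lp_space p) S \<and> Lp_norm p (inv_into (lp_space p) S) \<le> 1 / \<nu>"
  proof (cases "S = A")
    case True
    have conv: "loc_conv p (\<lambda>k. ext_section A c (k + n0)) S"
      unfolding True by (rule loc_conv_subseq[OF ext_section_loc_conv[OF AL comm]]) (rule filterlim_add_const_nat_at_top)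
    have c1: "\<exists>r>0. \<forall>k. comm_bound p r \<epsilon> (ext_section A c (k + n0))" if "\<epsilon> > 0" for \<epsilon>
      using commE[OF that] by blast
    show ?thesis
      using limit_invertible[OF conv _ _ c1 \<nu>(1) lowE surjE] AL True by simp
  next
    case False
    then obtain m h where m: "filterlim m at_top sequentially" and conv0: "P_strong_lim p (\<lambda>k. Shift_conj (h k) (ext_section A c (m k))) S"
      using S unfolding stability_spectrum_def by blast
    obtain k0 where k0: "\<And>k. k \<ge> k0 \<Longrightarrow> m k \<ge> n0"
      using m unfolding filterlim_at_top eventually_sequentially by blast
    let ?B = "\<lambda>k. Shift_conj (h (k + k0)) (ext_section A c (m (k + k0)))"
    have conv: "loc_conv p ?B S"
      by (rule loc_conv_subseq[OF P_strong_lim_imp_loc_conv[OF conv0], of "\<lambda>k. k + k0"]) (rule filterlim_add_const_nat_at_top)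
    have SL: "S \<in> Lp p" using conv0 by (simp add: P_strong_lim_def)
    have c1: "\<exists>r>0. \<forall>k. comm_bound p r \<epsilon> (?B k)" if "\<epsilon> > 0" for \<epsilon>
      using commE[OF that] comm_bound_Shift[OF ext_section_Lp[OF AL]] by blast
    have low: "\<nu> * lp_norm p x \<le> lp_norm p (?B k x)" if "x \<in> lp_space p" for k x
      by (rule Shift_conj_lower_bound[OF lowE that]) (use k0 in simp_all)
    have surj: "\<exists>x\<in>lp_space p. ?B k x = y" if "y \<in> lp_space p" for k y
      by (rule Shift_conj_surj[OF surjE that]) (use k0 in simp_all)
    have BL: "?B k \<in> Lp p" for k using AL by simp
    show ?thesis
      using limit_invertible[OF conv BL SL c1 \<nu>(1) low surj] by blast
  qed
  then show "op_invertible p (lp_space p) S" "Lp_norm p (inv_into (lp_space p) S) \<le> M"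
    by (simp_all add: \<nu>_def)
qed

text \<open>It suffices to apply \<open>\<parallel>z\<parallel> \<le> \<parallel>S\<^sup>-\<^sup>1\<parallel> \<parallel>Sz\<parallel>\<close> to vectors whose quotients approach \<open>1/L\<close>.\<close>

lemma inverse_norm_ge:
  fixes S :: "('n::finite, 'a::complex_banach) seq_op"
  assumes inv: "op_invertible p (lp_space p) S" and L: "L > 0"
    and test: "\<And>\<eta>. \<eta> > 0 \<Longrightarrow> \<exists>z\<in>lp_space p. z \<noteq> (\<lambda>i. 0) \<and> lp_norm p (S z) \<le> (1 / L + \<eta>) * lp_norm p z"
  shows "L \<le> Lp_norm p (inv_into (lp_space p) S)"
proof -
  define J where "J = Lp_norm p (inv_into (lp_space p) S)"
  have "inv_into (lp_space p) S \<in> Lp p" using inv by (simp add: op_invertible_def)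
  then have J: "J \<ge> 0" by (simp add: J_def)
  have 1: "1 \<le> J * (1 / L + \<eta>)" if \<eta>: "\<eta> > 0" for \<eta>
  proof -
    obtain z where z: "z \<in> lp_space p" "z \<noteq> (\<lambda>i. 0)" "lp_norm p (S z) \<le> (1 / L + \<eta>) * lp_norm p z" using test[OF \<eta>] by blast
    have pos: "lp_norm p z > 0" using z lp_norm_pos_iff by blast
    have "lp_norm p z \<le> J * lp_norm p (S z)"
      unfolding J_def by (rule op_invertible_lower_bound[OF inv _ z(1)]) simp
    also have "\<dots> \<le> J * ((1 / L + \<eta>) * lp_norm p z)" using z(3) J by (rule mult_left_mono)
    finally have "1 * lp_norm p z \<le> (J * (1 / L + \<eta>)) * lp_norm p z" by (simp add: mult.assoc)
    then show ?thesis using pos by (simp only: mult_le_cancel_right_pos)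
  qed
  have "1 \<le> J / L + e" if e: "e > 0" for e
  proof -
    have "1 \<le> J * (1 / L + e / (J + 1))" by (rule 1) (use e J in simp)
    also have "\<dots> = J / L + e * (J / (J + 1))" by (simp add: distrib_left)
    also have "\<dots> \<le> J / L + e * 1" using e J by (intro add_left_mono mult_left_mono) auto
    finally show ?thesis by simp
  qed
  then have "1 \<le> J / L" by (rule field_le_epsilon)
  then show ?thesis using L by (simp add: J_def)
qed

text \<open>The case distinction is on the distance between the common sites of the nested pieces and the boundary of the cubes. The bound \<open>2 \<cdot> 2\<^sup>-\<^sup>l\<close>
  for the piece at scale \<open>l\<close> does not depend on the index of the section, so the limit in that index is taken first, at
  fixed \<open>l\<close>, and the same operator is then tested at all scales.\<close>

lemma spectrum_attains_limit:
  fixes A :: "('n::finite, 'a::complex_banach) seq_op"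
  assumes A: "A \<in> rich_band_dominated p"
    and specinv: "\<And>S. S \<in> stability_spectrum p A c \<Longrightarrow> op_invertible p (lp_space p) S"
    and inv: "\<And>k. op_invertible p (im_Proj p (n k)) (fin_section A (n k))"
    and pos: "\<And>k. inv_norm p A (n k) > 0"
    and n: "strict_mono n" and L: "L > 0"
    and lim: "(\<lambda>k. inv_norm p A (n k)) \<longlonglongrightarrow> L"
  shows "\<exists>S\<in>stability_spectrum p A c. L \<le> Lp_norm p (inv_into (lp_space p) S)"
proof -
  have Abd: "A \<in> band_dominated p" and rich: "rich p A" using A by (auto simp: rich_band_dominated_def)
  have AL: "A \<in> Lp p" using Abd by (simp add: band_dominated_def)
  have comm: "almost_local p A" using band_dominated_comm_bound[OF Abd] by blast
  \<comment> \<open>Slightly smaller than the norm of the inverse, so that it is exceeded by some vector, and with the same limit.\<close>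
  define a where "a k = inv_norm p A (n k) * (1 - 1 / (real k + 2))" for k
  have a0: "a k > 0" for k unfolding a_def using pos[of k] by (intro mult_pos_pos) auto
  have a_lt: "a k < inv_norm p A (n k)" for k
    unfolding a_def using pos[of k] by simp
  have "(\<lambda>k. 1 - 1 / (real k + 2)) \<longlonglongrightarrow> 1"
    using tendsto_diff[OF tendsto_const LIMSEQ_ignore_initial_segment[OF lim_1_over_n, of 2], of "1::real"]
    by (simp add: add.commute)
  from tendsto_mult[OF lim this] have a_lim: "a \<longlonglongrightarrow> L" by (simp add: a_def[abs_def])
  then have inv_a: "(\<lambda>k. 1 / a k) \<longlonglongrightarrow> 1 / L" using L by (intro tendsto_intros) auto
  define near where "near k x \<longleftrightarrow> Proj (n k) x = x \<and> x \<noteq> (\<lambda>i. 0) \<and>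
    quot p A (n k) x \<le> 1 / a k" for k x
  have "\<exists>x. near k x" for k
  proof -
    obtain x where x: "x \<in> im_Proj p (n k)" "x \<noteq> (\<lambda>i. 0)" "a k * lp_norm p (fin_section A (n k) x) \<le> lp_norm p x"
      using near_minimiser[OF inv _ a0 a_lt] by auto
    have "lp_norm p x > 0" using x lp_norm_pos_iff[OF im_Proj_lp[OF x(1)]] by blast
    then have "quot p A (n k) x \<le> 1 / a k"
      using x(3) a0[of k] by (simp add: field_simps)
    then show ?thesis using x im_Proj_iff unfolding near_def by blast
  qed
  then obtain x where "\<And>k. near k (x k)" by metis
  then have x: "\<And>k. Proj (n k) (x k) = x k" "\<And>k. x k \<noteq> (\<lambda>i. 0)"
    "\<And>k. quot p A (n k) (x k) \<le> 1 / a k" by (simp_all add: near_def)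
  obtain R where R: "\<And>j n x. Proj n x = x \<Longrightarrow> x \<noteq> (\<lambda>i. 0) \<Longrightarrow>
    (\<exists>y i0. x i0 \<noteq> 0 \<and> (\<forall>l<j. Proj n (y l) = y l \<and> y l i0 \<noteq> 0 \<and>
      (\<forall>i. y l i \<noteq> 0 \<longrightarrow> idx_norm (i - i0) \<le> R l) \<and>
      quot p A n (y l)
        \<le> quot p A n x + (\<Sum>s\<in>{l..<j}. (1/2) ^ s)))"
    using nested_localisation[OF Abd] by blast
  define local where "local k y i0 \<longleftrightarrow> x k i0 \<noteq> 0 \<and> (\<forall>l<k. Proj (n k) (y l) = y l \<and> y l i0 \<noteq> 0 \<and>
      (\<forall>i. y l i \<noteq> 0 \<longrightarrow> idx_norm (i - i0) \<le> R l) \<and>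
      lp_norm p (fin_section A (n k) (y l)) \<le> (1 / a k + 2 * (1/2) ^ l) * lp_norm p (y l))" for k y i0
  have "\<exists>y i0. local k y i0" for k
  proof -
    obtain y i0 where i0: "x k i0 \<noteq> 0" and y: "\<And>l. l < k \<Longrightarrow> Proj (n k) (y l) = y l \<and> y l i0 \<noteq> 0 \<and>
      (\<forall>i. y l i \<noteq> 0 \<longrightarrow> idx_norm (i - i0) \<le> R l) \<and>
      quot p A (n k) (y l)
        \<le> quot p A (n k) (x k) + (\<Sum>s\<in>{l..<k}. (1/2) ^ s)"
      using R[OF x(1,2), of k k] by blast
    have "lp_norm p (fin_section A (n k) (y l)) \<le> (1 / a k + 2 * (1/2) ^ l) * lp_norm p (y l)" if "l < k" for l
    proof -
      have "y l \<in> lp_space p" using y[OF that] lp_Proj[of "n k" "y l"] by simp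
      moreover have "y l \<noteq> (\<lambda>i. 0)" using y[OF that] by auto
      ultimately have "lp_norm p (y l) > 0" using lp_norm_pos_iff by blast
      moreover have "quot p A (n k) (y l) \<le> 1 / a k + 2 * (1/2) ^ l"
        using y[OF that] x(3)[of k] geometric_tail_le[of l k] by linarith
      ultimately show ?thesis by (simp add: pos_divide_le_eq)
    qed
    then show ?thesis using i0 y unfolding local_def by blast
  qed
  then obtain y ii where "\<And>k. local k (y k) (ii k)" by metis
  then have ii: "\<And>k. x k (ii k) \<noteq> 0" and y: "\<And>k l. l < k \<Longrightarrow> Proj (n k) (y k l) = y k l \<and> y k l (ii k) \<noteq> 0 \<and>
      (\<forall>i. y k l i \<noteq> 0 \<longrightarrow> idx_norm (i - ii k) \<le> R l) \<and>
      lp_norm p (fin_section A (n k) (y k l)) \<le> (1 / a k + 2 * (1/2) ^ l) * lp_norm p (y k l)"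
    by (simp_all add: local_def)
  have yl: "y k l \<in> lp_space p" "y k l \<noteq> (\<lambda>i. 0)" if "l < k" for k l
  proof -
    show "y k l \<in> lp_space p" using y[OF that] lp_Proj[of "n k" "y k l"] by simp
    show "y k l \<noteq> (\<lambda>i. 0)" using y[OF that] by auto
  qed
  have small: "\<exists>l. \<exists>k0>l. \<forall>k\<ge>k0. lp_norm p (fin_section A (n k) (y k l)) \<le> (1 / L + \<eta>) * lp_norm p (y k l)"
    if \<eta>: "\<eta> > 0" for \<eta>
  proof -
    obtain l where l: "(1/2::real) ^ l < \<eta> / 4" using real_arch_pow_inv[of "\<eta> / 4" "1 / 2"] \<eta> by auto
    have "\<forall>\<^sub>F k in sequentially. 1 / a k < 1 / L + \<eta> / 2" using \<eta> by (intro order_tendstoD(2)[OF inv_a]) simp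
    then obtain k0 where k0: "\<And>k. k \<ge> k0 \<Longrightarrow> 1 / a k < 1 / L + \<eta> / 2" unfolding eventually_sequentially by blast
    have "lp_norm p (fin_section A (n k) (y k l)) \<le> (1 / L + \<eta>) * lp_norm p (y k l)" if "k \<ge> max k0 (Suc l)" for k
    proof -
      have "l < k" using that by simp
      then have "lp_norm p (fin_section A (n k) (y k l)) \<le> (1 / a k + 2 * (1/2) ^ l) * lp_norm p (y k l)" using y by blast
      also have "\<dots> \<le> (1 / L + \<eta>) * lp_norm p (y k l)"
        using k0[of k] that l yl(1)[OF \<open>l < k\<close>] by (intro mult_right_mono) auto
      finally show ?thesis .
    qed
    then show ?thesis by (intro exI[of _ l] exI[of _ "max k0 (Suc l)"]) auto
  qed
  have ii_in: "idx_norm (ii k) \<le> int (n k)" for k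
    using ii[of k] x(1)[of k] unfolding Proj_eq_iff by blast
  show ?thesis
  \<comment> \<open>Either the sites get arbitrarily deep into the cubes, or they stay within distance \<open>D\<close> of the boundary.\<close>
  proof (cases "\<forall>D k0. \<exists>k\<ge>k0. D \<le> int (n k) - idx_norm (ii k)")
    case True
    have "A \<in> stability_spectrum p A c" by (simp add: stability_spectrum_def)
    moreover have "L \<le> Lp_norm p (inv_into (lp_space p) A)"
    proof (rule inverse_norm_ge[OF specinv[OF \<open>A \<in> stability_spectrum p A c\<close>] L])
      fix \<eta> :: real assume "\<eta> > 0"
      then have \<eta>: "\<eta> / 2 > 0" by simp
      obtain l k0 where l: "k0 > l" "\<And>k. k \<ge> k0 \<Longrightarrow> lp_norm p (fin_section A (n k) (y k l)) \<le> (1 / L + \<eta> / 2) * lp_norm p (y k l)"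
        using small[OF \<eta>] by blast
      obtain r where r: "r > 0" "comm_bound p r (\<eta> / 2) A" using comm \<eta> by blast
      obtain k where k: "k \<ge> k0" "R l + \<lceil>r\<rceil> \<le> int (n k) - idx_norm (ii k)" using True by blast
      have lk: "l < k" using l(1) k(1) by simp
      let ?y = "y k l"
      note Y = y[OF lk]
      note yL = yl[OF lk]
      have Ay: "A ?y \<in> lp_space p" using AL yL(1) by simp
      have "lp_norm p (Coproj (n k) (A ?y)) \<le> \<eta> / 2 * lp_norm p ?y"
        unfolding Coproj_eq_Mult
      proof (rule off_diagonal_out[OF AL r(2,1) yL(1), where h = "ii k" and m = "real_of_int (R l)"])
        fix i
        show "real_of_int (idx_norm (i - ii k)) \<le> real_of_int (R l)" if "?y i \<noteq> 0" using Y that by simp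
        show "real_of_int (R l) + r \<le> real_of_int (idx_norm (i - ii k))"
          if "(if idx_norm i \<le> int (n k) then 0 else 1 :: real) \<noteq> 0"
        proof -
          have "int (n k) < idx_norm i" using that by (simp split: if_splits)
          then have "R l + \<lceil>r\<rceil> \<le> idx_norm (i - ii k)"
            using k(2) idx_norm_triangle[of "i - ii k" "ii k"] by simp
          then show ?thesis by linarith
        qed
      qed auto
      moreover have "lp_norm p (Proj (n k) (A ?y)) \<le> (1 / L + \<eta> / 2) * lp_norm p ?y"
        using l(2)[OF k(1)] Y by (simp add: fin_section_def)
      moreover have "lp_norm p (A ?y) \<le> lp_norm p (Proj (n k) (A ?y)) + lp_norm p (Coproj (n k) (A ?y))"
        using lp_norm_triangle[OF lp_Proj Lp_lp[OF Lp_Coproj Ay], of "n k" "A ?y" "n k"]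
        by (simp add: Coproj_def)
      ultimately have "lp_norm p (A ?y) \<le> (1 / L + \<eta>) * lp_norm p ?y" by (simp add: algebra_simps)
      then show "\<exists>z\<in>lp_space p. z \<noteq> (\<lambda>i. 0) \<and> lp_norm p (A z) \<le> (1 / L + \<eta>) * lp_norm p z" using yL by blast
    qed
    ultimately show ?thesis by blast
  next
    case False
    then obtain D k1 where D: "\<And>k. k \<ge> k1 \<Longrightarrow> int (n k) - idx_norm (ii k) < D" by (meson not_le)
    have "\<exists>h. idx_norm h = int (n k) \<and> idx_norm (h - ii k) = int (n k) - idx_norm (ii k)" for k
      by (rule boundary_point_near[OF ii_in])
    then obtain h where h: "\<And>k. idx_norm (h k) = int (n k)" "\<And>k. idx_norm (h k - ii k) = int (n k) - idx_norm (ii k)" by metis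
    have ninf: "filterlim n at_top sequentially" using n by (rule filterlim_subseq)
    have "tends_to_infinity h"
      unfolding tends_to_infinity_def h(1) by (rule filterlim_compose[OF filterlim_int_sequentially ninf])
    then obtain \<rho> A' where \<rho>: "strict_mono (\<rho> :: nat \<Rightarrow> nat)" and lim': "limit_operator p A (h \<circ> \<rho>) A'"
      using rich unfolding rich_def by blast
    obtain \<sigma> U where \<sigma>: "strict_mono (\<sigma> :: nat \<Rightarrow> nat)"
      and U: "\<And>i. \<forall>\<^sub>F k in sequentially. (idx_norm (i + h (\<rho> (\<sigma> k))) \<le> int (n (\<rho> (\<sigma> k)))) = (i \<in> U)"
      using converging_indicators_subseq[of "\<lambda>k i. idx_norm (i + h (\<rho> k)) \<le> int (n (\<rho> k))"] by blast
    define \<tau> where "\<tau> k = \<rho> (\<sigma> k)" for k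
    have \<tau>: "strict_mono \<tau>" using \<rho> \<sigma> by (simp add: \<tau>_def[abs_def] strict_mono_def)
    have PA': "P_strong_lim p (\<lambda>k. Shift_conj (h (\<rho> k)) A) A'"
      using lim' by (simp add: limit_operator_def)
    have A'L: "A' \<in> Lp p" using PA' by (simp add: P_strong_lim_def)
    have convA: "loc_conv p (\<lambda>k. Shift_conj (h (\<tau> k)) A) A'"
      unfolding \<tau>_def by (rule loc_conv_subseq[OF P_strong_lim_imp_loc_conv[OF PA'] filterlim_subseq[OF \<sigma>]])
    obtain S where PS: "P_strong_lim p (\<lambda>k. Shift_conj (h (\<tau> k)) (ext_section A c (n (\<tau> k)))) S"
      using truncated_limit[OF AL comm A'L convA, of "\<lambda>k. n (\<tau> k)" U c] U unfolding \<tau>_def by blast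
    have SL: "S \<in> Lp p" using PS by (simp add: P_strong_lim_def)
    have Sin: "S \<in> stability_spectrum p A c"
      unfolding stability_spectrum_def
      using PS h(1) filterlim_compose[OF ninf filterlim_subseq[OF \<tau>]]
      by (intro UnI2 CollectI exI[of _ "\<lambda>k. n (\<tau> k)"] exI[of _ "\<lambda>k. h (\<tau> k)"]) auto
    have "L \<le> Lp_norm p (inv_into (lp_space p) S)"
    proof (rule inverse_norm_ge[OF specinv[OF Sin] L])
      fix \<eta> :: real assume "\<eta> > 0"
      then have \<eta>: "\<eta> / 2 > 0" by simp
      obtain l k0 where l: "k0 > l" "\<And>k. k \<ge> k0 \<Longrightarrow> lp_norm p (fin_section A (n k) (y k l)) \<le> (1 / L + \<eta> / 2) * lp_norm p (y k l)"
        using small[OF \<eta>] by blast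
      \<comment> \<open>After the shift by \<open>h\<close>, the piece at scale \<open>l\<close> lies in this cube around the origin.\<close>
      define m where "m = nat (R l + D)"
      obtain k2 where k2: "\<And>k z. k \<ge> k2 \<Longrightarrow> z \<in> lp_space p \<Longrightarrow>
          lp_norm p (\<lambda>i. Shift_conj (h (\<tau> k)) (ext_section A c (n (\<tau> k))) (Proj m z) i - S (Proj m z) i) \<le> \<eta> / 2 * lp_norm p z"
        using loc_convD(2)[OF P_strong_lim_imp_loc_conv[OF PS] \<eta>, of m] by blast
      define k where "k = max k2 (max k0 k1)"
      have k\<tau>: "k \<le> \<tau> k" using strict_mono_imp_increasing[OF \<tau>] by blast
      then have kk: "k \<ge> k2" "\<tau> k \<ge> k0" "\<tau> k \<ge> k1" "l < \<tau> k" using l(1) by (auto simp: k_def)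
      let ?y = "y (\<tau> k) l" and ?h = "h (\<tau> k)"
      note Y = y[OF kk(4)]
      note yL = yl[OF kk(4)]
      let ?z = "Shift (- ?h) ?y"
      have z: "?z \<in> lp_space p" "?z \<noteq> (\<lambda>i. 0)"
      proof -
        show "?z \<in> lp_space p" using yL by simp
        show "?z \<noteq> (\<lambda>i. 0)" 
        proof
          assume "?z = (\<lambda>i. 0)"
          then have "Shift ?h ?z = (\<lambda>i. 0)" by (simp only:) (simp add: Shift_def)
          then show False using yL(2) by simp
        qed
      qed
      have zP: "Proj m ?z = ?z"
        unfolding Proj_eq_iff
      proof (intro allI impI)
        fix i :: "int^'n" assume i: "\<not> idx_norm i \<le> int m"
        show "?z i = 0"
        proof (rule ccontr)
          assume "?z i \<noteq> 0"
          then have "idx_norm (i + ?h - ii (\<tau> k)) \<le> R l" using Y by (simp add: Shift_def)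
          then have "idx_norm i \<le> R l + D"
            using idx_norm_triangle[of "i + ?h - ii (\<tau> k)" "ii (\<tau> k) - ?h"] h(2)[of "\<tau> k"] D[OF kk(3)]
            by (simp add: idx_norm_minus_commute[of "ii (\<tau> k)"])
          moreover have "0 \<le> idx_norm i" by simp
          ultimately have "0 \<le> R l + D" by linarith
          then have "int m = R l + D" by (simp add: m_def)
          then show False using i \<open>idx_norm i \<le> R l + D\<close> by simp
        qed
      qed
      have "Coproj (n (\<tau> k)) ?y = (\<lambda>i. 0)" using Y by (simp add: Coproj_def fun_diff_def)
      then have Bz: "Shift_conj ?h (ext_section A c (n (\<tau> k))) ?z = Shift (- ?h) (fin_section A (n (\<tau> k)) ?y)"
        by (simp add: ext_section_def)
      have FL: "fin_section A (n (\<tau> k)) ?y \<in> lp_space p" using Lp_lp[OF fin_section_Lp[OF AL] yL(1)] .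
      have "lp_norm p (S ?z) \<le> lp_norm p (Shift (- ?h) (fin_section A (n (\<tau> k)) ?y))
          + lp_norm p (\<lambda>i. S ?z i - Shift (- ?h) (fin_section A (n (\<tau> k)) ?y) i)"
        by (rule lp_norm_le_diff[OF Lp_lp[OF SL z(1)]]) (use FL in simp)
      also have "lp_norm p (Shift (- ?h) (fin_section A (n (\<tau> k)) ?y)) \<le> (1 / L + \<eta> / 2) * lp_norm p ?z"
        using l(2)[OF kk(2)] by simp
      also have "lp_norm p (\<lambda>i. S ?z i - Shift (- ?h) (fin_section A (n (\<tau> k)) ?y) i) \<le> \<eta> / 2 * lp_norm p ?z"
        using k2[OF kk(1) z(1)] unfolding zP Bz
        by (simp add: lp_norm_minus_commute[of "S ?z"])
      finally have "lp_norm p (S ?z) \<le> (1 / L + \<eta>) * lp_norm p ?z" by (simp add: algebra_simps)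
      then show "\<exists>z\<in>lp_space p. z \<noteq> (\<lambda>i. 0) \<and> lp_norm p (S z) \<le> (1 / L + \<eta>) * lp_norm p z" using z by blast
    qed
    then show ?thesis using Sin by blast
  qed
qed

end

theorem corollary6p7:
  fixes A :: "('n::finite, 'a::complex_banach) seq_op" and p :: ennreal and c :: real
  assumes "p = 0 \<or> 1 \<le> p"
    and "\<exists>v::'a. v \<noteq> 0"
    and "A \<in> rich_band_dominated p"
    and "c > 0" and "c \<ge> Lp_norm p A"
    and "stable_sections p A"
  shows "(\<forall>S\<in>stability_spectrum p A c. op_invertible p (lp_space p) S) \<and>
    (\<exists>S\<^sub>0\<in>stability_spectrum p A c.
       (\<forall>S\<in>stability_spectrum p A c.
          Lp_norm p (inv_into (lp_space p) S) \<le> Lp_norm p (inv_into (lp_space p) S\<^sub>0)) \<and>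
       limsup (\<lambda>n. cond_number p (im_Proj p n) (fin_section A n))
         = ereal (Lp_norm p A * Lp_norm p (inv_into (lp_space p) S\<^sub>0)))"
proof -
  note p_valid = assms(1)
  have Abd: "A \<in> band_dominated p" using assms(3) by (simp add: rich_band_dominated_def)
  have AL: "A \<in> Lp p" using Abd by (simp add: band_dominated_def)
  have comm: "almost_local p A" using band_dominated_comm_bound[OF p_valid Abd] by blast
  define f where "f n = op_norm p (im_Proj p n) (fin_section A n)" for n
  define g where "g n = inv_norm p A n" for n
  obtain v :: 'a where v: "v \<noteq> 0" using assms(2) by blast
  obtain n0 C where n0: "\<And>n. n \<ge> n0 \<Longrightarrow> op_invertible p (im_Proj p n) (fin_section A n)" and C: "\<And>n. n \<ge> n0 \<Longrightarrow> g n \<le> C"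
    using assms(6) unfolding stable_sections_def g_def by blast
  have fg: "1 \<le> f n * g n" if "n \<ge> n0" for n
    unfolding f_def g_def by (rule fin_section_inverse_norm_ge[OF p_valid AL v n0[OF that]])
  have f0: "0 \<le> f n" and fA: "f n \<le> Lp_norm p A" for n
    unfolding f_def by (rule op_norm_nonneg[OF p_valid fin_section_bounded_ops[OF p_valid AL] scaling_closed_im_Proj[OF p_valid]],
        rule fin_section_norm_le[OF p_valid AL])
  have g0: "g n > 0" if "n \<ge> n0" for n
    using fg[OF that] f0[of n] by (smt (verit) mult_nonneg_nonpos)
  have Apos: "Lp_norm p A > 0"
    using fg[of n0] f0[of n0] fA[of n0] by (smt (verit) mult_eq_0_iff order_refl)
  have gA: "1 \<le> Lp_norm p A * g n" if "n \<ge> n0" for n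
    using fg[OF that] mult_right_mono[OF fA[of n], of "g n"] g0[OF that] by linarith
  have f_lim: "f \<longlonglongrightarrow> Lp_norm p A"
    unfolding f_def by (rule fin_section_norm_tendsto[OF p_valid AL comm])
  define \<Lambda> where "\<Lambda> = limsup (\<lambda>n. ereal (g n))"
  have "\<Lambda> \<le> ereal C"
    unfolding \<Lambda>_def by (rule Limsup_bounded) (use C in \<open>auto simp: eventually_sequentially\<close>)
  moreover have "ereal (1 / Lp_norm p A) \<le> \<Lambda>"
    unfolding \<Lambda>_def
  proof (rule order_trans[OF _ Liminf_le_Limsup[OF sequentially_bot]], rule Liminf_bounded)
    show "\<forall>\<^sub>F n in sequentially. ereal (1 / Lp_norm p A) \<le> ereal (g n)"
      using gA Apos unfolding eventually_sequentially by (auto simp: field_simps)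
  qed
  ultimately obtain L where L: "\<Lambda> = ereal L" "1 / Lp_norm p A \<le> L"
    by (cases \<Lambda>) auto
  have Lpos: "L > 0" using L(2) Apos by (meson less_le_trans zero_less_divide_1_iff)
  \<comment> \<open>The strict inequality \<open>L < M\<close> allows for the sections whose inverses exceed \<open>L\<close>.\<close>
  have upper: "op_invertible p (lp_space p) S \<and> Lp_norm p (inv_into (lp_space p) S) \<le> M"
    if S: "S \<in> stability_spectrum p A c" and M: "L < M" for S M
  proof -
    have "\<Lambda> < ereal M" using L(1) M by simp
    then have "\<forall>\<^sub>F n in sequentially. ereal (g n) < ereal M" unfolding \<Lambda>_def by (rule Limsup_lessD)
    then obtain n1 where n1: "\<And>n. n \<ge> n1 \<Longrightarrow> g n < M" unfolding eventually_sequentially by auto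
    define n2 where "n2 = max n0 n1"
    have M0: "M > 0" using M Lpos by simp
    have "1 \<le> Lp_norm p A * g n2" by (rule gA) (simp add: n2_def)
    also have "\<dots> \<le> c * M"
      using assms(4,5) n1[of n2] g0[of n2] by (intro mult_mono) (auto simp: n2_def intro: less_imp_le)
    finally have cM: "1 \<le> c * M" .
    have i: "op_invertible p (im_Proj p n) (fin_section A n)" if "n \<ge> n2" for n using n0 that by (simp add: n2_def)
    have b: "inv_norm p A n \<le> M" if "n \<ge> n2" for n
      using n1[of n] that by (simp add: n2_def g_def)
    show ?thesis using stability_spectrum_invertible[OF p_valid Abd M0 cM i b S] by blast
  qed
  have inv: "op_invertible p (lp_space p) S" if "S \<in> stability_spectrum p A c" for S
    using upper[OF that, of "L + 1"] by simp
  have le: "Lp_norm p (inv_into (lp_space p) S) \<le> L" if "S \<in> stability_spectrum p A c" for S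
    by (rule field_le_epsilon) (use upper[OF that] in simp)
  obtain r :: "nat \<Rightarrow> nat" where r: "strict_mono r" "((\<lambda>n. ereal (g n)) \<circ> r) \<longlonglongrightarrow> \<Lambda>"
    unfolding \<Lambda>_def using limsup_subseq_lim by blast
  define n where "n k = r (k + n0)" for k
  have nmono: "strict_mono n" using r(1) by (simp add: n_def[abs_def] strict_mono_def)
  have n_ge: "n k \<ge> n0" for k
    unfolding n_def using strict_mono_imp_increasing[OF r(1), of "k + n0"] by simp
  have "(\<lambda>k. g (r k)) \<longlonglongrightarrow> L" using r(2) unfolding L(1) comp_def by simp
  then have glim: "(\<lambda>k. g (n k)) \<longlonglongrightarrow> L" unfolding n_def by (rule LIMSEQ_ignore_initial_segment)
  obtain S\<^sub>0 where S0: "S\<^sub>0 \<in> stability_spectrum p A c" "L \<le> Lp_norm p (inv_into (lp_space p) S\<^sub>0)"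
    using spectrum_attains_limit[OF p_valid assms(3) inv n0[OF n_ge] g0[OF n_ge, unfolded g_def] nmono Lpos glim[unfolded g_def]]
    by blast
  have S0L: "Lp_norm p (inv_into (lp_space p) S\<^sub>0) = L" using S0 le by (simp add: order_antisym)
  have "limsup (\<lambda>n. cond_number p (im_Proj p n) (fin_section A n)) = limsup (\<lambda>n. ereal (f n) * ereal (g n))"
  proof (rule Limsup_eq)
    show "\<forall>\<^sub>F n in sequentially. cond_number p (im_Proj p n) (fin_section A n) = ereal (f n) * ereal (g n)"
      using n0 unfolding eventually_sequentially cond_number_def f_def g_def by auto
  qed
  also have "\<dots> = ereal (Lp_norm p A) * \<Lambda>"
    unfolding \<Lambda>_def by (rule ereal_limsup_lim_mult) (use f_lim Apos in simp_all)
  finally have "limsup (\<lambda>n. cond_number p (im_Proj p n) (fin_section A n)) = ereal (Lp_norm p A * L)"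
    by (simp add: L(1))
  then show ?thesis using inv S0(1) le S0L by (intro conjI ballI bexI[of _ S\<^sub>0]) auto
qed

end
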